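(* Let $\mathbf{W} = \{\mathbf{W}(t) : t \ge 0\}$ be a standard planar Brownian motion started at the origin and let $\mathbf{B} = \{\mathbf{B}(t) : t \in [0,1]\}$ be a standard planar Brownian bridge, with $\mathbf{W}$ and $\mathbf{B}$ independent. Let $$\mathrm{H} = \operatorname{hull}\left(\{\mathbf{W}(t) : t \in [0,1]\} \cup \{\mathbf{B}(t) : t \in [0,1]\}\right),$$ and let $\mathsf{L}$ be the perimeter of $\mathrm{H}$. Then $$\mathbb{E}[\mathsf{L}] = \sqrt{2\pi}\left(2 + \arctan\frac{1}{2}\right).$$
   Context: A standard planar Brownian motion is $\mathbf{W}(t) = (W_1(t), W_2(t))$ with $W_1, W_2$ independent standard one-dimensional Brownian motions started at $0$. A standard planar Brownian bridge is $\mathbf{B}(t) = (B_1(t), B_2(t))$, $t\in[0,1]$, with $B_1, B_2$ independent standard one-dimensional Brownian bridges (standard Brownian motion started at $0$ and conditioned to return to $0$ at time $1$). For $A \subseteq \mathbb{R}^2$, $\operatorname{hull}(A)$ denotes the convex hull of $A$, i.e. the smallest convex subset of $\mathbb{R}^2$ containing $A$. The perimeter of a planar convex body is the length of its boundary. *)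

theory Defs
  imports "HOL-Probability.Probability"
begin

text \<open>Processes are functions \<open>X :: real \<Rightarrow> 'a \<Rightarrow> _\<close> (time first). Only the values at times in
  \<open>{0..}\<close> (Brownian motion) or \<open>{0..1}\<close> (bridge) are constrained. Every path, and not only almost
  every path, is required to be continuous, so that functionals of whole paths are measurable
  without completing the probability space.\<close>

context prob_space
begin

definition standard_brownian_motion :: "(real \<Rightarrow> 'a \<Rightarrow> real) \<Rightarrow> bool" where
  "standard_brownian_motion X \<longleftrightarrow>
     (\<forall>t\<ge>0. random_variable borel (X t)) \<and>
     (AE \<omega> in M. X 0 \<omega> = 0) \<and>
     (\<forall>\<omega>\<in>space M. continuous_on {0..} (\<lambda>t. X t \<omega>)) \<and>
     (\<forall>s t. 0 \<le> s \<and> s < t \<longrightarrow>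
        distributed M lborel (\<lambda>\<omega>. X t \<omega> - X s \<omega>) (normal_density 0 (sqrt (t - s)))) \<and>
     (\<forall>n (t :: nat \<Rightarrow> real). 0 \<le> t 0 \<and> (\<forall>i<n. t i < t (Suc i)) \<longrightarrow>
        indep_vars (\<lambda>_. borel) (\<lambda>i \<omega>. X (t (Suc i)) \<omega> - X (t i) \<omega>) {..<n})"

end

text \<open>For \<open>0 = t 0 < t 1 < \<dots> < t n\<close> and \<open>x 0 = 0\<close> this is the joint density at
  \<open>(x 1, \<dots>, x n)\<close> of a standard Brownian motion observed at the times \<open>t 1, \<dots>, t n\<close>.\<close>

definition brownian_density :: "nat \<Rightarrow> (nat \<Rightarrow> real) \<Rightarrow> (nat \<Rightarrow> real) \<Rightarrow> real" where
  "brownian_density n t x =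
     (\<Prod>i<n. normal_density (x i) (sqrt (t (Suc i) - t i)) (x (Suc i)))"

text \<open>The event that a Brownian motion \<open>X\<close> vanishes at time 1 is null, so the conditioning is
  expressed by the conditional density
  (joint density of \<open>(X (t 1), \<dots>, X (t n), X 1)\<close> at \<open>(x 1, \<dots>, x n, 0)\<close>)
  / (density of \<open>X 1\<close> at 0),
  for all \<open>0 < t 1 < \<dots> < t n < 1\<close>.\<close>

definition bridge_density :: "nat \<Rightarrow> (nat \<Rightarrow> real) \<Rightarrow> (nat \<Rightarrow> real) \<Rightarrow> real" where
  "bridge_density n t x =
     brownian_density (Suc n) (t(0 := 0, Suc n := 1)) (x(0 := 0, Suc n := 0)) / normal_density 0 1 0"

context prob_space
begin

definition standard_brownian_bridge :: "(real \<Rightarrow> 'a \<Rightarrow> real) \<Rightarrow> bool" where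
  "standard_brownian_bridge X \<longleftrightarrow>
     (\<forall>t\<in>{0..1}. random_variable borel (X t)) \<and>
     (AE \<omega> in M. X 0 \<omega> = 0 \<and> X 1 \<omega> = 0) \<and>
     (\<forall>\<omega>\<in>space M. continuous_on {0..1} (\<lambda>t. X t \<omega>)) \<and>
     (\<forall>n (t :: nat \<Rightarrow> real).
        (\<forall>i\<in>{1..n}. 0 < t i \<and> t i < 1) \<and> (\<forall>i\<in>{1..<n}. t i < t (Suc i)) \<longrightarrow>
        distributed M (\<Pi>\<^sub>M i\<in>{1..n}. lborel) (\<lambda>\<omega>. \<lambda>i\<in>{1..n}. X (t i) \<omega>) (bridge_density n t))"

definition indep_processes ::
    "real set \<Rightarrow> (real \<Rightarrow> 'a \<Rightarrow> 'b::topological_space) \<Rightarrow>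
     real set \<Rightarrow> (real \<Rightarrow> 'a \<Rightarrow> 'b) \<Rightarrow> bool" where
  "indep_processes I X J Y \<longleftrightarrow>
     indep_var (\<Pi>\<^sub>M t\<in>I. (borel :: 'b measure)) (\<lambda>\<omega>. \<lambda>t\<in>I. X t \<omega>)
               (\<Pi>\<^sub>M t\<in>J. (borel :: 'b measure)) (\<lambda>\<omega>. \<lambda>t\<in>J. Y t \<omega>)"

definition planar_brownian_motion :: "(real \<Rightarrow> 'a \<Rightarrow> real ^ 2) \<Rightarrow> bool" where
  "planar_brownian_motion W \<longleftrightarrow>
     standard_brownian_motion (\<lambda>t \<omega>. W t \<omega> $ 1) \<and>
     standard_brownian_motion (\<lambda>t \<omega>. W t \<omega> $ 2) \<and>
     indep_processes {0..} (\<lambda>t \<omega>. W t \<omega> $ 1) {0..} (\<lambda>t \<omega>. W t \<omega> $ 2)"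

definition planar_brownian_bridge :: "(real \<Rightarrow> 'a \<Rightarrow> real ^ 2) \<Rightarrow> bool" where
  "planar_brownian_bridge B \<longleftrightarrow>
     standard_brownian_bridge (\<lambda>t \<omega>. B t \<omega> $ 1) \<and>
     standard_brownian_bridge (\<lambda>t \<omega>. B t \<omega> $ 2) \<and>
     indep_processes {0..1} (\<lambda>t \<omega>. B t \<omega> $ 1) {0..1} (\<lambda>t \<omega>. B t \<omega> $ 2)"

end

text \<open>Length is one-dimensional Hausdorff measure, which in dimension 1 needs no normalising
  constant. Boundedness of the covering sets is explicit because \<^const>\<open>diameter\<close> is unspecified
  on unbounded sets; finite covers are included via empty sets, of diameter 0.\<close>

definition hausdorff_length_pre :: "real \<Rightarrow> 'a::metric_space set \<Rightarrow> ennreal" where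
  "hausdorff_length_pre \<delta> A =
     (INF C \<in> {C :: nat \<Rightarrow> 'a set. A \<subseteq> (\<Union>i. C i) \<and> (\<forall>i. bounded (C i) \<and> diameter (C i) \<le> \<delta>)}.
        \<Sum>i. ennreal (diameter (C i)))"

definition hausdorff_length :: "'a::metric_space set \<Rightarrow> ennreal" where
  "hausdorff_length A = (SUP \<delta>\<in>{0<..}. hausdorff_length_pre \<delta> A)"

text \<open>Boundaries of planar convex bodies have finite length, so \<^const>\<open>enn2real\<close> loses nothing
  on them.\<close>

definition perimeter :: "(real ^ 2) set \<Rightarrow> real" where
  "perimeter K = enn2real (hausdorff_length (frontier K))"

end

theory Submission
  imports Defs "HOL-Real_Asymp.Real_Asymp"
begin

text \<open>By Cauchy's formula the perimeter of the hull is the integral of its support function over the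
  circle of directions. In a direction \<open>u\<close> the support function is the maximum of
  \<open>sup (W \<bullet> u)\<close> and \<open>sup (B \<bullet> u)\<close>, and by rotation invariance these are the suprema of
  an independent standard Brownian motion and bridge; so the expected perimeter is \<open>2 \<pi> E max (S, R)\<close>,
  where \<open>S\<close> has the law of \<open>\<bar>N\<bar>\<close> (reflection principle) and \<open>P (R > x) = exp (- 2 x\<^sup>2)\<close>.
  The latter holds because \<open>V s = (1 + s) b (s / (1 + s))\<close> turns a bridge \<open>b\<close> into a Brownian motion,
  and \<open>b\<close> exceeds \<open>x\<close> iff \<open>V\<close> crosses the line \<open>x (1 + s)\<close>, an event whose probability comes from the
  exponential martingale. Both passage laws are obtained by stopping at the first grid time
  above the level and refining the grid: path continuity makes the overshoot vanish, so no strong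
  Markov property is needed.\<close>

subsection \<open>Hausdorff length\<close>

text \<open>Two obstacles shape the route. The perimeter is a Hausdorff measure of a frontier, so
  the formula is proved for polygons cut out by finitely many support lines, whose edge lengths are
  explicit in the support function. The expected perimeter becomes a limit of expectations of finite
  sums over directions, and joint measurability in sample point and direction never enters. The
  perimeter must also be measurable on the whole space, including the null event of a degenerate
  hull, whose frontier is a segment counted only once. The bridge is given by conditional densities.
  Completing squares factors them into independent normal residuals, which after rescaling are the
  increments of \<open>V\<close>. The constant comes from max (S, R) = S + (R - S)^+. Here E S = E
  |N| = sqrt (2 / pi), and E (R - S)^+ integrates P (|N| \<le> x) exp (- 2 x^2) over x > 0. With y =
  x s the exponents 2 x^2 and x^2 s^2 / 2 combine to (4 + s^2) x^2 / 2, and the integral of 1 / (4 +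
  s^2) over -1 \<le> s \<le> 1 is arctan (1 / 2).\<close>

lemma diameter_le_dist:
  fixes S :: "'a::metric_space set"
  assumes "0 \<le> d" "\<And>x y. x \<in> S \<Longrightarrow> y \<in> S \<Longrightarrow> dist x y \<le> d"
  shows "diameter S \<le> d"
  using assms by (auto simp: diameter_def intro!: cSUP_least)

lemma hausdorff_length_pre_le:
  assumes "A \<subseteq> (\<Union>i. C i)" "\<And>i. bounded (C i)" "\<And>i. diameter (C i) \<le> \<delta>"
  shows "hausdorff_length_pre \<delta> A \<le> (\<Sum>i. ennreal (diameter (C i)))"
  unfolding hausdorff_length_pre_def by (rule INF_lower) (use assms in auto)

lemma hausdorff_length_pre_ge:
  assumes "\<And>C. A \<subseteq> (\<Union>i. C i) \<Longrightarrow> (\<And>i. bounded (C i)) \<Longrightarrow> (\<And>i. diameter (C i) \<le> \<delta>) \<Longrightarrow>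
    c \<le> (\<Sum>i. ennreal (diameter (C i)))"
  shows "c \<le> hausdorff_length_pre \<delta> A"
  unfolding hausdorff_length_pre_def by (rule INF_greatest) (use assms in auto)

lemma hausdorff_length_pre_antimono:
  assumes "\<delta> \<le> \<delta>'"
  shows "hausdorff_length_pre \<delta>' A \<le> hausdorff_length_pre \<delta> A"
  by (rule hausdorff_length_pre_ge, rule hausdorff_length_pre_le) (use assms in \<open>auto intro: order.trans\<close>)

lemma hausdorff_length_pre_le_length:
  "0 < \<delta> \<Longrightarrow> hausdorff_length_pre \<delta> A \<le> hausdorff_length A"
  unfolding hausdorff_length_def by (rule SUP_upper) auto

lemma hausdorff_length_leI:
  "(\<And>\<delta>. 0 < \<delta> \<Longrightarrow> hausdorff_length_pre \<delta> A \<le> c) \<Longrightarrow> hausdorff_length A \<le> c"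
  unfolding hausdorff_length_def by (rule SUP_least) auto

lemma hausdorff_length_mono:
  assumes "A \<subseteq> B"
  shows "hausdorff_length A \<le> hausdorff_length B"
proof (rule hausdorff_length_leI)
  fix \<delta> :: real assume "0 < \<delta>"
  have "hausdorff_length_pre \<delta> A \<le> hausdorff_length_pre \<delta> B"
    by (rule hausdorff_length_pre_ge, rule hausdorff_length_pre_le) (use assms in auto)
  also have "\<dots> \<le> hausdorff_length B"
    by (rule hausdorff_length_pre_le_length) fact
  finally show "hausdorff_length_pre \<delta> A \<le> hausdorff_length B" .
qed

text \<open>A cover of \<open>A\<close> of mesh \<open>\<delta> / c\<close> is mapped to a cover of
  the image of mesh \<open>\<delta>\<close>. Its members are intersected with \<open>A\<close>
  before mapping, because the Lipschitz estimate holds only there.\<close>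

lemma hausdorff_length_lipschitz_image:
  fixes f :: "'a::metric_space \<Rightarrow> 'b::metric_space"
  assumes c: "0 < c" and lip: "\<And>x y. x \<in> A \<Longrightarrow> y \<in> A \<Longrightarrow> dist (f x) (f y) \<le> c * dist x y"
  shows "hausdorff_length (f ` A) \<le> ennreal c * hausdorff_length A"
proof (rule hausdorff_length_leI)
  fix \<delta> :: real assume \<delta>: "0 < \<delta>"
  have *: "hausdorff_length_pre \<delta> (f ` A) \<le> ennreal c * (\<Sum>i. ennreal (diameter (C i)))"
    if C: "A \<subseteq> (\<Union>i. C i)" "\<And>i. bounded (C i)" "\<And>i. diameter (C i) \<le> \<delta> / c" for C
  proof -
    have d: "dist (f x) (f y) \<le> c * diameter (C i)" if "x \<in> C i \<inter> A" "y \<in> C i \<inter> A" for x y i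
    proof -
      have "dist (f x) (f y) \<le> c * dist x y" using that lip by auto
      also have "\<dots> \<le> c * diameter (C i)"
        using that c C(2) by (intro mult_left_mono diameter_bounded_bound) auto
      finally show ?thesis .
    qed
    have b: "bounded (f ` (C i \<inter> A))" for i
    proof (cases "C i \<inter> A = {}")
      case False
      then obtain x where "x \<in> C i \<inter> A" by blast
      with d show ?thesis
        unfolding bounded_any_center[where a = "f x"] by blast
    qed simp
    have dm: "diameter (f ` (C i \<inter> A)) \<le> c * diameter (C i)" for i
      by (rule diameter_le_dist) (use d c C(2) in \<open>auto intro!: mult_nonneg_nonneg diameter_ge_0\<close>)
    have "hausdorff_length_pre \<delta> (f ` A) \<le> (\<Sum>i. ennreal (diameter (f ` (C i \<inter> A))))"
    proof (rule hausdorff_length_pre_le)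
      show "f ` A \<subseteq> (\<Union>i. f ` (C i \<inter> A))" using C(1) by blast
      show "diameter (f ` (C i \<inter> A)) \<le> \<delta>" for i
        using order.trans[OF dm[of i] mult_left_mono[OF C(3)[of i], of c]] c by simp
    qed (rule b)
    also have "\<dots> \<le> (\<Sum>i. ennreal c * ennreal (diameter (C i)))"
      using dm c by (intro suminf_le) (auto simp flip: ennreal_mult' intro!: ennreal_leI)
    finally show ?thesis by simp
  qed
  have "hausdorff_length_pre \<delta> (f ` A) / ennreal c \<le> hausdorff_length_pre (\<delta> / c) A"
  proof (rule hausdorff_length_pre_ge)
    fix C assume "A \<subseteq> (\<Union>i. C i)" "\<And>i::nat. bounded (C i)" "\<And>i. diameter (C i) \<le> \<delta> / c"
    from *[OF this] show "hausdorff_length_pre \<delta> (f ` A) / ennreal c \<le> (\<Sum>i. ennreal (diameter (C i)))"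
      using c by (intro divide_le_posI_ennreal) (auto simp: mult.commute)
  qed
  also have "\<dots> \<le> hausdorff_length A"
    using c \<delta> by (intro hausdorff_length_pre_le_length) auto
  finally have "ennreal c * (hausdorff_length_pre \<delta> (f ` A) / ennreal c) \<le> ennreal c * hausdorff_length A"
    by (rule mult_left_mono) simp
  also have "ennreal c * (hausdorff_length_pre \<delta> (f ` A) / ennreal c) = hausdorff_length_pre \<delta> (f ` A)"
    using c by (simp add: ennreal_times_divide mult.commute[of "ennreal c"] mult_divide_eq_ennreal)
  finally show "hausdorff_length_pre \<delta> (f ` A) \<le> ennreal c * hausdorff_length A" .
qed

text \<open>Two sequences of covering sets are merged into one by sending them to the even and the
  odd indices; this bounds the sum belonging to the merged cover.\<close>

lemma suminf_interleave_le:
  fixes f g :: "nat \<Rightarrow> ennreal"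
  shows "(\<Sum>i. if even i then f (i div 2) else g (i div 2)) \<le> suminf f + suminf g"
proof -
  let ?h = "\<lambda>i. if even i then f (i div 2) else g (i div 2)"
  have eq: "(\<Sum>i<2*n. ?h i) = (\<Sum>i<n. f i) + (\<Sum>i<n. g i)" for n
    by (induction n) (auto simp: algebra_simps)
  have "(\<Sum>i<n. ?h i) \<le> suminf f + suminf g" for n
  proof -
    have "(\<Sum>i<n. ?h i) \<le> (\<Sum>i<2*n. ?h i)" by (rule sum_mono2) auto
    also have "\<dots> \<le> suminf f + suminf g"
      unfolding eq by (intro add_mono sum_le_suminf) auto
    finally show ?thesis .
  qed
  then show ?thesis
    unfolding suminf_eq_SUP by (intro SUP_least) (simp add: suminf_eq_SUP)
qed

lemma hausdorff_length_Un_le: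
  "hausdorff_length (A \<union> B) \<le> hausdorff_length A + hausdorff_length B"
proof (rule hausdorff_length_leI)
  fix \<delta> :: real assume \<delta>: "0 < \<delta>"
  let ?p = "hausdorff_length_pre \<delta>"
  have 1: "?p (A \<union> B) \<le> (\<Sum>i. ennreal (diameter (C i))) + (\<Sum>i. ennreal (diameter (D i)))"
    if C: "A \<subseteq> (\<Union>i. C i)" "\<And>i. bounded (C i)" "\<And>i. diameter (C i) \<le> \<delta>"
     and D: "B \<subseteq> (\<Union>i. D i)" "\<And>i. bounded (D i)" "\<And>i. diameter (D i) \<le> \<delta>" for C D
  proof -
    let ?E = "\<lambda>i. if even i then C (i div 2) else D (i div 2)"
    have "?p (A \<union> B) \<le> (\<Sum>i. ennreal (diameter (?E i)))"
    proof (rule hausdorff_length_pre_le)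
      show "A \<union> B \<subseteq> (\<Union>i. ?E i)"
      proof
        fix x assume "x \<in> A \<union> B"
        then consider i where "x \<in> C i" | i where "x \<in> D i" using C D by blast
        then show "x \<in> (\<Union>i. ?E i)"
        proof cases
          case 1 then show ?thesis by (intro UN_I[of "2*i"]) auto
        next
          case 2 then show ?thesis by (intro UN_I[of "2*i+1"]) auto
        qed
      qed
    qed (use C D in auto)
    also have "\<dots> = (\<Sum>i. if even i then ennreal (diameter (C (i div 2))) else ennreal (diameter (D (i div 2))))"
      by (intro suminf_cong) auto
    also have "\<dots> \<le> (\<Sum>i. ennreal (diameter (C i))) + (\<Sum>i. ennreal (diameter (D i)))"
      by (rule suminf_interleave_le)
    finally show ?thesis .
  qed
  \<comment> \<open>The two infima are taken one after the other: with the cover of \<open>B\<close>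
    fixed, its finite sum is subtracted, and what remains is a lower bound for every cover of
    \<open>A\<close>. An infinite sum has to be split off because the subtraction is then
    meaningless.\<close>
  have 2: "?p (A \<union> B) \<le> ?p A + S"
    if D: "B \<subseteq> (\<Union>i. D i)" "\<And>i. bounded (D i)" "\<And>i. diameter (D i) \<le> \<delta>"
      and S: "S = (\<Sum>i. ennreal (diameter (D i)))" for D S
  proof (cases "S = \<top>")
    case False
    have "?p (A \<union> B) - S \<le> ?p A"
      by (rule hausdorff_length_pre_ge)
        (use 1[OF _ _ _ D] False in \<open>auto simp: ennreal_minus_le_iff add.commute S\<close>)
    with False show ?thesis by (auto simp: ennreal_minus_le_iff add.commute)
  qed simp
  have "?p (A \<union> B) \<le> ?p A + ?p B"
  proof (cases "?p A = \<top>")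
    case False
    then have "?p (A \<union> B) - ?p A \<le> ?p B"
      by (intro hausdorff_length_pre_ge) (auto simp: ennreal_minus_le_iff intro: 2)
    with False show ?thesis by (auto simp: ennreal_minus_le_iff)
  qed simp
  also have "\<dots> \<le> hausdorff_length A + hausdorff_length B"
    using \<delta> by (intro add_mono hausdorff_length_pre_le_length)
  finally show "?p (A \<union> B) \<le> hausdorff_length A + hausdorff_length B" .
qed

lemma hausdorff_length_empty [simp]: "hausdorff_length {} = 0"
proof -
  have "hausdorff_length ({}::'a set) \<le> 0"
  proof (rule hausdorff_length_leI)
    fix \<delta> :: real assume "0 < \<delta>"
    then show "hausdorff_length_pre \<delta> ({}::'a set) \<le> 0"
      using hausdorff_length_pre_le[of "{}::'a set" "\<lambda>_. {}" \<delta>] by simp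
  qed
  then show ?thesis by simp
qed

lemma hausdorff_length_UN_le:
  "finite I \<Longrightarrow> hausdorff_length (\<Union>i\<in>I. A i) \<le> (\<Sum>i\<in>I. hausdorff_length (A i))"
proof (induction I rule: finite_induct)
  case (insert i I)
  have "hausdorff_length (\<Union>j\<in>insert i I. A j) \<le> hausdorff_length (A i) + hausdorff_length (\<Union>j\<in>I. A j)"
    using hausdorff_length_Un_le[of "A i" "\<Union>j\<in>I. A j"] by simp
  also have "\<dots> \<le> hausdorff_length (A i) + (\<Sum>j\<in>I. hausdorff_length (A j))"
    by (intro add_left_mono insert.IH)
  finally show ?case using insert by simp
qed simp

text \<open>At a mesh below the distance of the two sets no covering set meets both, so a cover of
  the union splits into a cover of \<open>A\<close> and a cover of \<open>B\<close> without counting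
  any set twice.\<close>

lemma hausdorff_length_Un_disjoint_ge:
  fixes A B :: "'a::heine_borel set"
  assumes "compact A" "closed B" "A \<inter> B = {}"
  shows "hausdorff_length A + hausdorff_length B \<le> hausdorff_length (A \<union> B)"
proof -
  obtain d where d: "0 < d" "\<And>x y. x \<in> A \<Longrightarrow> y \<in> B \<Longrightarrow> d \<le> dist x y"
    using separate_compact_closed[OF assms] by blast
  let ?p = hausdorff_length_pre
  have *: "?p \<delta> A + ?p \<epsilon> B \<le> hausdorff_length (A \<union> B)" if "0 < \<delta>" "0 < \<epsilon>" for \<delta> \<epsilon>
  proof -
    \<comment> \<open>One mesh serves both sets, since the pre-measure only grows when the mesh
      shrinks; \<open>d / 2\<close> keeps it strictly below the distance.\<close>
    define \<eta> where "\<eta> = min (min \<delta> \<epsilon>) (d / 2)"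
    have \<eta>: "0 < \<eta>" "\<eta> \<le> \<delta>" "\<eta> \<le> \<epsilon>" "\<eta> < d" using that d by (auto simp: \<eta>_def)
    have "?p \<delta> A + ?p \<epsilon> B \<le> ?p \<eta> A + ?p \<eta> B"
      using \<eta> by (intro add_mono hausdorff_length_pre_antimono)
    also have "\<dots> \<le> ?p \<eta> (A \<union> B)"
    proof (rule hausdorff_length_pre_ge)
      fix C assume C: "A \<union> B \<subseteq> (\<Union>i. C i)" "\<And>i::nat. bounded (C i)" "\<And>i. diameter (C i) \<le> \<eta>"
      have e: "C i \<inter> A = {} \<or> C i \<inter> B = {}" for i
      proof (rule ccontr)
        assume "\<not> (C i \<inter> A = {} \<or> C i \<inter> B = {})"
        then obtain x y where "x \<in> C i" "x \<in> A" "y \<in> C i" "y \<in> B" by auto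
        then show False
          using d(2)[of x y] diameter_bounded_bound[OF C(2), of x i y] C(3)[of i] \<eta> by simp
      qed
      have ds: "diameter (C i \<inter> X) \<le> diameter (C i)" for i X
        by (rule diameter_subset) (use C in auto)
      have "?p \<eta> A \<le> (\<Sum>i. ennreal (diameter (C i \<inter> A)))"
        by (rule hausdorff_length_pre_le) (use C in \<open>auto intro: order.trans[OF ds]\<close>)
      moreover have "?p \<eta> B \<le> (\<Sum>i. ennreal (diameter (C i \<inter> B)))"
        by (rule hausdorff_length_pre_le) (use C in \<open>auto intro: order.trans[OF ds]\<close>)
      ultimately have "?p \<eta> A + ?p \<eta> B \<le> (\<Sum>i. ennreal (diameter (C i \<inter> A)) + ennreal (diameter (C i \<inter> B)))"
        by (subst suminf_add[symmetric]) (auto intro: add_mono)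
      also have "\<dots> \<le> (\<Sum>i. ennreal (diameter (C i)))"
      proof (rule suminf_le)
        show "ennreal (diameter (C i \<inter> A)) + ennreal (diameter (C i \<inter> B)) \<le> ennreal (diameter (C i))" for i
          using e[of i] ds[of i A] ds[of i B] by (auto intro: ennreal_leI)
      qed auto
      finally show "?p \<eta> A + ?p \<eta> B \<le> (\<Sum>i. ennreal (diameter (C i)))" .
    qed
    also have "\<dots> \<le> hausdorff_length (A \<union> B)"
      by (rule hausdorff_length_pre_le_length) fact
    finally show ?thesis .
  qed
  have "hausdorff_length A + ?p \<epsilon> B \<le> hausdorff_length (A \<union> B)" if "0 < \<epsilon>" for \<epsilon>
    unfolding hausdorff_length_def[of A]
    by (subst ennreal_SUP_add_left[symmetric]) (use * that in \<open>auto intro!: SUP_least\<close>)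
  then show ?thesis
    unfolding hausdorff_length_def[of B]
    by (subst ennreal_SUP_add_right) (auto intro!: SUP_least)
qed

lemma hausdorff_length_UN_disjoint_ge:
  fixes A :: "'i \<Rightarrow> 'a::heine_borel set"
  assumes "finite I" "\<And>i. i \<in> I \<Longrightarrow> compact (A i)" "disjoint_family_on A I"
  shows "(\<Sum>i\<in>I. hausdorff_length (A i)) \<le> hausdorff_length (\<Union>i\<in>I. A i)"
  using assms
proof (induction I rule: finite_induct)
  case (insert i I)
  have dj: "disjoint_family_on A I"
    using insert.prems(2) by (rule disjoint_family_on_mono[rotated]) auto
  have "(\<Sum>j\<in>insert i I. hausdorff_length (A j)) = hausdorff_length (A i) + (\<Sum>j\<in>I. hausdorff_length (A j))"
    using insert by simp
  also have "\<dots> \<le> hausdorff_length (A i) + hausdorff_length (\<Union>j\<in>I. A j)"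
    using insert dj by (intro add_left_mono insert.IH) auto
  also have "\<dots> \<le> hausdorff_length (A i \<union> (\<Union>j\<in>I. A j))"
  proof (rule hausdorff_length_Un_disjoint_ge)
    show "closed (\<Union>j\<in>I. A j)" using insert by (intro closed_UN) (auto intro: compact_imp_closed)
    show "A i \<inter> (\<Union>j\<in>I. A j) = {}"
      using insert.prems(2) insert.hyps by (fastforce simp: disjoint_family_on_def)
  qed (use insert in auto)
  finally show ?case by simp
qed simp

lemma hausdorff_length_interval:
  fixes a b :: real
  assumes "a \<le> b"
  shows "hausdorff_length {a..b} = ennreal (b - a)"
proof (rule antisym)
  show "hausdorff_length {a..b} \<le> ennreal (b - a)"
  proof (rule hausdorff_length_leI)
    fix \<delta> :: real assume \<delta>: "0 < \<delta>"
    obtain n :: nat where n: "(b - a) / \<delta> < real n" using reals_Archimedean2 by blast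
    then have n0: "0 < n" using assms \<delta> by (cases n) (auto simp: divide_less_0_iff)
    define w where "w = (b - a) / n"
    have w: "0 \<le> w" "w \<le> \<delta>" "real n * w = b - a" using assms n n0 \<delta> by (auto simp: w_def field_simps)
    define C where "C i = (if i < n then {a + real i * w .. a + real (Suc i) * w} else {})" for i
    have cov: "{a..a + real m * w} \<subseteq> (\<Union>i<m. {a + real i * w .. a + real (Suc i) * w})" if "m > 0" for m
      using that
    proof (induction m rule: nat_induct_non_zero)
      case (Suc m)
      have "{a..a + real (Suc m) * w} \<subseteq> {a..a + real m * w} \<union> {a + real m * w..a + real (Suc m) * w}" by auto
      with Suc show ?case by (simp only: lessThan_Suc UN_insert) blast
    qed auto
    have "{a..b} \<subseteq> (\<Union>i<n. {a + real i * w .. a + real (Suc i) * w})"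
      using cov[OF n0] w by simp
    then have "{a..b} \<subseteq> (\<Union>i. C i)" unfolding C_def by fastforce
    moreover have "diameter (C i) = (if i < n then w else 0)" for i
      using w by (auto simp: C_def algebra_simps)
    moreover have "bounded (C i)" for i
      by (simp add: C_def)
    ultimately have "hausdorff_length_pre \<delta> {a..b} \<le> (\<Sum>i. ennreal (if i < n then w else 0))"
      using w(2) \<delta> hausdorff_length_pre_le[of "{a..b}" C \<delta>] by simp
    also have "\<dots> = (\<Sum>i<n. ennreal w)" by (subst suminf_finite[of "{..<n}"]) auto
    also have "\<dots> = ennreal (b - a)" by (subst sum_ennreal) (use w in auto)
    finally show "hausdorff_length_pre \<delta> {a..b} \<le> ennreal (b - a)" .
  qed
next
  have "ennreal (b - a) \<le> hausdorff_length_pre 1 {a..b}"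
  proof (rule hausdorff_length_pre_ge)
    fix C :: "nat \<Rightarrow> real set" assume C: "{a..b} \<subseteq> (\<Union>i. C i)" "\<And>i. bounded (C i)"
    \<comment> \<open>Each covering set is enlarged to the closed interval it spans, which has
      length at most its diameter and is Lebesgue measurable. Countable subadditivity of Lebesgue
      measure then gives the lower bound.\<close>
    define D where "D i = (if C i = {} then {} else {Inf (C i)..Sup (C i)})" for i
    have D: "C i \<subseteq> D i" for i
      using bounded_imp_bdd_above[OF C(2)[of i]] bounded_imp_bdd_below[OF C(2)[of i]]
      by (auto simp: D_def intro!: cInf_lower cSup_upper)
    have D': "D i \<in> sets lborel" for i
      by (simp add: D_def)
    have e: "emeasure lborel (D i) \<le> ennreal (diameter (C i))" for i
    proof (cases "C i = {}")
      case False
      have "Sup (C i) - diameter (C i) \<le> Inf (C i)"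
      proof (rule cInf_greatest[OF False])
        fix x assume x: "x \<in> C i"
        have "Sup (C i) \<le> x + diameter (C i)"
        proof (rule cSup_least[OF False])
          fix y assume y: "y \<in> C i"
          show "y \<le> x + diameter (C i)"
            using diameter_bounded_bound[OF C(2) x y] by (auto simp: dist_real_def)
        qed
        then show "Sup (C i) - diameter (C i) \<le> x" by simp
      qed
      moreover have "Inf (C i) \<le> Sup (C i)"
        using False C(2) by (intro cInf_le_cSup bounded_imp_bdd_above bounded_imp_bdd_below)
      ultimately show ?thesis using False by (auto simp: D_def intro!: ennreal_leI)
    qed (simp add: D_def)
    have "ennreal (b - a) = emeasure lborel {a..b}" using assms by simp
    also have "\<dots> \<le> emeasure lborel (\<Union>i. D i)"
    proof (rule emeasure_mono)
      show "{a..b} \<subseteq> (\<Union>i. D i)" using C(1) D by blast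
    qed (use D' in auto)
    also have "\<dots> \<le> (\<Sum>i. emeasure lborel (D i))"
      using D' by (intro emeasure_subadditive_countably) auto
    also have "\<dots> \<le> (\<Sum>i. ennreal (diameter (C i)))" by (intro suminf_le e) auto
    finally show "ennreal (b - a) \<le> (\<Sum>i. ennreal (diameter (C i)))" .
  qed
  also have "\<dots> \<le> hausdorff_length {a..b}" by (rule hausdorff_length_pre_le_length) simp
  finally show "ennreal (b - a) \<le> hausdorff_length {a..b}" .
qed

text \<open>Both inequalities come from maps with Lipschitz constant 1: the parametrisation by arc
  length, and the orthogonal projection to the line, which inverts it.\<close>

lemma hausdorff_length_segment:
  fixes c \<tau> :: "'a::real_inner"
  assumes "norm \<tau> = 1" "a \<le> b"
  shows "hausdorff_length ((\<lambda>s. c + s *\<^sub>R \<tau>) ` {a..b}) = ennreal (b - a)"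
proof (rule antisym)
  have "dist (c + s *\<^sub>R \<tau>) (c + t *\<^sub>R \<tau>) = dist s t" for s t :: real
    using assms(1) by (simp add: dist_norm scaleR_diff_left[symmetric])
  then show "hausdorff_length ((\<lambda>s. c + s *\<^sub>R \<tau>) ` {a..b}) \<le> ennreal (b - a)"
    using hausdorff_length_lipschitz_image[of 1 "{a..b}" "\<lambda>s. c + s *\<^sub>R \<tau>"]
    by (simp add: hausdorff_length_interval[OF assms(2)])
  let ?S = "(\<lambda>s. c + s *\<^sub>R \<tau>) ` {a..b}"
  have "dist ((x - c) \<bullet> \<tau>) ((y - c) \<bullet> \<tau>) \<le> 1 * dist x y" for x y
    using Cauchy_Schwarz_ineq2[of "x - y" \<tau>] assms(1)
    by (simp add: dist_norm inner_diff_left[symmetric])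
  from hausdorff_length_lipschitz_image[OF _ this, of ?S]
  have "hausdorff_length ((\<lambda>x. (x - c) \<bullet> \<tau>) ` ?S) \<le> hausdorff_length ?S" by simp
  moreover have "(\<lambda>x. (x - c) \<bullet> \<tau>) ` ?S = {a..b}"
    using assms(1) by (simp add: image_image dot_square_norm)
  ultimately show "ennreal (b - a) \<le> hausdorff_length ?S"
    by (simp add: hausdorff_length_interval[OF assms(2)])
qed

subsection \<open>Support functions of planar convex bodies\<close>

definition dir :: "real \<Rightarrow> real ^ 2" where
  "dir t = vector [cos t, sin t]"

lemma dir_nth [simp]: "dir t $ 1 = cos t" "dir t $ 2 = sin t"
  by (simp_all add: dir_def)

lemma inner_dir [simp]: "dir s \<bullet> dir t = cos (s - t)"
  by (simp add: inner_vec_def sum_2 cos_diff)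

lemma inner_dir_right: "x \<bullet> dir t = cos t * x $ 1 + sin t * x $ 2"
  by (simp add: inner_vec_def sum_2 mult.commute)

lemma norm_dir [simp]: "norm (dir t) = 1"
  by (simp add: norm_eq_sqrt_inner)

lemma dir_periodic_int [simp]: "dir (t + of_int n * (2 * pi)) = dir t"
  using sin.plus_of_int[of t n] cos.plus_of_int[of t n]
  by (simp add: vec_eq_iff forall_2)

lemma dir_periodic [simp]: "dir (t + 2 * pi) = dir t"
  by (simp add: vec_eq_iff forall_2)

lemma dir_plus_pi [simp]: "dir (t + pi) = - dir t"
  by (simp add: vec_eq_iff forall_2)

lemma vec2_polar:
  fixes x :: "real ^ 2"
  obtains t where "x = norm x *\<^sub>R dir t"
proof -
  obtain r a where ra: "x $ 1 = r * cos a" "x $ 2 = r * sin a" using polar_Ex by blast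
  have "x = r *\<^sub>R dir a" using ra by (simp add: vec_eq_iff forall_2)
  moreover have "r *\<^sub>R dir a = \<bar>r\<bar> *\<^sub>R dir (if r \<ge> 0 then a else a + pi)" by simp
  ultimately show thesis using that by (metis abs_of_nonneg norm_dir norm_scaleR mult.right_neutral)
qed

lemma dir_decomp: "x = (x \<bullet> dir t) *\<^sub>R dir t + (x \<bullet> dir (t + pi / 2)) *\<^sub>R dir (t + pi / 2)"
proof -
  have c: "cos t * (cos t * y) + sin t * (sin t * y) = y" for y
    using sin_cos_squared_add2[of t]
    by (simp add: power2_eq_square mult.assoc[symmetric] distrib_right[symmetric])
  show ?thesis
    by (simp add: vec_eq_iff forall_2 inner_dir_right sin_add cos_add algebra_simps c)
qed

text \<open>A chord of the unit circle is no longer than its arc; its length is 2 |sin ((s - t) /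
  2)|.\<close>

lemma norm_dir_diff_le: "norm (dir s - dir t) \<le> \<bar>s - t\<bar>"
proof (rule power2_le_imp_le)
  have "(norm (dir s - dir t))\<^sup>2 = 2 - 2 * cos (s - t)"
    by (simp add: power2_norm_eq_inner inner_diff_left inner_diff_right cos_diff algebra_simps)
  also have "\<dots> = 4 * (sin ((s - t) / 2))\<^sup>2"
  proof -
    have e: "2 * ((s - t) / 2) = s - t" by simp
    show ?thesis using cos_double_sin[of "(s - t) / 2"] unfolding e by simp
  qed
  also have "\<dots> \<le> 4 * \<bar>(s - t) / 2\<bar>\<^sup>2"
    using abs_sin_x_le_abs_x[of "(s - t) / 2"]
    by (intro mult_left_mono) (metis abs_ge_zero power2_abs power_mono, simp)
  finally show "(norm (dir s - dir t))\<^sup>2 \<le> \<bar>s - t\<bar>\<^sup>2" by (simp add: power_divide)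
qed simp

definition support :: "'a::real_inner set \<Rightarrow> 'a \<Rightarrow> real" where
  "support K u = (SUP x\<in>K. x \<bullet> u)"

lemma bdd_above_inner:
  fixes K :: "'a::real_inner set"
  assumes "bounded K"
  shows "bdd_above ((\<lambda>x. x \<bullet> u) ` K)"
proof -
  obtain R where "\<And>x. x \<in> K \<Longrightarrow> norm x \<le> R" using assms by (auto simp: bounded_iff)
  then have "x \<bullet> u \<le> R * norm u" if "x \<in> K" for x
    using norm_cauchy_schwarz[of x u] that by (meson mult_right_mono norm_ge_zero order.trans)
  then show ?thesis by (auto intro!: bdd_aboveI)
qed

lemma support_le_iff:
  assumes "bounded K" "K \<noteq> {}"
  shows "support K u \<le> a \<longleftrightarrow> (\<forall>x\<in>K. x \<bullet> u \<le> a)"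
  unfolding support_def using assms by (intro cSUP_le_iff bdd_above_inner)

lemma inner_le_support: "bounded K \<Longrightarrow> x \<in> K \<Longrightarrow> x \<bullet> u \<le> support K u"
  unfolding support_def by (intro cSUP_upper bdd_above_inner)

lemma support_convex_hull:
  fixes A :: "'a::real_inner set"
  assumes "bounded A" "A \<noteq> {}"
  shows "support (convex hull A) u = support A u"
proof (rule antisym)
  have "convex hull A \<subseteq> {x. u \<bullet> x \<le> support A u}"
    using inner_le_support[OF assms(1)]
    by (intro hull_minimal convex_halfspace_le) (auto simp: inner_commute)
  then show "support (convex hull A) u \<le> support A u"
    using assms by (subst support_le_iff) (auto simp: bounded_convex_hull inner_commute)
  show "support A u \<le> support (convex hull A) u"
    using assms by (subst support_le_iff) (auto simp: hull_inc intro!: inner_le_support bounded_convex_hull)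
qed

text \<open>By the sine addition formulas the intermediate direction, multiplied by
  \<open>sin \<beta>\<close>, is a combination of the outer two with coefficients
  \<open>sin (\<beta> - \<alpha>)\<close> and \<open>sin \<alpha>\<close>, both nonnegative.
  Subadditivity and positive homogeneity of the support function give the inequality.\<close>

lemma support_dir_sublinear:
  assumes K: "bounded K" "K \<noteq> {}" and ab: "0 \<le> \<alpha>" "\<alpha> \<le> \<beta>" "\<beta> \<le> pi"
  shows "sin \<beta> * support K (dir (\<phi> + \<alpha>))
    \<le> sin (\<beta> - \<alpha>) * support K (dir \<phi>) + sin \<alpha> * support K (dir (\<phi> + \<beta>))"
proof (cases "sin \<beta> = 0")
  case True
  \<comment> \<open>The combination degenerates for opposite directions,
    \<open>\<beta> = pi\<close>; what is left of the claim is that the width is nonnegative.\<close>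
  have *: "support K (dir \<phi>) + support K (- dir \<phi>) \<ge> 0"
  proof -
    obtain x where "x \<in> K" using K by auto
    from inner_le_support[OF K(1) this, of "dir \<phi>"] inner_le_support[OF K(1) this, of "- dir \<phi>"]
    show ?thesis by simp
  qed
  have "\<beta> = 0 \<or> \<beta> = pi"
    using sin_gt_zero[of \<beta>] True ab by fastforce
  then show ?thesis
  proof
    assume [simp]: "\<beta> = pi"
    have "sin (pi - \<alpha>) = sin \<alpha>" "0 \<le> sin \<alpha>" using ab by (auto intro: sin_ge_zero)
    with * show ?thesis by (simp add: distrib_left[symmetric])
  qed (use ab in auto)
next
  case False
  then have sb: "0 < sin \<beta>" using sin_ge_zero[of \<beta>] ab by linarith
  have n: "0 \<le> sin (\<beta> - \<alpha>)" "0 \<le> sin \<alpha>" using ab by (auto intro!: sin_ge_zero)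
  have eq: "sin \<beta> *\<^sub>R dir (\<phi> + \<alpha>) = sin (\<beta> - \<alpha>) *\<^sub>R dir \<phi> + sin \<alpha> *\<^sub>R dir (\<phi> + \<beta>)"
    by (simp add: vec_eq_iff forall_2 sin_add cos_add sin_diff algebra_simps)
  let ?r = "sin (\<beta> - \<alpha>) * support K (dir \<phi>) + sin \<alpha> * support K (dir (\<phi> + \<beta>))"
  have "support K (dir (\<phi> + \<alpha>)) \<le> ?r / sin \<beta>"
  proof (subst support_le_iff[OF K], intro ballI)
    fix x assume x: "x \<in> K"
    have "sin \<beta> * (x \<bullet> dir (\<phi> + \<alpha>)) = x \<bullet> (sin \<beta> *\<^sub>R dir (\<phi> + \<alpha>))" by simp
    also have "\<dots> = sin (\<beta> - \<alpha>) * (x \<bullet> dir \<phi>) + sin \<alpha> * (x \<bullet> dir (\<phi> + \<beta>))"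
      unfolding eq by (simp add: inner_add_right)
    also have "\<dots> \<le> ?r"
      using n x K by (intro add_mono mult_left_mono inner_le_support)
    finally show "x \<bullet> dir (\<phi> + \<alpha>) \<le> ?r / sin \<beta>"
      using sb by (simp add: field_simps)
  qed
  then show ?thesis using sb by (simp add: field_simps)
qed

lemma support_dir_sublinear':
  assumes K: "bounded K" "K \<noteq> {}" and ab: "0 \<le> \<alpha>" "\<alpha> \<le> \<beta>" "\<beta> \<le> pi"
  shows "sin \<beta> * support K (dir (\<phi> - \<alpha>))
    \<le> sin (\<beta> - \<alpha>) * support K (dir \<phi>) + sin \<alpha> * support K (dir (\<phi> - \<beta>))"
  using support_dir_sublinear[OF K, of "\<beta> - \<alpha>" \<beta> "\<phi> - \<beta>"] ab by simp

text \<open>A compact convex set is the intersection of its support half-planes: the normal of a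
  hyperplane separating \<open>x\<close> from \<open>K\<close>, reversed and normalised, is a
  direction that violates the assumption.\<close>

lemma mem_convex_if_inner_dir_le_support:
  assumes K: "compact K" "convex K" "K \<noteq> {}" and le: "\<And>t. x \<bullet> dir t \<le> support K (dir t)"
  shows "x \<in> K"
proof (rule ccontr)
  assume "x \<notin> K"
  then obtain a b where ab: "a \<bullet> x < b" "\<And>y. y \<in> K \<Longrightarrow> b < a \<bullet> y"
    using separating_hyperplane_closed_point[of K x] K compact_imp_closed by blast
  obtain t where t: "- a = norm (- a) *\<^sub>R dir t" using vec2_polar .
  have "a \<noteq> 0" using ab K(3) by force
  then have na: "norm a > 0" by simp
  have "support K (dir t) \<le> - b / norm a"
  proof (subst support_le_iff, rule compact_imp_bounded[OF K(1)], rule K(3), intro ballI)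
    fix y assume "y \<in> K"
    from ab(2)[OF this] have "y \<bullet> (- a) \<le> - b" by (simp add: inner_commute)
    then have "norm a * (y \<bullet> dir t) \<le> - b" by (subst (asm) t) simp
    then show "y \<bullet> dir t \<le> - b / norm a" using na by (simp add: field_simps)
  qed
  also have "\<dots> < x \<bullet> dir t"
  proof -
    have "x \<bullet> (- a) > - b" using ab(1) by (simp add: inner_commute)
    then have "norm a * (x \<bullet> dir t) > - b" by (subst (asm) t) simp
    then show ?thesis using na by (simp add: field_simps)
  qed
  finally show False using le[of t] by simp
qed

section \<open>Monotonicity of boundary length, and degenerate bodies\<close>

text \<open>The nearest-point map of \<open>K\<close> does not increase distances and maps
  \<open>frontier L\<close> to a set containing \<open>frontier K\<close>: the ray from a frontier
  point of \<open>K\<close> along its outer normal has that point as nearest point throughout, and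
  it must cross \<open>frontier L\<close> because \<open>L\<close> is bounded.\<close>

lemma hausdorff_length_frontier_mono:
  fixes K L :: "'a::euclidean_space set"
  assumes K: "compact K" "convex K" "interior K \<noteq> {}" and L: "bounded L" and KL: "K \<subseteq> L"
  shows "hausdorff_length (frontier K) \<le> hausdorff_length (frontier L)"
proof -
  have ne: "K \<noteq> {}" and cl: "closed K" using K interior_subset compact_imp_closed by blast+
  have "frontier K \<subseteq> closest_point K ` frontier L"
  proof
    fix p assume p: "p \<in> frontier K"
    have pK: "p \<in> K" "p \<notin> rel_interior K"
      using p cl rel_interior_nonempty_interior[OF K(3)] by (auto simp: frontier_def)
    obtain a where a: "a \<noteq> 0" "\<And>y. y \<in> K \<Longrightarrow> a \<bullet> p \<le> a \<bullet> y"
      using supporting_hyperplane_rel_boundary[OF K(2) pK] by metis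
    let ?S = "(\<lambda>t. p - t *\<^sub>R a) ` {0..}"
    have "?S \<inter> frontier L \<noteq> {}"
    proof (rule connected_Int_frontier)
      show "connected ?S" by (intro connected_continuous_image continuous_intros) auto
      have "p \<in> ?S" by (rule image_eqI[of _ _ 0]) auto
      then show "?S \<inter> L \<noteq> {}" using pK KL by blast
      obtain R where R: "\<And>x. x \<in> L \<Longrightarrow> norm x \<le> R" using L by (auto simp: bounded_iff)
      \<comment> \<open>Far enough along the ray that the norm is at least |R| + 1, which no point
        of \<open>L\<close> reaches.\<close>
      define t where "t = (\<bar>R\<bar> + norm p + 1) / norm a"
      have t: "0 \<le> t" "t * norm a = \<bar>R\<bar> + norm p + 1" using a(1) by (auto simp: t_def)
      have "norm (t *\<^sub>R a) \<le> norm (p - t *\<^sub>R a) + norm p"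
        by (metis add.commute norm_minus_commute norm_triangle_sub)
      then have "\<bar>R\<bar> + 1 \<le> norm (p - t *\<^sub>R a)" using t by simp
      then have "p - t *\<^sub>R a \<notin> L" using R[of "p - t *\<^sub>R a"] by auto
      then show "?S - L \<noteq> {}" using t(1) by auto
    qed
    then obtain t where t: "0 \<le> t" "p - t *\<^sub>R a \<in> frontier L" by auto
    have "p = closest_point K (p - t *\<^sub>R a)"
    proof (rule closest_point_unique[OF K(2) cl pK(1)], intro ballI)
      fix z assume z: "z \<in> K"
      have "(norm (t *\<^sub>R a))\<^sup>2 \<le> (norm (t *\<^sub>R a + (z - p)))\<^sup>2"
      proof -
        have "0 \<le> t * (a \<bullet> (z - p))"
          using a(2)[OF z] t(1) by (intro mult_nonneg_nonneg) (auto simp: inner_diff_right)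
        moreover have "(norm (t *\<^sub>R a + v))\<^sup>2 = (norm (t *\<^sub>R a))\<^sup>2 + 2 * (t * (a \<bullet> v)) + (norm v)\<^sup>2" for v
          unfolding power2_norm_eq_inner inner_add_left inner_add_right by (simp add: inner_commute)
        ultimately show ?thesis by simp
      qed
      then have "norm (t *\<^sub>R a) \<le> norm (t *\<^sub>R a + (z - p))" by (rule power2_le_imp_le) simp
      then show "dist (p - t *\<^sub>R a) p \<le> dist (p - t *\<^sub>R a) z"
        by (simp add: dist_norm norm_minus_commute[of p "z + t *\<^sub>R a"] algebra_simps)
    qed
    then show "p \<in> closest_point K ` frontier L" using t by blast
  qed
  then have "hausdorff_length (frontier K) \<le> hausdorff_length (closest_point K ` frontier L)"
    by (rule hausdorff_length_mono)
  also have "\<dots> \<le> ennreal 1 * hausdorff_length (frontier L)"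
    by (rule hausdorff_length_lipschitz_image)
      (use closest_point_lipschitz[OF K(2) cl ne] in auto)
  finally show ?thesis by simp
qed

lemma frontier_dilation:
  fixes S :: "'a::euclidean_space set"
  assumes "c \<noteq> 0"
  shows "frontier ((\<lambda>x. a + c *\<^sub>R x) ` S) = (\<lambda>x. a + c *\<^sub>R x) ` frontier S"
proof -
  have inj: "inj ((*\<^sub>R) c :: 'a \<Rightarrow> 'a)" using assms by (auto intro: injI)
  have lin: "linear ((*\<^sub>R) c :: 'a \<Rightarrow> 'a)" by (rule linear_scaleR)
  have "frontier ((*\<^sub>R) c ` S) = (*\<^sub>R) c ` frontier S"
    unfolding frontier_def closure_injective_linear_image[OF lin inj, symmetric]
      interior_injective_linear_image[OF lin inj] image_set_diff[OF inj] ..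
  then show ?thesis
    using frontier_translation[of a "(*\<^sub>R) c ` S"] by (simp add: image_image)
qed

lemma compact_convex_empty_interior_segment:
  fixes K :: "(real ^ 2) set"
  assumes "compact K" "convex K" "K \<noteq> {}" "interior K = {}"
  obtains p q where "K = closed_segment p q"
proof -
  have "aff_dim K \<noteq> 2"
  proof
    assume "aff_dim K = 2"
    then have "affine hull K = UNIV" by (simp add: aff_dim_eq_full[symmetric])
    then have "rel_interior K = interior K" by (rule rel_interior_interior)
    with assms rel_interior_eq_empty[of K] show False by auto
  qed
  moreover have "aff_dim K \<le> 2" using aff_dim_le_DIM[of K] by simp
  ultimately have "collinear K" by (simp add: collinear_aff_dim)
  with assms that show thesis using compact_convex_collinear_segment by blast
qed

text \<open>A segment without interior is its own frontier, so its length is counted once, whereas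
  the integral of its support function would count it twice.\<close>

lemma perimeter_segment:
  fixes p q :: "real ^ 2"
  assumes "interior (closed_segment p q) = {}"
  shows "perimeter (closed_segment p q) = dist p q"
proof (cases "p = q")
  case True
  then show ?thesis
    using hausdorff_length_segment[of "axis 1 1 :: real^2" 0 0 p]
    by (simp add: perimeter_def frontier_def)
next
  case False
  define \<tau> where "\<tau> = (q - p) /\<^sub>R dist p q"
  have \<tau>: "norm \<tau> = 1" "dist p q *\<^sub>R \<tau> = q - p" using False by (auto simp: \<tau>_def dist_norm norm_minus_commute)
  have "closed_segment p q = (\<lambda>s. p + s *\<^sub>R \<tau>) ` {0..dist p q}"
  proof
    show "closed_segment p q \<subseteq> (\<lambda>s. p + s *\<^sub>R \<tau>) ` {0..dist p q}"
    proof
      fix x assume "x \<in> closed_segment p q"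
      then obtain u where u: "0 \<le> u" "u \<le> 1" "x = (1 - u) *\<^sub>R p + u *\<^sub>R q" by (auto simp: in_segment)
      have "x = p + u *\<^sub>R (q - p)" using u by (simp add: algebra_simps)
      then have "x = p + (u * dist p q) *\<^sub>R \<tau>" using \<tau>(2) by (metis scaleR_scaleR)
      then show "x \<in> (\<lambda>s. p + s *\<^sub>R \<tau>) ` {0..dist p q}"
        using u by (intro image_eqI[of _ _ "u * dist p q"]) (auto intro: mult_left_le_one_le)
    qed
    show "(\<lambda>s. p + s *\<^sub>R \<tau>) ` {0..dist p q} \<subseteq> closed_segment p q"
    proof
      fix x assume "x \<in> (\<lambda>s. p + s *\<^sub>R \<tau>) ` {0..dist p q}"
      then obtain s where s: "0 \<le> s" "s \<le> dist p q" "x = p + s *\<^sub>R \<tau>" by auto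
      have "x = p + (s / dist p q) *\<^sub>R (q - p)" unfolding \<tau>(2)[symmetric] using s False by simp
      then have "x = (1 - s / dist p q) *\<^sub>R p + (s / dist p q) *\<^sub>R q" by (simp add: algebra_simps)
      then show "x \<in> closed_segment p q" unfolding in_segment
        using s False by (intro exI[of _ "s / dist p q"]) auto
    qed
  qed
  moreover have "frontier (closed_segment p q) = closed_segment p q"
    using assms by (simp add: frontier_def)
  ultimately show ?thesis
    using hausdorff_length_segment[OF \<tau>(1), of 0 "dist p q" p] by (simp add: perimeter_def)
qed

lemma support_closed_segment:
  fixes p q :: "'a::euclidean_space"
  shows "support (closed_segment p q) u = max (p \<bullet> u) (q \<bullet> u)"
proof -
  have "support (closed_segment p q) u = support {p, q} u"
    unfolding segment_convex_hull by (rule support_convex_hull) auto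
  then show ?thesis by (simp add: support_def cSup_insert sup_max)
qed

text \<open>The widths in the two coordinate directions are the legs of a right triangle with the
  segment as hypotenuse. This expresses the perimeter of a degenerate body by four support values,
  which is what its measurability needs.\<close>

lemma perimeter_empty_interior:
  fixes K :: "(real ^ 2) set"
  assumes "compact K" "convex K" "K \<noteq> {}" "interior K = {}"
  defines "w \<equiv> \<lambda>t. support K (dir t) + support K (dir (t + pi))"
  shows "perimeter K = sqrt ((w 0)\<^sup>2 + (w (pi / 2))\<^sup>2)"
proof -
  obtain p q where K: "K = closed_segment p q"
    using compact_convex_empty_interior_segment[OF assms(1-4)] .
  have m: "max a b + max (- a) (- b) = \<bar>a - b\<bar>" for a b :: real by auto
  have "w 0 = \<bar>(p - q) $ 1\<bar>" "w (pi / 2) = \<bar>(p - q) $ 2\<bar>"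
    by (simp_all add: w_def K support_closed_segment m inner_dir_right del: dir_plus_pi)
  then show ?thesis using perimeter_segment[of p q] assms(4)
    by (simp add: K dist_norm norm_vec_def L2_set_def sum_2)
qed

section \<open>Edges and perimeter of circumscribed polygons\<close>

text \<open>The support line with normal angle \<open>\<phi>\<close>, parametrised by signed arc
  length from the foot of the perpendicular from the origin.\<close>

definition edge_point :: "(real ^ 2) set \<Rightarrow> real \<Rightarrow> real \<Rightarrow> real ^ 2" where
  "edge_point K \<phi> s = support K (dir \<phi>) *\<^sub>R dir \<phi> + s *\<^sub>R dir (\<phi> + pi / 2)"

text \<open>The parameter at which the support lines with normal angles \<open>\<phi>\<close> and
  \<open>\<phi> + \<alpha>\<close> meet. The line with normal angle \<open>\<phi> - \<alpha>\<close>
  is met at \<open>edge_min\<close> in the same way, so the two delimit an edge of a polygon whose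
  consecutive normals differ by \<open>\<alpha>\<close>.\<close>

definition edge_max :: "(real ^ 2) set \<Rightarrow> real \<Rightarrow> real \<Rightarrow> real" where
  "edge_max K \<alpha> \<phi> = (support K (dir (\<phi> + \<alpha>)) - support K (dir \<phi>) * cos \<alpha>) / sin \<alpha>"

definition edge_min :: "(real ^ 2) set \<Rightarrow> real \<Rightarrow> real \<Rightarrow> real" where
  "edge_min K \<alpha> \<phi> = - (support K (dir (\<phi> - \<alpha>)) - support K (dir \<phi>) * cos \<alpha>) / sin \<alpha>"

lemma inner_edge_point:
  "edge_point K \<phi> s \<bullet> dir \<psi> = support K (dir \<phi>) * cos (\<psi> - \<phi>) + s * sin (\<psi> - \<phi>)"
  by (simp add: edge_point_def inner_add_left cos_diff sin_diff cos_add sin_add algebra_simps)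

lemma inner_edge_point_same: "edge_point K \<phi> s \<bullet> dir \<phi> = support K (dir \<phi>)"
  by (simp add: inner_edge_point)

text \<open>After clearing \<open>sin \<alpha>\<close> this is sublinearity of the support function
  at \<open>\<phi>\<close> between its neighbours \<open>\<phi> - \<alpha>\<close> and
  \<open>\<phi> + \<alpha>\<close>; the bound on \<open>\<alpha>\<close> keeps the opening
  \<open>2 * \<alpha>\<close> within a half turn.\<close>

lemma edge_min_le_edge_max:
  assumes K: "bounded K" "K \<noteq> {}" and \<alpha>: "0 < \<alpha>" "\<alpha> \<le> pi / 2"
  shows "edge_min K \<alpha> \<phi> \<le> edge_max K \<alpha> \<phi>"
proof -
  have s: "0 < sin \<alpha>" using \<alpha> by (intro sin_gt_zero) auto
  have "sin (2 * \<alpha>) * support K (dir \<phi>)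
      \<le> sin \<alpha> * support K (dir (\<phi> - \<alpha>)) + sin \<alpha> * support K (dir (\<phi> + \<alpha>))"
    using support_dir_sublinear[OF K, of \<alpha> "2 * \<alpha>" "\<phi> - \<alpha>"] \<alpha> by (simp add: add.commute)
  then have "sin \<alpha> * (2 * cos \<alpha> * support K (dir \<phi>))
      \<le> sin \<alpha> * (support K (dir (\<phi> - \<alpha>)) + support K (dir (\<phi> + \<alpha>)))"
    unfolding sin_double by (simp add: algebra_simps)
  with s have "2 * cos \<alpha> * support K (dir \<phi>) \<le> support K (dir (\<phi> - \<alpha>)) + support K (dir (\<phi> + \<alpha>))"
    by simp
  with s show ?thesis unfolding edge_min_def edge_max_def
    by (intro divide_right_mono) auto
qed

text \<open>Sublinearity bounds the support value at \<open>\<phi> + \<alpha>\<close> by those at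
  \<open>\<phi>\<close> and \<open>\<phi> + \<beta>\<close>. The point attains the support value at
  \<open>\<phi>\<close>, so slack at \<open>\<phi> + \<alpha>\<close> forces slack at
  \<open>\<phi> + \<beta>\<close>.\<close>

lemma inner_edge_point_less:
  assumes K: "bounded K" "K \<noteq> {}" and \<alpha>: "0 < \<alpha>" "\<alpha> \<le> \<beta>" "\<beta> < pi" and s: "s < edge_max K \<alpha> \<phi>"
  shows "edge_point K \<phi> s \<bullet> dir (\<phi> + \<beta>) < support K (dir (\<phi> + \<beta>))"
proof -
  let ?g = "\<lambda>t. support K (dir t)"
  have sa: "0 < sin \<alpha>" and sb: "0 < sin \<beta>" using \<alpha> by (auto intro!: sin_gt_zero)
  have "s * sin \<alpha> < ?g (\<phi> + \<alpha>) - ?g \<phi> * cos \<alpha>"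
    using s sa by (simp add: edge_max_def field_simps)
  then have "sin \<beta> * (s * sin \<alpha>) < sin \<beta> * (?g (\<phi> + \<alpha>) - ?g \<phi> * cos \<alpha>)"
    using sb by simp
  also have "\<dots> \<le> sin (\<beta> - \<alpha>) * ?g \<phi> + sin \<alpha> * ?g (\<phi> + \<beta>) - sin \<beta> * ?g \<phi> * cos \<alpha>"
    using support_dir_sublinear[OF K, of \<alpha> \<beta> \<phi>] \<alpha> by (simp add: algebra_simps)
  also have "\<dots> = sin \<alpha> * (?g (\<phi> + \<beta>) - ?g \<phi> * cos \<beta>)"
    by (simp add: sin_diff algebra_simps)
  finally have "sin \<alpha> * (sin \<beta> * s) < sin \<alpha> * (?g (\<phi> + \<beta>) - ?g \<phi> * cos \<beta>)"
    by (simp add: mult.commute mult.left_commute)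
  with sa have "sin \<beta> * s < ?g (\<phi> + \<beta>) - ?g \<phi> * cos \<beta>" by simp
  then show ?thesis by (simp add: inner_edge_point mult.commute)
qed

lemma inner_edge_point_less':
  assumes K: "bounded K" "K \<noteq> {}" and \<alpha>: "0 < \<alpha>" "\<alpha> \<le> \<beta>" "\<beta> < pi" and s: "edge_min K \<alpha> \<phi> < s"
  shows "edge_point K \<phi> s \<bullet> dir (\<phi> - \<beta>) < support K (dir (\<phi> - \<beta>))"
proof -
  let ?g = "\<lambda>t. support K (dir t)"
  have sa: "0 < sin \<alpha>" and sb: "0 < sin \<beta>" using \<alpha> by (auto intro!: sin_gt_zero)
  have "- s * sin \<alpha> < ?g (\<phi> - \<alpha>) - ?g \<phi> * cos \<alpha>"
    using s sa by (simp add: edge_min_def field_simps)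
  then have "sin \<beta> * (- s * sin \<alpha>) < sin \<beta> * (?g (\<phi> - \<alpha>) - ?g \<phi> * cos \<alpha>)"
    using sb by (simp only: mult_less_cancel_left_pos)
  also have "\<dots> \<le> sin (\<beta> - \<alpha>) * ?g \<phi> + sin \<alpha> * ?g (\<phi> - \<beta>) - sin \<beta> * ?g \<phi> * cos \<alpha>"
    using support_dir_sublinear'[OF K, of \<alpha> \<beta> \<phi>] \<alpha> by (simp add: algebra_simps)
  also have "\<dots> = sin \<alpha> * (?g (\<phi> - \<beta>) - ?g \<phi> * cos \<beta>)"
    by (simp add: sin_diff algebra_simps)
  finally have "sin \<alpha> * (- sin \<beta> * s) < sin \<alpha> * (?g (\<phi> - \<beta>) - ?g \<phi> * cos \<beta>)"
    by (simp add: mult.commute mult.left_commute)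
  with sa have "- sin \<beta> * s < ?g (\<phi> - \<beta>) - ?g \<phi> * cos \<beta>" by (simp only: mult_less_cancel_left_pos)
  then show ?thesis by (simp add: inner_edge_point mult.commute)
qed

lemma support_neg_less:
  fixes K :: "(real ^ 2) set"
  assumes K: "bounded K" "interior K \<noteq> {}"
  shows "- support K (dir \<phi>) < support K (- dir \<phi>)"
proof -
  obtain c r where cr: "0 < r" "cball c r \<subseteq> K" using K(2) mem_interior_cball by blast
  have "c \<in> K" "c + r *\<^sub>R dir \<phi> \<in> K" using cr by (auto intro!: subsetD[OF cr(2)] simp: dist_norm)
  from inner_le_support[OF K(1) this(1), of "- dir \<phi>"] inner_le_support[OF K(1) this(2), of "dir \<phi>"] cr(1)
  show ?thesis by (simp add: inner_add_left)
qed

text \<open>The inner points of an edge lie strictly inside all other support half-planes around the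
  circle: below a half turn because of the upper end of the edge, above it because of the lower end,
  and at the opposite direction because the body has positive width.\<close>

lemma inner_edge_point_less_pos:
  assumes K: "bounded K" "interior K \<noteq> {}" and \<alpha>: "0 < \<alpha>" "\<alpha> \<le> \<beta>" "\<beta> \<le> 2 * pi - \<alpha>"
    and s: "edge_min K \<alpha> \<phi> < s" "s < edge_max K \<alpha> \<phi>"
  shows "edge_point K \<phi> s \<bullet> dir (\<phi> + \<beta>) < support K (dir (\<phi> + \<beta>))"
proof -
  have ne: "K \<noteq> {}" using K(2) by auto
  consider "\<beta> < pi" | "\<beta> = pi" | "pi < \<beta>" by linarith
  then show ?thesis
  proof cases
    case 1
    then show ?thesis using inner_edge_point_less[OF K(1) ne] assms by auto
  next
    case 2
    then show ?thesis using support_neg_less[OF K, of \<phi>] by (simp add: inner_edge_point_same)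
  next
    case 3
    have "dir (\<phi> + \<beta>) = dir (\<phi> - (2 * pi - \<beta>))"
      using dir_periodic[of "\<phi> - (2 * pi - \<beta>)"] by (simp add: algebra_simps)
    then show ?thesis
      using inner_edge_point_less'[OF K(1) ne, of \<alpha> "2 * pi - \<beta>"] 3 assms by auto
  qed
qed

definition circumscribed_polygon :: "(real ^ 2) set \<Rightarrow> nat \<Rightarrow> (real ^ 2) set" where
  "circumscribed_polygon K n =
     {x. \<forall>k<n. x \<bullet> dir (real k * (2 * pi / n)) \<le> support K (dir (real k * (2 * pi / n)))}"

text \<open>A Riemann sum of the support function over the circle in which the step 2 pi / n is
  replaced by 2 tan (pi / n), the factor that turns the sum of the edge lengths into this expression
  exactly.\<close>

definition support_sum :: "(real ^ 2) set \<Rightarrow> nat \<Rightarrow> real" where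
  "support_sum K n = 2 * tan (pi / n) * (\<Sum>k<n. support K (dir (real k * (2 * pi / n))))"

text \<open>Integer indices let an edge refer to its neighbours \<open>k - 1\<close> and
  \<open>k + 1\<close> without a separate treatment of the two ends of the index range.\<close>

lemma dir_mod:
  assumes "0 < n"
  shows "dir (of_int k * (2 * pi / real n)) = dir (real (nat (k mod int n)) * (2 * pi / real n))"
proof -
  have "real_of_int k = of_int (k mod int n) + of_int (k div int n) * real n"
    by (metis mod_div_mult_eq of_int_add of_int_mult of_int_of_nat_eq)
  then have "of_int k * (2 * pi / real n) = of_int (k mod int n) * (2 * pi / real n) + of_int (k div int n) * (2 * pi)"
    using assms by (simp add: field_simps)
  then show ?thesis using assms by simp
qed

lemma inner_dir_le_if_mem_polygon:
  assumes n: "0 < n" and x: "x \<in> circumscribed_polygon K n"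
  shows "x \<bullet> dir (of_int k * (2 * pi / n)) \<le> support K (dir (of_int k * (2 * pi / n)))"
proof -
  have "nat (k mod int n) < n" using n by (simp add: nat_less_iff)
  then show ?thesis unfolding dir_mod[OF n] using x by (auto simp: circumscribed_polygon_def)
qed

lemma subset_circumscribed_polygon: "bounded K \<Longrightarrow> K \<subseteq> circumscribed_polygon K n"
  by (auto simp: circumscribed_polygon_def intro: inner_le_support)

lemma circumscribed_polygon_Inter:
  "circumscribed_polygon K n =
     (\<Inter>k<n. {x. dir (real k * (2 * pi / n)) \<bullet> x \<le> support K (dir (real k * (2 * pi / n)))})"
  by (auto simp: circumscribed_polygon_def inner_commute)

lemma closed_circumscribed_polygon: "closed (circumscribed_polygon K n)"
  unfolding circumscribed_polygon_Inter by (intro closed_INT ballI closed_halfspace_le)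

lemma convex_circumscribed_polygon: "convex (circumscribed_polygon K n)"
  unfolding circumscribed_polygon_Inter by (intro convex_INT convex_halfspace_le)

text \<open>At a frontier point some constraint is tight, since the points where all are strict form
  an open subset of the polygon. The point then lies on that support line, and the constraints of
  the two neighbouring normals confine its parameter to the edge.\<close>

lemma frontier_circumscribed_polygon_subset:
  assumes n: "3 \<le> n"
  defines "\<alpha> \<equiv> 2 * pi / n"
  shows "frontier (circumscribed_polygon K n)
    \<subseteq> (\<Union>k<n. edge_point K (real k * \<alpha>) ` {edge_min K \<alpha> (real k * \<alpha>)..edge_max K \<alpha> (real k * \<alpha>)})"
proof
  let ?Q = "circumscribed_polygon K n"
  let ?g = "\<lambda>t. support K (dir t)"
  fix x assume "x \<in> frontier ?Q"
  then have x: "x \<in> ?Q" "x \<notin> interior ?Q"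
    using closed_circumscribed_polygon[of K n] by (auto simp: frontier_def)
  have le: "x \<bullet> dir (of_int k * \<alpha>) \<le> ?g (of_int k * \<alpha>)" for k
    unfolding \<alpha>_def using inner_dir_le_if_mem_polygon[OF _ x(1)] n by auto
  have "\<exists>k<n. x \<bullet> dir (real k * \<alpha>) = ?g (real k * \<alpha>)"
  proof (rule ccontr)
    assume "\<not> ?thesis"
    then have "x \<in> (\<Inter>k<n. {x. dir (real k * \<alpha>) \<bullet> x < ?g (real k * \<alpha>)})" (is "_ \<in> ?U")
      using le[of "int k" for k] by (force simp: inner_commute less_le)
    moreover have "open ?U" by (intro open_INT finite_lessThan ballI open_halfspace_lt)
    moreover have "?U \<subseteq> ?Q" unfolding circumscribed_polygon_Inter \<alpha>_def by force
    ultimately show False using x(2) interior_maximal by blast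
  qed
  then obtain k where k: "k < n" "x \<bullet> dir (real k * \<alpha>) = ?g (real k * \<alpha>)" by blast
  define \<phi> s where "\<phi> = real k * \<alpha>" and "s = x \<bullet> dir (\<phi> + pi / 2)"
  have xe: "x = edge_point K \<phi> s"
    using dir_decomp[of x \<phi>] k by (simp add: edge_point_def s_def \<phi>_def)
  have "0 < \<alpha>" "\<alpha> < pi" using n by (auto simp: \<alpha>_def field_simps)
  then have sa: "0 < sin \<alpha>" by (rule sin_gt_zero)
  have p: "of_int (int k + 1) * \<alpha> = \<phi> + \<alpha>" "of_int (int k - 1) * \<alpha> = \<phi> - \<alpha>"
    by (auto simp: \<phi>_def algebra_simps)
  have "edge_point K \<phi> s \<bullet> dir (\<phi> + \<alpha>) \<le> ?g (\<phi> + \<alpha>)" "edge_point K \<phi> s \<bullet> dir (\<phi> - \<alpha>) \<le> ?g (\<phi> - \<alpha>)"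
    using le[of "int k + 1"] le[of "int k - 1"] unfolding p xe by auto
  then have "edge_min K \<alpha> \<phi> \<le> s" "s \<le> edge_max K \<alpha> \<phi>"
    using sa by (auto simp: inner_edge_point edge_min_def edge_max_def field_simps)
  then show "x \<in> (\<Union>k<n. edge_point K (real k * \<alpha>) ` {edge_min K \<alpha> (real k * \<alpha>)..edge_max K \<alpha> (real k * \<alpha>)})"
    using k(1) xe unfolding \<phi>_def by (intro UN_I[of k] image_eqI[of _ _ s]) auto
qed

text \<open>An edge has length (G (k + 1) + G (k - 1) - 2 cos \<alpha> G k) / sin \<alpha>. Cyclic
  shifts do not change the sum of the G k, so the factor (2 - 2 cos \<alpha>) / sin \<alpha> = 2 tan
  (\<alpha> / 2) can be taken out.\<close>

lemma sum_edge_lengths: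
  assumes n: "4 \<le> n"
  defines "\<alpha> \<equiv> 2 * pi / n"
  shows "(\<Sum>k<n. edge_max K \<alpha> (real k * \<alpha>) - edge_min K \<alpha> (real k * \<alpha>)) = support_sum K n"
proof -
  define G where "G k = support K (dir (of_int k * \<alpha>))" for k
  have per: "G (int n) = G 0"
    using dir_periodic[of 0] n by (simp add: G_def \<alpha>_def)
  have per': "G (int n - 1) = G (- 1)"
  proof -
    have "of_int (int n - 1) * \<alpha> = - \<alpha> + 2 * pi" using n by (simp add: \<alpha>_def field_simps)
    then have "G (int n - 1) = support K (dir (- \<alpha>))" unfolding G_def by (simp only: dir_periodic)
    then show ?thesis by (simp add: G_def)
  qed
  have shift: "(\<Sum>k<n. G (int k + 1)) = (\<Sum>k<n. G (int k))"
    using sum.lessThan_Suc_shift[of "\<lambda>k. G (int k)" n] per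
    by (simp add: add.commute)
  have shift': "(\<Sum>k<n. G (int k - 1)) = (\<Sum>k<n. G (int k))"
    using sum.lessThan_Suc_shift[of "\<lambda>k. G (int k - 1)" n] per' by simp
  have \<alpha>: "0 < \<alpha>" "\<alpha> < pi" using n by (auto simp: \<alpha>_def field_simps)
  then have sa: "0 < sin \<alpha>" by (intro sin_gt_zero)
  have "sin \<alpha> * (\<Sum>k<n. edge_max K \<alpha> (real k * \<alpha>) - edge_min K \<alpha> (real k * \<alpha>))
      = (\<Sum>k<n. G (int k + 1) + G (int k - 1) - 2 * cos \<alpha> * G (int k))"
    unfolding sum_distrib_left using sa
    by (intro sum.cong) (auto simp: edge_max_def edge_min_def G_def field_simps)
  also have "\<dots> = (2 - 2 * cos \<alpha>) * (\<Sum>k<n. G (int k))"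
    unfolding sum.distrib sum_subtractf shift shift' sum_distrib_left[symmetric]
    by (simp add: algebra_simps)
  also have "2 - 2 * cos \<alpha> = sin \<alpha> * (2 * tan (\<alpha> / 2))"
  proof -
    have c: "0 < cos (\<alpha> / 2)" using \<alpha> by (intro cos_gt_zero) auto
    have "sin \<alpha> = 2 * sin (\<alpha> / 2) * cos (\<alpha> / 2)" "cos \<alpha> = 1 - 2 * (sin (\<alpha> / 2))\<^sup>2"
      using sin_double[of "\<alpha> / 2"] cos_double_sin[of "\<alpha> / 2"] by simp_all
    with c show ?thesis by (simp add: tan_def power2_eq_square)
  qed
  finally have "sin \<alpha> * (\<Sum>k<n. edge_max K \<alpha> (real k * \<alpha>) - edge_min K \<alpha> (real k * \<alpha>))
    = sin \<alpha> * (2 * tan (\<alpha> / 2) * (\<Sum>k<n. G (int k)))" by (simp only: mult.assoc)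
  with sa show ?thesis by (simp add: support_sum_def G_def \<alpha>_def)
qed

lemma support_sum_nonneg:
  assumes K: "bounded K" "K \<noteq> {}" and n: "4 \<le> n"
  shows "0 \<le> support_sum K n"
proof -
  have "0 < 2 * pi / real n" "2 * pi / real n \<le> pi / 2" using n by (auto simp: field_simps)
  then show ?thesis
    unfolding sum_edge_lengths[OF n, symmetric]
    by (intro sum_nonneg) (simp add: edge_min_le_edge_max[OF K])
qed

lemma hausdorff_length_frontier_polygon_le:
  assumes K: "bounded K" "K \<noteq> {}" and n: "4 \<le> n"
  shows "hausdorff_length (frontier (circumscribed_polygon K n)) \<le> ennreal (support_sum K n)"
proof -
  define \<alpha> where "\<alpha> = 2 * pi / n"
  have \<alpha>: "0 < \<alpha>" "\<alpha> \<le> pi / 2" using n by (auto simp: \<alpha>_def field_simps)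
  let ?E = "\<lambda>k. edge_point K (real k * \<alpha>) ` {edge_min K \<alpha> (real k * \<alpha>)..edge_max K \<alpha> (real k * \<alpha>)}"
  have "hausdorff_length (frontier (circumscribed_polygon K n)) \<le> hausdorff_length (\<Union>k<n. ?E k)"
    using frontier_circumscribed_polygon_subset[of n K] n unfolding \<alpha>_def
    by (intro hausdorff_length_mono) simp
  also have "\<dots> \<le> (\<Sum>k<n. hausdorff_length (?E k))" by (rule hausdorff_length_UN_le) simp
  also have "\<dots> = (\<Sum>k<n. ennreal (edge_max K \<alpha> (real k * \<alpha>) - edge_min K \<alpha> (real k * \<alpha>)))"
    unfolding edge_point_def
    by (intro sum.cong refl hausdorff_length_segment edge_min_le_edge_max K \<alpha>) simp
  also have "\<dots> = ennreal (support_sum K n)"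
    unfolding sum_edge_lengths[OF n, folded \<alpha>_def, symmetric]
    using edge_min_le_edge_max[OF K \<alpha>] by (intro sum_ennreal) auto
  finally show ?thesis .
qed

text \<open>Neighbouring edges share a vertex, so additivity is applied to the edges shortened by
  \<open>\<eta>\<close> at both ends; these are compact, pairwise disjoint and contained in the
  frontier. The loss of at most \<open>2 * \<eta>\<close> per edge disappears in the limit.\<close>

lemma hausdorff_length_frontier_polygon_ge:
  assumes K: "bounded K" "interior K \<noteq> {}" and n: "4 \<le> n"
  shows "ennreal (support_sum K n) \<le> hausdorff_length (frontier (circumscribed_polygon K n))"
proof -
  define \<alpha> where "\<alpha> = 2 * pi / n"
  have \<alpha>: "0 < \<alpha>" "\<alpha> \<le> pi / 2" using n by (auto simp: \<alpha>_def field_simps)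
  let ?Q = "circumscribed_polygon K n"
  define lo hi where "lo k = edge_min K \<alpha> (real k * \<alpha>)" and "hi k = edge_max K \<alpha> (real k * \<alpha>)" for k
  have less: "edge_point K (real k * \<alpha>) s \<bullet> dir (real j * \<alpha>) < support K (dir (real j * \<alpha>))"
    if kj: "k < n" "j < n" "k \<noteq> j" and s: "lo k < s" "s < hi k" for k j s
  proof -
    have na: "real n * \<alpha> = 2 * pi" using n by (simp add: \<alpha>_def)
    have *: "\<alpha> \<le> real m * \<alpha> \<and> real m * \<alpha> \<le> 2 * pi - \<alpha>" if "1 \<le> m" "m \<le> n - 1" for m
    proof -
      have "real m \<le> real n - 1" using that n by linarith
      then have "real m * \<alpha> \<le> (real n - 1) * \<alpha>" using \<alpha> by (intro mult_right_mono) auto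
      moreover have "1 * \<alpha> \<le> real m * \<alpha>" using \<alpha> that by (intro mult_right_mono) auto
      ultimately show ?thesis using na by (simp add: algebra_simps)
    qed
    show ?thesis
    proof (cases "k < j")
      case True
      have "real j * \<alpha> = real k * \<alpha> + real (j - k) * \<alpha>" using True by (simp add: of_nat_diff algebra_simps)
      then show ?thesis
        using inner_edge_point_less_pos[OF K \<alpha>(1), of "real (j - k) * \<alpha>" "real k * \<alpha>" s] *[of "j - k"] True kj s
        by (simp add: lo_def hi_def)
    next
      case False
      then have "k > j" using kj by simp
      \<comment> \<open>Turning from the normal of edge \<open>k\<close> to that of an edge
        \<open>j\<close> with smaller index passes the angle 0, hence the full turn and the index
        \<open>n + j - k\<close>.\<close>
      then have e: "real j * \<alpha> + 2 * pi = real k * \<alpha> + real (n + j - k) * \<alpha>"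
        using kj na[symmetric] by (simp add: of_nat_diff algebra_simps)
      have d: "dir (real j * \<alpha>) = dir (real k * \<alpha> + real (n + j - k) * \<alpha>)"
        unfolding e[symmetric] by simp
      show ?thesis unfolding d
        using inner_edge_point_less_pos[OF K \<alpha>(1), of "real (n + j - k) * \<alpha>" "real k * \<alpha>" s] *[of "n + j - k"] \<open>k > j\<close> kj s
        by (simp add: lo_def hi_def)
    qed
  qed
  have "ennreal (support_sum K n - 2 * real n * \<eta>) \<le> hausdorff_length (frontier ?Q)" if \<eta>: "0 < \<eta>" for \<eta>
  proof -
    define E where "E k = edge_point K (real k * \<alpha>) ` {lo k + \<eta>..hi k - \<eta>}" for k
    have len: "ennreal (hi k - lo k - 2 * \<eta>) \<le> hausdorff_length (E k)" for k
    proof (cases "lo k + \<eta> \<le> hi k - \<eta>")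
      case True
      then show ?thesis unfolding E_def edge_point_def by (subst hausdorff_length_segment) auto
    qed (simp add: ennreal_neg)
    have "support_sum K n - 2 * real n * \<eta> = (\<Sum>k<n. hi k - lo k - 2 * \<eta>)"
      using sum_edge_lengths[OF n, of K] by (simp add: sum_subtractf lo_def hi_def \<alpha>_def)
    \<comment> \<open>Edges shorter than \<open>2 * \<eta>\<close> contribute negative summands,
      which \<open>ennreal\<close> cuts off at 0; therefore only an inequality.\<close>
    also have "ennreal \<dots> \<le> (\<Sum>k<n. ennreal (hi k - lo k - 2 * \<eta>))"
    proof -
      have "ennreal (\<Sum>k<n. hi k - lo k - 2 * \<eta>) \<le> ennreal (\<Sum>k<n. max 0 (hi k - lo k - 2 * \<eta>))"
        by (intro ennreal_leI sum_mono) auto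
      also have "\<dots> = (\<Sum>k<n. ennreal (max 0 (hi k - lo k - 2 * \<eta>)))"
        by (rule sum_ennreal[symmetric]) auto
      also have "\<dots> = (\<Sum>k<n. ennreal (hi k - lo k - 2 * \<eta>))"
        by (intro sum.cong refl) (auto simp: max_def ennreal_neg)
      finally show ?thesis .
    qed
    also have "\<dots> \<le> (\<Sum>k<n. hausdorff_length (E k))" by (intro sum_mono len)
    also have "\<dots> \<le> hausdorff_length (\<Union>k<n. E k)"
    proof (rule hausdorff_length_UN_disjoint_ge)
      show "compact (E k)" for k
        unfolding E_def edge_point_def by (intro compact_continuous_image continuous_intros compact_Icc)
      show "disjoint_family_on E {..<n}"
      proof (unfold disjoint_family_on_def, safe)
        fix j k x assume jk: "j < n" "k < n" "j \<noteq> k" and x: "x \<in> E j" "x \<in> E k"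
        from x(1) have "x \<bullet> dir (real j * \<alpha>) = support K (dir (real j * \<alpha>))"
          by (auto simp: E_def inner_edge_point_same)
        moreover from x(2) have "x \<bullet> dir (real j * \<alpha>) < support K (dir (real j * \<alpha>))"
          using less[OF jk(2,1)] jk \<eta> by (auto simp: E_def)
        ultimately show "x \<in> {}" by simp
      qed
    qed simp
    also have "\<dots> \<le> hausdorff_length (frontier ?Q)"
    proof (rule hausdorff_length_mono, safe)
      fix k x assume k: "k < n" and "x \<in> E k"
      then obtain s where s': "lo k + \<eta> \<le> s" "s \<le> hi k - \<eta>" and x: "x = edge_point K (real k * \<alpha>) s"
        unfolding E_def by auto
      have s: "lo k < s" "s < hi k" using s' \<eta> by auto
      have "x \<bullet> dir (real j * \<alpha>) \<le> support K (dir (real j * \<alpha>))" if "j < n" for j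
        using less[OF k that _ s] by (cases "k = j") (auto simp: x inner_edge_point_same less_imp_le)
      then have xQ: "x \<in> ?Q" by (auto simp: circumscribed_polygon_def \<alpha>_def)
      have "interior ?Q \<subseteq> interior {x. dir (real k * \<alpha>) \<bullet> x \<le> support K (dir (real k * \<alpha>))}"
        unfolding circumscribed_polygon_Inter using k by (intro interior_mono) (auto simp: \<alpha>_def)
      also have "\<dots> = {x. dir (real k * \<alpha>) \<bullet> x < support K (dir (real k * \<alpha>))}"
        by (rule interior_halfspace_le) (metis norm_dir norm_zero zero_neq_one)
      finally have "x \<notin> interior ?Q"
        using inner_edge_point_same[of K "real k * \<alpha>" s] by (auto simp: x inner_commute)
      with xQ show "x \<in> frontier ?Q" using closure_subset by (auto simp: frontier_def)
    qed
    finally show ?thesis .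
  qed
  note ge = this
  have "(\<lambda>m. ennreal (support_sum K n - 2 * real n * (1 / real (Suc m)))) \<longlonglongrightarrow> ennreal (support_sum K n - 2 * real n * 0)"
    using LIMSEQ_inverse_real_of_nat
    by (intro tendsto_ennrealI tendsto_intros) (simp add: inverse_eq_divide)
  moreover have "ennreal (support_sum K n - 2 * real n * (1 / real (Suc m)))
      \<le> hausdorff_length (frontier ?Q)" for m
    by (rule ge) simp
  ultimately show ?thesis
    using tendsto_upperbound[OF _ always_eventually] by fastforce
qed

section \<open>Approximation of a body by its circumscribed polygons\<close>

text \<open>Every direction is within \<open>\<alpha>\<close> of a normal of the polygon, so a point
  of the polygon violates the support inequality of \<open>K\<close> in any direction by at most a
  multiple of \<open>\<alpha>\<close>. The inner ball turns this additive error into a dilation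
  about its centre.\<close>

lemma circumscribed_polygon_close:
  assumes K: "compact K" "convex K" and r: "0 < r" "cball c r \<subseteq> K" and R: "K \<subseteq> cball c R" and n: "16 \<le> n"
  defines "\<alpha> \<equiv> 2 * pi / n"
  shows "circumscribed_polygon K n \<subseteq> cball c (3 * R)"
    and "circumscribed_polygon K n \<subseteq> (\<lambda>x. (c - (1 + 4 * R * \<alpha> / r) *\<^sub>R c) + (1 + 4 * R * \<alpha> / r) *\<^sub>R x) ` K"
proof -
  let ?g = "\<lambda>t. support K (dir t)"
  have bK: "bounded K" using K compact_imp_bounded by blast
  have cK: "c \<in> K" using r by (auto intro!: subsetD[OF r(2)])
  have ne: "K \<noteq> {}" using cK by auto
  have "c \<in> cball c R" using R cK by blast
  then have R0: "0 \<le> R" by simp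
  have \<alpha>: "0 < \<alpha>" "\<alpha> \<le> 1 / 2" "of_nat n * \<alpha> = 2 * pi"
  proof -
    show "\<alpha> \<le> 1 / 2" using n pi_less_4 by (simp add: \<alpha>_def field_simps)
  qed (use n in \<open>auto simp: \<alpha>_def\<close>)
  \<comment> \<open>Direction \<open>t\<close> is replaced by the normal with index floor (t /
    \<alpha>). The term \<open>R * \<alpha>\<close> pays for the change of the support value, the
    term with \<open>norm (x - c)\<close> for the change of the inner product with
    \<open>x - c\<close>.\<close>
  have step: "(x - c) \<bullet> dir t \<le> ?g t - c \<bullet> dir t + R * \<alpha> + norm (x - c) * \<alpha>"
    if x: "x \<in> circumscribed_polygon K n" for x t
  proof -
    define k where "k = \<lfloor>t / \<alpha>\<rfloor>"
    have "of_int k \<le> t / \<alpha>" "t / \<alpha> < of_int k + 1" by (auto simp: k_def)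
    then have "\<bar>t - of_int k * \<alpha>\<bar> \<le> \<alpha>" using \<alpha>(1) by (auto simp: field_simps abs_if)
    then have d: "norm (dir t - dir (of_int k * \<alpha>)) \<le> \<alpha>"
      using norm_dir_diff_le order.trans by blast
    have d': "y \<bullet> (dir t - dir (of_int k * \<alpha>)) \<le> norm y * \<alpha>"
      "y \<bullet> (dir (of_int k * \<alpha>) - dir t) \<le> norm y * \<alpha>" for y
      using norm_cauchy_schwarz[of y "dir t - dir (of_int k * \<alpha>)"]
        norm_cauchy_schwarz[of y "dir (of_int k * \<alpha>) - dir t"] mult_left_mono[OF d, of "norm y"]
      by (auto simp: norm_minus_commute)
    have "?g (of_int k * \<alpha>) \<le> c \<bullet> dir (of_int k * \<alpha>) + (?g t - c \<bullet> dir t + R * \<alpha>)"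
    proof (subst support_le_iff[OF bK ne], intro ballI)
      fix y assume y: "y \<in> K"
      have "norm (y - c) \<le> R" using R y by (auto simp: dist_norm norm_minus_commute)
      then have "norm (y - c) * \<alpha> \<le> R * \<alpha>" using \<alpha> by (intro mult_right_mono) auto
      then show "y \<bullet> dir (of_int k * \<alpha>) \<le> c \<bullet> dir (of_int k * \<alpha>) + (?g t - c \<bullet> dir t + R * \<alpha>)"
        using d'(2)[of "y - c"] inner_le_support[OF bK y, of "dir t"]
        by (simp add: inner_diff_left inner_diff_right)
    qed
    moreover have "x \<bullet> dir (of_int k * \<alpha>) \<le> ?g (of_int k * \<alpha>)"
      unfolding \<alpha>_def using n x by (intro inner_dir_le_if_mem_polygon) auto
    ultimately show ?thesis using d'(1)[of "x - c"]
      by (simp add: inner_diff_left inner_diff_right)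
  qed
  have bd: "norm (x - c) \<le> 3 * R" if x: "x \<in> circumscribed_polygon K n" for x
  proof -
    obtain t where t: "x - c = norm (x - c) *\<^sub>R dir t" using vec2_polar .
    have "(x - c) \<bullet> dir t = norm (x - c)" by (subst t) simp
    moreover have "?g t \<le> c \<bullet> dir t + R"
    proof (subst support_le_iff[OF bK ne], intro ballI)
      fix y assume "y \<in> K"
      then have "norm (y - c) \<le> R" using R by (auto simp: dist_norm norm_minus_commute)
      then show "y \<bullet> dir t \<le> c \<bullet> dir t + R"
        using norm_cauchy_schwarz[of "y - c" "dir t"] by (simp add: inner_diff_left)
    qed
    \<comment> \<open>Here \<open>16 \<le> n\<close> enters: it gives
      \<open>\<alpha> \<le> 1 / 2\<close>, so half of \<open>norm (x - c)\<close> can be absorbed on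
      the left, leaving the bound 3 R.\<close>
    moreover have "R * \<alpha> \<le> R * (1 / 2)" "norm (x - c) * \<alpha> \<le> norm (x - c) * (1 / 2)"
      using \<alpha> R0 by (intro mult_left_mono; simp)+
    ultimately show ?thesis using step[OF x, of t] by linarith
  qed
  then show "circumscribed_polygon K n \<subseteq> cball c (3 * R)"
    by (auto simp: dist_norm norm_minus_commute)
  \<comment> \<open>The total error is (R + 3 R) \<alpha> = e r. Seen from \<open>c\<close> every
    support value of \<open>K\<close> is at least \<open>r\<close>, so the error is at most
    \<open>e\<close> times that value, which a dilation by \<open>1 + e\<close> covers.\<close>
  define e where "e = 4 * R * \<alpha> / r"
  have e: "0 \<le> e" "e * r = 4 * R * \<alpha>" using R0 r(1) \<alpha> by (auto simp: e_def)
  show "circumscribed_polygon K n \<subseteq> (\<lambda>x. (c - (1 + 4 * R * \<alpha> / r) *\<^sub>R c) + (1 + 4 * R * \<alpha> / r) *\<^sub>R x) ` K"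
    unfolding e_def[symmetric]
  proof
    fix x assume x: "x \<in> circumscribed_polygon K n"
    define y where "y = c + (x - c) /\<^sub>R (1 + e)"
    have xy: "x = c - (1 + e) *\<^sub>R c + (1 + e) *\<^sub>R y"
    proof -
      have "1 + e \<noteq> 0" using e(1) by simp
      then have "(1 + e) *\<^sub>R y = (1 + e) *\<^sub>R c + (x - c)"
        unfolding y_def scaleR_add_right by (simp del: scaleR_add_left)
      then show ?thesis by simp
    qed
    have "y \<in> K"
    proof (rule mem_convex_if_inner_dir_le_support[OF K ne])
      fix t
      have "c + r *\<^sub>R dir t \<in> K" using r by (auto intro!: subsetD[OF r(2)] simp: dist_norm)
      from inner_le_support[OF bK this, of "dir t"] have gr: "r \<le> ?g t - c \<bullet> dir t"
        by (simp add: inner_add_left)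
      have "norm (x - c) * \<alpha> \<le> 3 * R * \<alpha>" using bd[OF x] \<alpha> by (intro mult_right_mono) auto
      then have "(x - c) \<bullet> dir t \<le> (?g t - c \<bullet> dir t) + e * r"
        using step[OF x, of t] e(2) by simp
      also have "\<dots> \<le> (?g t - c \<bullet> dir t) + e * (?g t - c \<bullet> dir t)"
        using gr e by (intro add_left_mono mult_left_mono)
      also have "\<dots> = (1 + e) * (?g t - c \<bullet> dir t)" by (simp add: algebra_simps)
      finally have "(x - c) \<bullet> dir t / (1 + e) \<le> ?g t - c \<bullet> dir t"
        using e(1) by (simp add: divide_le_eq mult.commute)
      then show "y \<bullet> dir t \<le> ?g t" by (simp add: y_def inner_add_left divide_inverse mult.commute)
    qed
    with xy show "x \<in> (\<lambda>x. c - (1 + e) *\<^sub>R c + (1 + e) *\<^sub>R x) ` K" by blast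
  qed
qed

text \<open>Cauchy's perimeter formula, the Riemann sums of the support function standing for its
  integral over the circle. The circumscribed polygon with \<open>n\<close> equidistant normal directions has
  perimeter \<^term>\<open>support_sum K n\<close> exactly and lies between \<open>K\<close> and a dilation of \<open>K\<close> by a
  factor \<open>1 + O(1 / n)\<close>, and boundary length is monotone for inclusion of convex bodies.\<close>

theorem support_sum_tendsto_perimeter:
  assumes K: "compact K" "convex K" "interior K \<noteq> {}"
  shows "support_sum K \<longlonglongrightarrow> perimeter K"
proof -
  obtain c r where r: "0 < r" "cball c r \<subseteq> K" using K(3) mem_interior_cball by blast
  obtain R where R: "K \<subseteq> cball c R"
    using compact_imp_bounded[OF K(1)] unfolding bounded_any_center[of K c] by (metis mem_cball subsetI)
  have ne: "K \<noteq> {}" and bK: "bounded K" using K compact_imp_bounded by auto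
  have "c \<in> cball c R" using r by (intro subsetD[OF R] subsetD[OF r(2)]) simp
  then have R0: "0 \<le> R" by simp
  define \<epsilon> where "\<epsilon> n = 4 * R * (2 * pi / real n) / r" for n
  have \<epsilon>0: "0 \<le> \<epsilon> n" for n using R0 r(1) by (simp add: \<epsilon>_def)
  define H where "H = hausdorff_length (frontier K)"
  have lower: "H \<le> ennreal (support_sum K n)" and upper: "ennreal (support_sum K n) \<le> ennreal (1 + \<epsilon> n) * H"
    if n: "16 \<le> n" for n
  proof -
    let ?Q = "circumscribed_polygon K n"
    note close = circumscribed_polygon_close[OF K(1,2) r R n, folded \<epsilon>_def]
    let ?f = "\<lambda>x. (c - (1 + \<epsilon> n) *\<^sub>R c) + (1 + \<epsilon> n) *\<^sub>R x"
    have bQ: "bounded ?Q" using close(1) bounded_cball bounded_subset by blast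
    have KQ: "K \<subseteq> ?Q" by (rule subset_circumscribed_polygon[OF bK])
    have "H \<le> hausdorff_length (frontier ?Q)"
      unfolding H_def using K bQ KQ by (rule hausdorff_length_frontier_mono)
    also have "\<dots> \<le> ennreal (support_sum K n)"
      using n by (intro hausdorff_length_frontier_polygon_le bK ne) auto
    finally show "H \<le> ennreal (support_sum K n)" .
    have "ennreal (support_sum K n) \<le> hausdorff_length (frontier ?Q)"
      using n by (intro hausdorff_length_frontier_polygon_ge bK K) auto
    also have "\<dots> \<le> hausdorff_length (frontier (?f ` K))"
    proof (rule hausdorff_length_frontier_mono)
      show "compact ?Q" using bQ closed_circumscribed_polygon compact_eq_bounded_closed by blast
      show "interior ?Q \<noteq> {}" using K(3) interior_mono[OF KQ] by blast
      show "bounded (?f ` K)"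
        by (intro compact_imp_bounded compact_continuous_image continuous_intros K)
    qed (use close(2) convex_circumscribed_polygon in auto)
    also have "\<dots> = hausdorff_length (?f ` frontier K)"
      using \<epsilon>0[of n] by (subst frontier_dilation) auto
    also have "\<dots> \<le> ennreal (1 + \<epsilon> n) * H"
      unfolding H_def using \<epsilon>0[of n]
      by (intro hausdorff_length_lipschitz_image) (auto simp: dist_norm scaleR_diff_right[symmetric])
    finally show "ennreal (support_sum K n) \<le> ennreal (1 + \<epsilon> n) * H" .
  qed
  have "H < \<top>" using lower[of 16] by (auto intro: le_less_trans)
  then have H: "H = ennreal (perimeter K)" by (simp add: perimeter_def H_def less_top)
  have p0: "0 \<le> perimeter K" by (simp add: perimeter_def)
  have ev: "\<forall>\<^sub>F n in sequentially. perimeter K \<le> support_sum K n \<and> support_sum K n \<le> (1 + \<epsilon> n) * perimeter K"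
    unfolding eventually_sequentially
  proof (intro exI[of _ 16] allI impI conjI)
    fix n :: nat assume n: "16 \<le> n"
    show "support_sum K n \<le> (1 + \<epsilon> n) * perimeter K"
      using upper[OF n] \<epsilon>0[of n] p0 unfolding H by (simp add: ennreal_mult'[symmetric] del: ennreal_plus)
    show "perimeter K \<le> support_sum K n"
    \<comment> \<open>\<open>ennreal\<close> sends negative reals to 0, so the bound in
      \<open>ennreal\<close> says nothing about the sign of the sum when the left side is 0.\<close>
    proof (cases "perimeter K = 0")
      case True
      have "0 \<le> support_sum K n"
        using n by (intro support_sum_nonneg bK ne) auto
      then show ?thesis using True by simp
    next
      case False
      then show ?thesis using lower[OF n] p0 unfolding H by (simp add: ennreal_le_iff2)
    qed
  qed
  have "\<epsilon> \<longlonglongrightarrow> 4 * R * 0 / r"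
    unfolding \<epsilon>_def using r(1) by (intro tendsto_intros lim_const_over_n) auto
  then have lim: "(\<lambda>n. (1 + \<epsilon> n) * perimeter K) \<longlonglongrightarrow> perimeter K"
    by (auto intro!: tendsto_eq_intros)
  have 1: "\<forall>\<^sub>F n in sequentially. perimeter K \<le> support_sum K n"
    and 2: "\<forall>\<^sub>F n in sequentially. support_sum K n \<le> (1 + \<epsilon> n) * perimeter K"
    using ev by (auto simp: eventually_conj_iff)
  show ?thesis by (rule tendsto_sandwich[OF 1 2 tendsto_const lim])
qed

subsection \<open>Rotations of Brownian motion and bridge\<close>

context prob_space
begin

text \<open>Independence of finitely many variables is a property of their joint law, which null
  sets do not affect. It allows a process that starts at 0 only almost surely to be exchanged for
  one whose value at time 0 is literally 0.\<close>

lemma indep_vars_cong_AE: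
  assumes "indep_vars M' X I" "\<And>i. i \<in> I \<Longrightarrow> random_variable (M' i) (Y i)" "finite I"
    "\<And>i. i \<in> I \<Longrightarrow> AE \<omega> in M. X i \<omega> = Y i \<omega>"
  shows "indep_vars M' Y I"
proof (cases "I = {}")
  case False
  have X: "\<And>i. i \<in> I \<Longrightarrow> random_variable (M' i) (X i)" using assms(1) by (auto simp: indep_vars_def)
  have ae: "AE \<omega> in M. \<forall>i\<in>I. X i \<omega> = Y i \<omega>" using assms(3,4) by (simp add: AE_ball_countable countable_finite)
  have "distr M (Pi\<^sub>M I M') (\<lambda>x. \<lambda>i\<in>I. Y i x) = distr M (Pi\<^sub>M I M') (\<lambda>x. \<lambda>i\<in>I. X i x)"
    using ae X assms(2) by (intro distr_cong_AE) (auto elim!: eventually_mono intro!: measurable_restrict)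
  also have "\<dots> = Pi\<^sub>M I (\<lambda>i. distr M (M' i) (X i))"
    using indep_vars_iff_distr_eq_PiM'[where I = I and X = X and M' = M'] assms(1) False X by auto
  also have "\<dots> = Pi\<^sub>M I (\<lambda>i. distr M (M' i) (Y i))"
    using assms by (intro PiM_cong distr_cong_AE) (auto intro: X)
  finally show ?thesis using indep_vars_iff_distr_eq_PiM'[where I = I and X = Y and M' = M'] False assms(2) by auto
qed (simp add: indep_vars_def indep_sets_def)

lemma distributed_cong_AE:
  assumes "distributed M N X f" "random_variable N Y" "AE \<omega> in M. X \<omega> = Y \<omega>"
  shows "distributed M N Y f"
proof -
  have "distr M N Y = distr M N X"
    using assms by (intro distr_cong_AE) (auto simp: distributed_def)
  with assms show ?thesis by (simp add: distributed_def)
qed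

text \<open>Independence within each family and between the two makes the doubled family
  \<open>Z\<close>, indexed by \<open>I \<times> UNIV\<close> with a boolean choosing the family,
  independent. Grouping it by the first index gives independent pairs, to which \<open>f\<close> is
  applied.\<close>

lemma indep_vars_combine:
  fixes X Y :: "'i \<Rightarrow> 'a \<Rightarrow> real" and f :: "real \<Rightarrow> real \<Rightarrow> real"
  assumes I: "finite I"
    and X: "indep_vars (\<lambda>_. borel) X I" and Y: "indep_vars (\<lambda>_. borel) Y I"
    and XY: "indep_var (Pi\<^sub>M I (\<lambda>_. borel)) (\<lambda>\<omega>. \<lambda>i\<in>I. X i \<omega>) (Pi\<^sub>M I (\<lambda>_. borel)) (\<lambda>\<omega>. \<lambda>i\<in>I. Y i \<omega>)"
    and f: "(\<lambda>(x, y). f x y) \<in> borel_measurable (borel \<Otimes>\<^sub>M borel)"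
  shows "indep_vars (\<lambda>_. borel) (\<lambda>i \<omega>. f (X i \<omega>) (Y i \<omega>)) I"
proof (cases "I = {}")
  case False
  define Z where "Z k = (case k of (i, b) \<Rightarrow> if b then X i else Y i)" for k :: "'i \<times> bool"
  have rvX: "\<And>i. i \<in> I \<Longrightarrow> random_variable borel (X i)" and rvY: "\<And>i. i \<in> I \<Longrightarrow> random_variable borel (Y i)"
    using X Y by (auto simp: indep_vars_def)
  have rv: "random_variable borel (Z k)" if "k \<in> I \<times> UNIV" for k
    using that rvX rvY by (auto simp: Z_def)
  have ind: "indep_vars (\<lambda>_. borel) Z (I \<times> UNIV)"
  proof (subst indep_vars_finite[where E = "\<lambda>_. sets borel"])
    show "\<forall>A\<in>I \<times> UNIV \<rightarrow> sets borel. prob (\<Inter>j\<in>I \<times> UNIV. Z j -` A j \<inter> space M)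
        = (\<Prod>j\<in>I \<times> UNIV. prob (Z j -` A j \<inter> space M))"
    proof
      fix A :: "'i \<times> bool \<Rightarrow> real set" assume A: "A \<in> I \<times> UNIV \<rightarrow> sets borel"
      then have AT: "\<And>i b. i \<in> I \<Longrightarrow> A (i, b) \<in> sets borel" by auto
      let ?P = "\<lambda>b. Pi\<^sub>E I (\<lambda>i. A (i, b))"
      have sP: "?P b \<in> sets (Pi\<^sub>M I (\<lambda>_. borel))" for b
        using AT I by (intro sets_PiM_I_finite) auto
      have "prob (\<Inter>j\<in>I \<times> UNIV. Z j -` A j \<inter> space M)
        = prob ((\<lambda>\<omega>. (\<lambda>i\<in>I. X i \<omega>, \<lambda>i\<in>I. Y i \<omega>)) -` (?P True \<times> ?P False) \<inter> space M)"
        using False by (intro arg_cong[where f = prob]) (auto simp: Z_def PiE_iff UNIV_bool split: if_splits)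
      also have "\<dots> = prob ((\<lambda>\<omega>. \<lambda>i\<in>I. X i \<omega>) -` ?P True \<inter> space M) * prob ((\<lambda>\<omega>. \<lambda>i\<in>I. Y i \<omega>) -` ?P False \<inter> space M)"
        by (rule indep_varD[OF XY sP sP])
      also have "(\<lambda>\<omega>. \<lambda>i\<in>I. X i \<omega>) -` ?P True \<inter> space M = (\<Inter>i\<in>I. X i -` A (i, True) \<inter> space M)"
        using False by (auto simp: PiE_iff)
      also have "(\<lambda>\<omega>. \<lambda>i\<in>I. Y i \<omega>) -` ?P False \<inter> space M = (\<Inter>i\<in>I. Y i -` A (i, False) \<inter> space M)"
        using False by (auto simp: PiE_iff)
      also have "prob (\<Inter>i\<in>I. X i -` A (i, True) \<inter> space M) = (\<Prod>i\<in>I. prob (X i -` A (i, True) \<inter> space M))"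
        by (rule indep_varsD_finite[OF X]) (use False I AT in auto)
      also have "prob (\<Inter>i\<in>I. Y i -` A (i, False) \<inter> space M) = (\<Prod>i\<in>I. prob (Y i -` A (i, False) \<inter> space M))"
        by (rule indep_varsD_finite[OF Y]) (use False I AT in auto)
      also have "(\<Prod>i\<in>I. prob (X i -` A (i, True) \<inter> space M)) * (\<Prod>i\<in>I. prob (Y i -` A (i, False) \<inter> space M))
        = (\<Prod>j\<in>I \<times> UNIV. prob (Z j -` A j \<inter> space M))"
        by (simp add: prod.distrib[symmetric] prod.cartesian_product' UNIV_bool Z_def mult.commute)
      finally show "prob (\<Inter>j\<in>I \<times> UNIV. Z j -` A j \<inter> space M) = (\<Prod>j\<in>I \<times> UNIV. prob (Z j -` A j \<inter> space M))" .
    qed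
    show "sets borel = sigma_sets (space borel) (sets (borel :: real measure))"
      by (rule sets.sigma_sets_eq[symmetric])
  qed (use False I rv in \<open>auto intro: sets.Int_stable\<close>)
  have "indep_vars (\<lambda>i. Pi\<^sub>M ({i} \<times> UNIV) (\<lambda>_. borel)) (\<lambda>i \<omega>. \<lambda>k\<in>{i} \<times> UNIV. Z k \<omega>) I"
    by (rule indep_vars_restrict[OF ind]) (auto simp: disjoint_family_on_def)
  then have "indep_vars (\<lambda>_. borel) (\<lambda>i \<omega>. (\<lambda>v. f (v (i, True)) (v (i, False))) (\<lambda>k\<in>{i} \<times> UNIV. Z k \<omega>)) I"
  proof (rule indep_vars_compose2)
    fix i
    have "(\<lambda>v. (v (i, True), v (i, False))) \<in> Pi\<^sub>M ({i} \<times> UNIV) (\<lambda>_. borel) \<rightarrow>\<^sub>M borel \<Otimes>\<^sub>M borel"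
      by (intro measurable_Pair measurable_component_singleton) auto
    from measurable_compose[OF this f]
    show "(\<lambda>v. f (v (i, True)) (v (i, False))) \<in> Pi\<^sub>M ({i} \<times> UNIV) (\<lambda>_. borel) \<rightarrow>\<^sub>M borel" by simp
  qed
  then show ?thesis by (simp add: Z_def)
qed (simp add: indep_vars_def indep_sets_def)

text \<open>The variances cos^2 s^2 and sin^2 s^2 add up to s^2. Directions along a coordinate axis
  are treated separately, because a summand with coefficient 0 has no normal density.\<close>

lemma distributed_normal_rotate:
  assumes XY: "indep_var borel X borel Y" and s: "0 < s"
    and X: "distributed M lborel X (normal_density 0 s)" and Y: "distributed M lborel Y (normal_density 0 s)"
  shows "distributed M lborel (\<lambda>\<omega>. cos \<theta> * X \<omega> + sin \<theta> * Y \<omega>) (normal_density 0 s)"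
proof -
  have scale: "distributed M lborel (\<lambda>\<omega>. a * Z \<omega>) (normal_density 0 (\<bar>a\<bar> * s))"
    if "a \<noteq> 0" "distributed M lborel Z (normal_density 0 s)" for a Z
    using normal_density_affine[OF that(2) s that(1), of 0] by simp
  have c: "(cos \<theta>)\<^sup>2 + (sin \<theta>)\<^sup>2 = 1" by simp
  consider "cos \<theta> = 0" "\<bar>sin \<theta>\<bar> = 1" | "sin \<theta> = 0" "\<bar>cos \<theta>\<bar> = 1" | "cos \<theta> \<noteq> 0" "sin \<theta> \<noteq> 0"
    using c by (cases "cos \<theta> = 0"; cases "sin \<theta> = 0") (auto simp: power2_eq_1_iff abs_if)
  then show ?thesis
  proof cases
    case 1
    then have "sin \<theta> \<noteq> 0" by auto
    then show ?thesis using scale[OF _ Y, of "sin \<theta>"] 1 by simp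
  next
    case 2
    then have "cos \<theta> \<noteq> 0" by auto
    then show ?thesis using scale[OF _ X, of "cos \<theta>"] 2 by simp
  next
    case 3
    have "indep_var borel ((\<lambda>x. cos \<theta> * x) \<circ> X) borel ((\<lambda>y. sin \<theta> * y) \<circ> Y)"
      by (rule indep_var_compose[OF XY]) auto
    then have "indep_var borel (\<lambda>\<omega>. cos \<theta> * X \<omega>) borel (\<lambda>\<omega>. sin \<theta> * Y \<omega>)" by (simp add: comp_def)
    from add_indep_normal[OF this _ _ scale[OF 3(1) X] scale[OF 3(2) Y]]
    have "distributed M lborel (\<lambda>\<omega>. cos \<theta> * X \<omega> + sin \<theta> * Y \<omega>)
        (normal_density (0 + 0) (sqrt ((\<bar>cos \<theta>\<bar> * s)\<^sup>2 + (\<bar>sin \<theta>\<bar> * s)\<^sup>2)))"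
      using 3 s by simp
    moreover have "sqrt ((\<bar>cos \<theta>\<bar> * s)\<^sup>2 + (\<bar>sin \<theta>\<bar> * s)\<^sup>2) = s"
      using s by (simp add: power_mult_distrib distrib_right[symmetric])
    ultimately show ?thesis by simp
  qed
qed

lemma indep_processes_compose:
  assumes "indep_processes I X J Y"
    and "f \<in> Pi\<^sub>M I (\<lambda>_. borel) \<rightarrow>\<^sub>M N" "g \<in> Pi\<^sub>M J (\<lambda>_. borel) \<rightarrow>\<^sub>M N'"
  shows "indep_var N (\<lambda>\<omega>. f (\<lambda>t\<in>I. X t \<omega>)) N' (\<lambda>\<omega>. g (\<lambda>t\<in>J. Y t \<omega>))"
  using indep_var_compose[OF assms(1)[unfolded indep_processes_def] assms(2,3)] by (simp add: comp_def)

lemma standard_brownian_motion_rotate: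
  assumes X: "standard_brownian_motion X" and Y: "standard_brownian_motion Y"
    and XY: "indep_processes {0..} X {0..} Y"
  shows "standard_brownian_motion (\<lambda>t \<omega>. cos \<theta> * X t \<omega> + sin \<theta> * Y t \<omega>)"
proof -
  note X' = X[unfolded standard_brownian_motion_def] and Y' = Y[unfolded standard_brownian_motion_def]
  have eq: "(cos \<theta> * x + sin \<theta> * y) - (cos \<theta> * x' + sin \<theta> * y') = cos \<theta> * (x - x') + sin \<theta> * (y - y')"
    for x y x' y' by (simp add: algebra_simps)
  show ?thesis
    unfolding standard_brownian_motion_def eq
  proof (intro conjI allI impI ballI)
    show "random_variable borel (\<lambda>\<omega>. cos \<theta> * X t \<omega> + sin \<theta> * Y t \<omega>)" if "0 \<le> t" for t
    proof -
      have [measurable]: "random_variable borel (X t)" "random_variable borel (Y t)" using X' Y' that by auto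
      show ?thesis by measurable
    qed
    show "AE \<omega> in M. cos \<theta> * X 0 \<omega> + sin \<theta> * Y 0 \<omega> = 0"
    proof -
      have "AE \<omega> in M. X 0 \<omega> = 0" "AE \<omega> in M. Y 0 \<omega> = 0" using X' Y' by auto
      then show ?thesis by eventually_elim simp
    qed
    show "continuous_on {0..} (\<lambda>t. cos \<theta> * X t \<omega> + sin \<theta> * Y t \<omega>)" if "\<omega> \<in> space M" for \<omega>
      using X' Y' that by (intro continuous_intros) auto
    show "distributed M lborel (\<lambda>\<omega>. cos \<theta> * (X t \<omega> - X s \<omega>) + sin \<theta> * (Y t \<omega> - Y s \<omega>))
        (normal_density 0 (sqrt (t - s)))" if st: "0 \<le> s \<and> s < t" for s t
    proof (rule distributed_normal_rotate)
      have "(\<lambda>p. p t - p s) \<in> borel_measurable (Pi\<^sub>M {0..} (\<lambda>_. borel :: real measure))"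
        using st by (intro borel_measurable_diff measurable_component_singleton) auto
      from indep_processes_compose[OF XY this this]
      show "indep_var borel (\<lambda>\<omega>. X t \<omega> - X s \<omega>) borel (\<lambda>\<omega>. Y t \<omega> - Y s \<omega>)" using st by simp
    qed (use X' Y' st in auto)
    show "indep_vars (\<lambda>_. borel) (\<lambda>i \<omega>. cos \<theta> * (X (t (Suc i)) \<omega> - X (t i) \<omega>) + sin \<theta> * (Y (t (Suc i)) \<omega> - Y (t i) \<omega>)) {..<n}"
      if t: "0 \<le> t 0 \<and> (\<forall>i<n. t i < t (Suc i))" for n and t :: "nat \<Rightarrow> real"
    proof (rule indep_vars_combine[where f = "\<lambda>x y. cos \<theta> * x + sin \<theta> * y"
        and X = "\<lambda>i \<omega>. X (t (Suc i)) \<omega> - X (t i) \<omega>" and Y = "\<lambda>i \<omega>. Y (t (Suc i)) \<omega> - Y (t i) \<omega>"])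
      have t0: "0 \<le> t i" if "i \<le> n" for i
        using that
      proof (induction i)
        case (Suc i)
        then have "0 \<le> t i" "t i < t (Suc i)" using t by auto
        then show ?case by simp
      qed (use t in auto)
      have m: "(\<lambda>p. \<lambda>i\<in>{..<n}. p (t (Suc i)) - p (t i))
          \<in> Pi\<^sub>M {0..} (\<lambda>_. borel :: real measure) \<rightarrow>\<^sub>M Pi\<^sub>M {..<n} (\<lambda>_. borel)"
        using t0 by (intro measurable_restrict borel_measurable_diff measurable_component_singleton) auto
      show "indep_var (Pi\<^sub>M {..<n} (\<lambda>_. borel)) (\<lambda>\<omega>. \<lambda>i\<in>{..<n}. X (t (Suc i)) \<omega> - X (t i) \<omega>)
          (Pi\<^sub>M {..<n} (\<lambda>_. borel)) (\<lambda>\<omega>. \<lambda>i\<in>{..<n}. Y (t (Suc i)) \<omega> - Y (t i) \<omega>)"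
        using indep_processes_compose[OF XY m m] t0 by (simp cong: restrict_cong)
    qed (use X' Y' t in \<open>auto\<close>)
  qed
qed

end

section \<open>The bridge as a Gaussian autoregression\<close>

lemma nn_integral_lborel_shift:
  fixes f :: "real \<Rightarrow> ennreal"
  assumes "f \<in> borel_measurable borel"
  shows "(\<integral>\<^sup>+y. f (y - a) \<partial>lborel) = (\<integral>\<^sup>+y. f y \<partial>lborel)"
  using nn_integral_real_affine[OF assms, of 1 "- a"] by simp

lemma autoregression_measurable:
  fixes F :: "nat \<Rightarrow> real \<Rightarrow> ennreal"
  assumes F: "\<And>i. F i \<in> borel_measurable borel" and "n \<le> m"
  shows "(\<lambda>x. \<Prod>i<n. F i ((x(0 := 0)) (Suc i) - c i * (x(0 := 0)) i))
    \<in> borel_measurable (Pi\<^sub>M {1..m} (\<lambda>_. lborel))"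
proof (rule borel_measurable_prod_ennreal)
  fix i assume "i \<in> {..<n}"
  then have i: "i < m" using assms(2) by auto
  have comp: "(\<lambda>x. x k) \<in> borel_measurable (Pi\<^sub>M {1..m} (\<lambda>_. lborel))" if "1 \<le> k" "k \<le> m" for k
    using that measurable_component_singleton[of k "{1..m}" "\<lambda>_. lborel"] by simp
  have "(\<lambda>x. (x(0 := 0)) i) \<in> borel_measurable (Pi\<^sub>M {1..m} (\<lambda>_. lborel))"
    using i comp[of i] by (cases "i = 0") auto
  then have "(\<lambda>x. (x(0 := 0)) (Suc i) - c i * (x(0 := 0)) i) \<in> borel_measurable (Pi\<^sub>M {1..m} (\<lambda>_. lborel))"
    using i comp[of "Suc i"] by (intro borel_measurable_diff borel_measurable_times) auto
  then show "(\<lambda>x. F i ((x(0 := 0)) (Suc i) - c i * (x(0 := 0)) i)) \<in> borel_measurable (Pi\<^sub>M {1..m} (\<lambda>_. lborel))"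
    by (rule measurable_compose) (rule F)
qed

text \<open>Integrating the last coordinate first, the remaining coordinates only translate its
  factor, and Lebesgue measure is translation invariant. The update \<open>x(0 := 0)\<close>
  supplies the starting value, which is not a coordinate of the product space.\<close>

lemma nn_integral_autoregression:
  fixes F :: "nat \<Rightarrow> real \<Rightarrow> ennreal"
  assumes F: "\<And>i. F i \<in> borel_measurable borel"
  shows "(\<integral>\<^sup>+x. (\<Prod>i<n. F i ((x(0 := 0)) (Suc i) - c i * (x(0 := 0)) i)) \<partial>(\<Pi>\<^sub>M i\<in>{1..n}. lborel))
    = (\<Prod>i<n. \<integral>\<^sup>+y. F i y \<partial>lborel)"
proof (induction n)
  case 0
  show ?case by (simp add: PiM_empty nn_integral_count_space_finite space_PiM)
next
  case (Suc n)
  interpret product_sigma_finite "\<lambda>_::nat. lborel :: real measure" by standard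
  let ?G = "\<lambda>m x. \<Prod>i<m. F i ((x(0 := 0)) (Suc i) - c i * (x(0 := 0)) i)"
  have ins: "{1..Suc n} = insert (Suc n) {1..n}" by auto
  have "(\<integral>\<^sup>+x. ?G (Suc n) x \<partial>(\<Pi>\<^sub>M i\<in>{1..Suc n}. lborel))
    = (\<integral>\<^sup>+x. (\<integral>\<^sup>+y. ?G (Suc n) (x(Suc n := y)) \<partial>lborel) \<partial>(\<Pi>\<^sub>M i\<in>{1..n}. lborel))"
    unfolding ins
    by (rule product_nn_integral_insert)
       (simp_all only: autoregression_measurable[where F = F and c = c and n = "Suc n" and m = "Suc n",
          OF F order.refl, unfolded ins], simp_all)
  also have "\<dots> = (\<integral>\<^sup>+x. ?G n x * (\<integral>\<^sup>+y. F n y \<partial>lborel) \<partial>(\<Pi>\<^sub>M i\<in>{1..n}. lborel))"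
  proof (rule nn_integral_cong)
    fix x :: "nat \<Rightarrow> real"
    have G: "?G (Suc n) (x(Suc n := y)) = ?G n x * F n (y - c n * (x(0 := 0)) n)" for y
    proof -
      have "(\<Prod>i<n. F i (((x(Suc n := y))(0 := 0)) (Suc i) - c i * ((x(Suc n := y))(0 := 0)) i)) = ?G n x"
        by (rule prod.cong) auto
      then show ?thesis unfolding prod.lessThan_Suc by simp
    qed
    have "(\<integral>\<^sup>+y. ?G (Suc n) (x(Suc n := y)) \<partial>lborel) = ?G n x * (\<integral>\<^sup>+y. F n (y - c n * (x(0 := 0)) n) \<partial>lborel)"
      unfolding G using measurable_compose[OF _ F[of n], of "\<lambda>y. y - c n * (x(0 := 0)) n" lborel]
      by (intro nn_integral_cmult) simp
    then show "(\<integral>\<^sup>+y. ?G (Suc n) (x(Suc n := y)) \<partial>lborel) = ?G n x * (\<integral>\<^sup>+y. F n y \<partial>lborel)"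
      by (simp only: nn_integral_lborel_shift[OF F])
  qed
  also have "\<dots> = (\<integral>\<^sup>+x. ?G n x \<partial>(\<Pi>\<^sub>M i\<in>{1..n}. lborel)) * (\<integral>\<^sup>+y. F n y \<partial>lborel)"
    by (rule nn_integral_multc) (rule autoregression_measurable[OF F order.refl])
  finally show ?case using Suc.IH by simp
qed

text \<open>The change from the values to the residuals \<open>E i\<close> is triangular with unit
  diagonal, and in the residuals the density is a product; hence they are independent with the
  factors as densities.\<close>

lemma (in prob_space) autoregression_indep:
  fixes X :: "nat \<Rightarrow> 'a \<Rightarrow> real"
  assumes X: "distributed M (\<Pi>\<^sub>M i\<in>{1..n}. lborel) (\<lambda>\<omega>. \<lambda>i\<in>{1..n}. X i \<omega>) g"
    and g: "\<And>x. g x = (\<Prod>i<n. ennreal (q i ((x(0 := 0)) (Suc i) - c i * (x(0 := 0)) i)))"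
    and q: "\<And>i. q i \<in> borel_measurable borel" "\<And>i. (\<integral>\<^sup>+y. ennreal (q i y) \<partial>lborel) = 1"
  defines "E \<equiv> \<lambda>i \<omega>. X (Suc i) \<omega> - c i * (if i = 0 then 0 else X i \<omega>)"
  shows "indep_vars (\<lambda>_. borel) E {..<n}" and "\<And>i. i < n \<Longrightarrow> distributed M lborel (E i) (q i)"
proof -
  have comp: "random_variable borel (X k)" if "1 \<le> k" "k \<le> n" for k
  proof -
    have "(\<lambda>\<omega>. \<lambda>i\<in>{1..n}. X i \<omega>) \<in> M \<rightarrow>\<^sub>M (\<Pi>\<^sub>M i\<in>{1..n}. lborel)"
      using X by (simp add: distributed_def)
    from measurable_compose[OF this measurable_component_singleton[of k "{1..n}"]] that
    show ?thesis by simp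
  qed
  have rv: "random_variable borel (E i)" if "i < n" for i
    unfolding E_def using that comp[of "Suc i"] comp[of i] by (cases "i = 0") auto
  \<comment> \<open>Products of test functions determine the joint law of the residuals. One
    indicator among constants 1 gives the marginal densities, indicators in all places give
    independence.\<close>
  have main: "(\<integral>\<^sup>+\<omega>. (\<Prod>i<n. G i (E i \<omega>)) \<partial>M) = (\<Prod>i<n. \<integral>\<^sup>+y. ennreal (q i y) * G i y \<partial>lborel)"
    if G[measurable]: "\<And>i. G i \<in> borel_measurable borel" for G :: "nat \<Rightarrow> real \<Rightarrow> ennreal"
  proof -
    let ?d = "\<lambda>x i. (x(0 := 0)) (Suc i) - c i * (x(0 := 0)) i"
    have m: "(\<lambda>y. ennreal (q i y) * G i y) \<in> borel_measurable borel" for i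
      using q(1)[of i] by measurable
    have "(\<integral>\<^sup>+\<omega>. (\<Prod>i<n. G i (E i \<omega>)) \<partial>M)
      = (\<integral>\<^sup>+\<omega>. (\<Prod>i<n. G i (?d (\<lambda>i\<in>{1..n}. X i \<omega>) i)) \<partial>M)"
      by (intro nn_integral_cong prod.cong) (auto simp: E_def)
    also have "\<dots> = (\<integral>\<^sup>+x. g x * (\<Prod>i<n. G i (?d x i)) \<partial>(\<Pi>\<^sub>M i\<in>{1..n}. lborel))"
      using distributed_nn_integral[OF X autoregression_measurable[where F = G, OF G order.refl]] by simp
    also have "\<dots> = (\<integral>\<^sup>+x. (\<Prod>i<n. (\<lambda>y. q i y * G i y) (?d x i)) \<partial>(\<Pi>\<^sub>M i\<in>{1..n}. lborel))"
      by (simp add: g prod.distrib)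
    also have "\<dots> = (\<Prod>i<n. \<integral>\<^sup>+y. ennreal (q i y) * G i y \<partial>lborel)"
      by (rule nn_integral_autoregression[OF m])
    finally show ?thesis .
  qed
  have em: "emeasure M (E i -` A \<inter> space M) = (\<integral>\<^sup>+y. ennreal (q i y) * indicator A y \<partial>lborel)"
    if "i < n" and A: "A \<in> sets borel" for i A
  proof -
    let ?G = "\<lambda>j y. if j = i then indicator A y else 1 :: ennreal"
    have "emeasure M (E i -` A \<inter> space M) = (\<integral>\<^sup>+\<omega>. indicator (E i -` A \<inter> space M) \<omega> \<partial>M)"
      using rv[OF that(1)] A by (intro nn_integral_indicator[symmetric]) (auto simp: measurable_sets)
    also have "\<dots> = (\<integral>\<^sup>+\<omega>. indicator A (E i \<omega>) \<partial>M)"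
      by (intro nn_integral_cong) (auto simp: indicator_def)
    also have "\<dots> = (\<integral>\<^sup>+\<omega>. (\<Prod>j<n. ?G j (E j \<omega>)) \<partial>M)"
      using that(1) by (intro nn_integral_cong) (simp add: prod.remove[of "{..<n}" i])
    also have "\<dots> = (\<Prod>j<n. \<integral>\<^sup>+y. ennreal (q j y) * ?G j y \<partial>lborel)" using A by (intro main) auto
    also have "\<dots> = (\<integral>\<^sup>+y. ennreal (q i y) * indicator A y \<partial>lborel)"
      using that(1) by (simp add: prod.remove[of "{..<n}" i] q(2))
    finally show ?thesis .
  qed
  show "distributed M lborel (E i) (q i)" if "i < n" for i
  proof -
    have "distr M lborel (E i) = density lborel (q i)"
      using rv[OF that] q(1)[of i] em[OF that]
      by (intro measure_eqI) (auto simp: emeasure_distr emeasure_density)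
    then show ?thesis using rv[OF that] q(1)[of i] by (simp add: distributed_def)
  qed
  show "indep_vars (\<lambda>_. borel) E {..<n}"
  proof (cases "n = 0")
    case False
    show ?thesis
    proof (subst indep_vars_finite[where E = "\<lambda>_. sets borel"])
      show "\<forall>A\<in>{..<n} \<rightarrow> sets borel. prob (\<Inter>j\<in>{..<n}. E j -` A j \<inter> space M)
          = (\<Prod>j\<in>{..<n}. prob (E j -` A j \<inter> space M))"
      proof
        fix A assume A: "A \<in> {..<n} \<rightarrow> sets (borel :: real measure)"
        define A' where "A' i = (if i < n then A i else {})" for i
        have A': "A' i \<in> sets borel" for i using A by (auto simp: A'_def)
        have eq: "(\<Inter>j\<in>{..<n}. E j -` A j \<inter> space M) = (\<Inter>j\<in>{..<n}. E j -` A' j \<inter> space M)"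
          by (auto simp: A'_def)
        have "(\<Inter>j\<in>{..<n}. E j -` A' j \<inter> space M) \<in> sets M"
          using False A' rv by (intro sets.finite_INT) auto
        then have "emeasure M (\<Inter>j\<in>{..<n}. E j -` A' j \<inter> space M)
            = (\<integral>\<^sup>+\<omega>. indicator (\<Inter>j\<in>{..<n}. E j -` A' j \<inter> space M) \<omega> \<partial>M)"
          by (rule nn_integral_indicator[symmetric])
        also have "\<dots> = (\<integral>\<^sup>+\<omega>. (\<Prod>i<n. indicator (A' i) (E i \<omega>)) \<partial>M)"
          using False by (intro nn_integral_cong) (auto simp: indicator_def)
        also have "\<dots> = (\<Prod>i<n. \<integral>\<^sup>+y. ennreal (q i y) * indicator (A' i) y \<partial>lborel)"
          using A' by (intro main) auto
        also have "\<dots> = (\<Prod>i<n. emeasure M (E i -` A i \<inter> space M))"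
          using A by (intro prod.cong) (auto simp: em A'_def Pi_iff)
        finally have "ennreal (prob (\<Inter>j\<in>{..<n}. E j -` A' j \<inter> space M))
            = ennreal (\<Prod>j<n. prob (E j -` A j \<inter> space M))"
          by (simp only: emeasure_eq_measure prod_ennreal[OF measure_nonneg])
        then show "prob (\<Inter>j\<in>{..<n}. E j -` A j \<inter> space M) = (\<Prod>j\<in>{..<n}. prob (E j -` A j \<inter> space M))"
          unfolding eq by (subst (asm) ennreal_inj) (auto intro!: prod_nonneg)
      qed
      show "sets borel = sigma_sets (space borel) (sets (borel :: real measure))"
        by (rule sets.sigma_sets_eq[symmetric])
    qed (use False rv in \<open>auto intro: sets.Int_stable\<close>)
  qed (simp add: indep_vars_def indep_sets_def)
qed

text \<open>Completing the square: going from \<open>x\<close> to \<open>y\<close> in time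
  \<open>A\<close> and on to 0 in time \<open>B\<close> has the weight of going from
  \<open>x\<close> to 0 in time \<open>A + B\<close>, times the conditional density of
  \<open>y\<close>, which is normal with mean B / (A + B) x and variance A B / (A + B).\<close>

lemma normal_density_bridge:
  assumes "0 < A" "0 < B"
  shows "normal_density x (sqrt A) y * normal_density y (sqrt B) 0
    = normal_density x (sqrt (A + B)) 0 * normal_density 0 (sqrt (A * B / (A + B))) (y - B / (A + B) * x)"
proof -
  have e: "(y - x)\<^sup>2 / (2 * A) + y\<^sup>2 / (2 * B)
      = x\<^sup>2 / (2 * (A + B)) + (y - B / (A + B) * x)\<^sup>2 / (2 * (A * B / (A + B)))"
  proof -
    define S where "S = A + B"
    have nz: "S \<noteq> 0" "A \<noteq> 0" "B \<noteq> 0" using assms by (auto simp: S_def)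
    have "(y - x)\<^sup>2 / (2 * A) + y\<^sup>2 / (2 * B) = (S * B * (y - x)\<^sup>2 + S * A * y\<^sup>2) / (2 * S * A * B)"
      using nz by (simp add: field_simps)
    also have "S * B * (y - x)\<^sup>2 + S * A * y\<^sup>2 = A * B * x\<^sup>2 + (S * y - B * x)\<^sup>2"
      by (simp add: S_def power2_eq_square algebra_simps)
    also have "(A * B * x\<^sup>2 + (S * y - B * x)\<^sup>2) / (2 * S * A * B)
        = x\<^sup>2 / (2 * S) + ((S * y - B * x) / S)\<^sup>2 / (2 * (A * B / S))"
      using nz by (simp add: power_divide power2_eq_square[of S] add_divide_distrib)
    also have "(S * y - B * x) / S = y - B / S * x"
      using nz by (simp add: field_simps)
    finally show ?thesis by (simp add: S_def)
  qed
  have s: "sqrt (2 * pi * A) * sqrt (2 * pi * B) = sqrt (2 * pi * (A + B)) * sqrt (2 * pi * (A * B / (A + B)))"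
    unfolding real_sqrt_mult[symmetric] using assms by (intro arg_cong[where f = sqrt]) (simp add: field_simps)
  have p: "0 \<le> A * B / (A + B)" using assms by simp
  have "normal_density x (sqrt A) y * normal_density y (sqrt B) 0
    = exp (- ((y - x)\<^sup>2 / (2 * A) + y\<^sup>2 / (2 * B))) / (sqrt (2 * pi * A) * sqrt (2 * pi * B))"
    using assms by (simp add: normal_density_def exp_add[symmetric])
  also have "\<dots> = exp (- (x\<^sup>2 / (2 * (A + B)) + (y - B / (A + B) * x)\<^sup>2 / (2 * (A * B / (A + B)))))
      / (sqrt (2 * pi * (A + B)) * sqrt (2 * pi * (A * B / (A + B))))"
    unfolding e s ..
  also have "\<dots> = normal_density x (sqrt (A + B)) 0 * normal_density 0 (sqrt (A * B / (A + B))) (y - B / (A + B) * x)"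
    unfolding normal_density_def using assms p by (simp only: real_sqrt_pow2 add_nonneg_nonneg less_imp_le)
      (simp add: exp_add[symmetric])
  finally show ?thesis .
qed

text \<open>The transition probabilities of the bridge as a Markov chain: each Brownian step
  together with the return to 0 in the remaining time is rewritten as the return from the previous
  point times a normal residual. The return factors telescope to the density of the whole return,
  the denominator of \<open>bridge_density\<close>.\<close>

lemma bridge_density_eq:
  assumes t: "\<And>i. i \<in> {1..n} \<Longrightarrow> 0 < t i \<and> t i < 1" "\<And>i. i \<in> {1..<n} \<Longrightarrow> t i < t (Suc i)"
  defines "t' \<equiv> t(0 := 0)"
  shows "bridge_density n t x = (\<Prod>i<n. normal_density 0
      (sqrt ((t' (Suc i) - t' i) * (1 - t' (Suc i)) / (1 - t' i)))
      ((x(0 := 0)) (Suc i) - (1 - t' (Suc i)) / (1 - t' i) * (x(0 := 0)) i))"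
proof -
  let ?x = "x(0 := 0)"
  define d where "d i = normal_density 0 (sqrt ((t' (Suc i) - t' i) * (1 - t' (Suc i)) / (1 - t' i)))
      (?x (Suc i) - (1 - t' (Suc i)) / (1 - t' i) * ?x i)" for i
  have t1: "t' i < 1" if "i \<le> n" for i using that t(1)[of i] by (auto simp: t'_def)
  have t2: "t' i < t' (Suc i)" if "i < n" for i
    using that t(1)[of "Suc i"] t(2)[of i] by (auto simp: t'_def)
  have ind: "(\<Prod>i<m. normal_density (?x i) (sqrt (t' (Suc i) - t' i)) (?x (Suc i))) * normal_density (?x m) (sqrt (1 - t' m)) 0
      = (\<Prod>i<m. d i) * normal_density 0 1 0" if "m \<le> n" for m
    using that
  proof (induction m)
    case 0
    then show ?case by (simp add: t'_def)
  next
    case (Suc m)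
    have "normal_density (?x m) (sqrt (t' (Suc m) - t' m)) (?x (Suc m)) * normal_density (?x (Suc m)) (sqrt (1 - t' (Suc m))) 0
      = normal_density (?x m) (sqrt (1 - t' m)) 0 * d m"
      using normal_density_bridge[of "t' (Suc m) - t' m" "1 - t' (Suc m)" "?x m" "?x (Suc m)"]
        t1[of "Suc m"] t2[of m] Suc.prems by (simp add: d_def)
    then have "(\<Prod>i<Suc m. normal_density (?x i) (sqrt (t' (Suc i) - t' i)) (?x (Suc i))) * normal_density (?x (Suc m)) (sqrt (1 - t' (Suc m))) 0
      = ((\<Prod>i<m. normal_density (?x i) (sqrt (t' (Suc i) - t' i)) (?x (Suc i))) * normal_density (?x m) (sqrt (1 - t' m)) 0) * d m"
      by (simp add: mult.assoc)
    with Suc show ?case by (simp add: mult.commute mult.left_commute)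
  qed
  have "brownian_density (Suc n) (t(0 := 0, Suc n := 1)) (x(0 := 0, Suc n := 0))
    = (\<Prod>i<n. normal_density (?x i) (sqrt (t' (Suc i) - t' i)) (?x (Suc i))) * normal_density (?x n) (sqrt (1 - t' n)) 0"
    by (simp add: brownian_density_def t'_def)
  also have "\<dots> = (\<Prod>i<n. d i) * normal_density 0 1 0" by (rule ind) simp
  finally show ?thesis
    using normal_density_pos[of 1 0 0] by (simp add: bridge_density_def d_def)
qed

context prob_space
begin

text \<open>With t = s / (1 + s) one has 1 - t = 1 / (1 + s), so the regression coefficient between
  consecutive times is the quotient of the factors 1 + s. The residual times the later factor is
  therefore an increment of \<open>v\<close>, and its variance becomes the difference of the times
  \<open>s\<close>.\<close>

lemma bridge_increments:
  fixes s :: "nat \<Rightarrow> real"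
  assumes X: "standard_brownian_bridge X" and s: "s 0 = 0" "\<And>i. i < n \<Longrightarrow> s i < s (Suc i)"
  defines "v \<equiv> \<lambda>i \<omega>. if i = 0 then 0 else (1 + s i) * X (s i / (1 + s i)) \<omega>"
  shows "indep_vars (\<lambda>_. borel) (\<lambda>i \<omega>. v (Suc i) \<omega> - v i \<omega>) {..<n}"
    and "\<And>i. i < n \<Longrightarrow> distributed M lborel (\<lambda>\<omega>. v (Suc i) \<omega> - v i \<omega>) (normal_density 0 (sqrt (s (Suc i) - s i)))"
proof -
  define t where "t i = s i / (1 + s i)" for i
  have s0: "0 \<le> s i" if "i \<le> n" for i
    using that
  proof (induction i)
    case (Suc i)
    then show ?case using s(2)[of i] by auto
  qed (use s in auto)
  have t1: "1 - t i = 1 / (1 + s i)" if "i \<le> n" for i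
    using s0[OF that] by (simp add: t_def field_simps)
  have ts: "t (Suc i) - t i = (s (Suc i) - s i) / ((1 + s i) * (1 + s (Suc i)))" if "i < n" for i
    using s0[of i] s0[of "Suc i"] that by (simp add: t_def field_simps)
  have t: "0 < t i \<and> t i < 1" if "i \<in> {1..n}" for i
  proof -
    obtain j where j: "i = Suc j" using \<open>i \<in> {1..n}\<close> by (cases i) auto
    then have "0 < s i" using s0[of j] s(2)[of j] that by auto
    then show ?thesis by (simp add: t_def)
  qed
  have t': "t i < t (Suc i)" if "i < n" for i
  proof -
    have "0 < (s (Suc i) - s i) / ((1 + s i) * (1 + s (Suc i)))"
      using s0[of i] s0[of "Suc i"] s(2)[of i] that by (intro divide_pos_pos mult_pos_pos) auto
    then show ?thesis using ts[OF that] by simp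
  qed
  have t0: "t(0 := 0) = t" using s by (auto simp: t_def)
  \<comment> \<open>The value 1 beyond \<open>n\<close> makes every factor a probability density, as
    \<open>autoregression_indep\<close> asks for all indices.\<close>
  define \<sigma> where "\<sigma> i = (if i < n then sqrt ((t (Suc i) - t i) * (1 - t (Suc i)) / (1 - t i)) else 1)" for i
  have \<sigma>: "\<sigma> i = sqrt (s (Suc i) - s i) / (1 + s (Suc i))" if "i < n" for i
  proof -
    have "(t (Suc i) - t i) * (1 - t (Suc i)) / (1 - t i) = (s (Suc i) - s i) / (1 + s (Suc i))\<^sup>2"
      using that s0[of i] s0[of "Suc i"] by (simp add: ts t1 power2_eq_square)
    then show ?thesis using that s0[of "Suc i"] by (simp add: \<sigma>_def real_sqrt_divide)
  qed
  have \<sigma>0: "0 < \<sigma> i" for i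
  proof (cases "i < n")
    case True
    then show ?thesis using s0[of "Suc i"] s(2)[of i] by (simp add: \<sigma>)
  qed (simp add: \<sigma>_def)
  define E where "E i \<omega> = X (t (Suc i)) \<omega> - (1 - t (Suc i)) / (1 - t i) * (if i = 0 then 0 else X (t i) \<omega>)" for i \<omega>
  have D: "distributed M (\<Pi>\<^sub>M i\<in>{1..n}. lborel) (\<lambda>\<omega>. \<lambda>i\<in>{1..n}. X (t i) \<omega>) (bridge_density n t)"
    using X t t' unfolding standard_brownian_bridge_def by auto
  have dens: "ennreal (bridge_density n t x) = (\<Prod>i<n. ennreal (normal_density 0 (\<sigma> i)
      ((x(0 := 0)) (Suc i) - (1 - t (Suc i)) / (1 - t i) * (x(0 := 0)) i)))" for x
  proof -
    have "bridge_density n t x = (\<Prod>i<n. normal_density 0 (\<sigma> i)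
      ((x(0 := 0)) (Suc i) - (1 - t (Suc i)) / (1 - t i) * (x(0 := 0)) i))"
      using t t' by (subst bridge_density_eq) (auto simp: t0 \<sigma>_def intro!: prod.cong)
    then show ?thesis by (simp only: prod_ennreal[OF normal_density_nonneg])
  qed
  have one: "(\<integral>\<^sup>+y. ennreal (normal_density 0 (\<sigma> i) y) \<partial>lborel) = 1" for i
    using \<sigma>0[of i] by (subst nn_integral_eq_integral) auto
  note ar = autoregression_indep[OF D dens borel_measurable_normal_density one, folded E_def]
  have vE: "v (Suc i) \<omega> - v i \<omega> = (1 + s (Suc i)) * E i \<omega>" if "i < n" for i \<omega>
    using that s0[of i] s0[of "Suc i"] by (simp add: v_def E_def t1 t_def[symmetric] right_diff_distrib)
  have "indep_vars (\<lambda>_. borel) (\<lambda>i \<omega>. (1 + s (Suc i)) * E i \<omega>) {..<n}"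
    by (rule indep_vars_compose2[OF ar(1)]) auto
  then show "indep_vars (\<lambda>_. borel) (\<lambda>i \<omega>. v (Suc i) \<omega> - v i \<omega>) {..<n}"
    by (subst indep_vars_cong[OF refl _ refl]) (auto simp: vE)
  show "distributed M lborel (\<lambda>\<omega>. v (Suc i) \<omega> - v i \<omega>) (normal_density 0 (sqrt (s (Suc i) - s i)))"
    if i: "i < n" for i
    using normal_density_affine[OF ar(2)[OF i] \<sigma>0, of "1 + s (Suc i)" 0] s0[of "Suc i"] i
    by (simp add: vE \<sigma> abs_of_nonneg)
qed

text \<open>Two gaps to \<open>bridge_increments\<close> remain: the value at time 0 vanishes only
  almost surely, and a partition may begin at a positive time. In the latter case time 0 is
  prepended and the additional first increment is dropped afterwards.\<close>

lemma standard_brownian_motion_of_bridge: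
  assumes X: "standard_brownian_bridge X"
  shows "standard_brownian_motion (\<lambda>s \<omega>. (1 + s) * X (s / (1 + s)) \<omega>)" (is "standard_brownian_motion ?V")
proof -
  note X' = X[unfolded standard_brownian_bridge_def]
  have rv: "random_variable borel (?V s)" if "0 \<le> s" for s
  proof -
    have "s / (1 + s) \<in> {0..1}" using that by auto
    then have [measurable]: "random_variable borel (X (s / (1 + s)))" using X' by blast
    show ?thesis by measurable
  qed
  have ae0: "AE \<omega> in M. ?V 0 \<omega> = 0" using X' by auto
  have inc: "indep_vars (\<lambda>_. borel) (\<lambda>i \<omega>. ?V (s (Suc i)) \<omega> - ?V (s i) \<omega>) {..<n} \<and>
      (\<forall>i<n. distributed M lborel (\<lambda>\<omega>. ?V (s (Suc i)) \<omega> - ?V (s i) \<omega>) (normal_density 0 (sqrt (s (Suc i) - s i))))"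
    if s: "s 0 = 0" "\<And>i. i < n \<Longrightarrow> s i < s (Suc i)" for s :: "nat \<Rightarrow> real" and n
  proof -
    let ?v = "\<lambda>i \<omega>. if i = 0 then 0 else ?V (s i) \<omega>"
    have s0: "0 \<le> s i" if "i \<le> n" for i
      using that
    proof (induction i)
      case (Suc i)
      then show ?case using s(2)[of i] by auto
    qed (use s in auto)
    have rv': "random_variable borel (\<lambda>\<omega>. ?V (s (Suc i)) \<omega> - ?V (s i) \<omega>)" if "i < n" for i
      using that s0[of i] s0[of "Suc i"] by (intro borel_measurable_diff rv) auto
    have ae: "AE \<omega> in M. ?v (Suc i) \<omega> - ?v i \<omega> = ?V (s (Suc i)) \<omega> - ?V (s i) \<omega>" for i
      using ae0 by eventually_elim (use s in auto)
    note bi = bridge_increments[OF X, of s n, OF s]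
    show ?thesis
      using indep_vars_cong_AE[OF bi(1) rv' _ ae] distributed_cong_AE[OF bi(2) _ ae] rv' by auto
  qed
  have inc': "indep_vars (\<lambda>_. borel) (\<lambda>i \<omega>. ?V (t (Suc i)) \<omega> - ?V (t i) \<omega>) {..<n} \<and>
      (\<forall>i<n. distributed M lborel (\<lambda>\<omega>. ?V (t (Suc i)) \<omega> - ?V (t i) \<omega>) (normal_density 0 (sqrt (t (Suc i) - t i))))"
    if t: "0 \<le> t 0" "\<And>i. i < n \<Longrightarrow> t i < t (Suc i)" for t :: "nat \<Rightarrow> real" and n
  proof (cases "t 0 = 0")
    case True
    then show ?thesis using inc t by blast
  next
    case False
    define s where "s i = (case i of 0 \<Rightarrow> 0 | Suc j \<Rightarrow> t j)" for i
    have "s i < s (Suc i)" if "i < Suc n" for i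
      using that t False by (cases i) (auto simp: s_def)
    from inc[of s "Suc n", OF _ this]
    have *: "indep_vars (\<lambda>_. borel) (\<lambda>i \<omega>. ?V (s (Suc i)) \<omega> - ?V (s i) \<omega>) {..<Suc n}"
      "\<And>i. i < Suc n \<Longrightarrow> distributed M lborel (\<lambda>\<omega>. ?V (s (Suc i)) \<omega> - ?V (s i) \<omega>) (normal_density 0 (sqrt (s (Suc i) - s i)))"
      by (auto simp: s_def)
    have "indep_vars (\<lambda>_. borel) (\<lambda>i \<omega>. ?V (s (Suc (Suc i))) \<omega> - ?V (s (Suc i)) \<omega>) {..<n}"
    proof -
      have "indep_vars (\<lambda>j. Pi\<^sub>M {Suc j} (\<lambda>_. borel))
          (\<lambda>j \<omega>. \<lambda>i\<in>{Suc j}. ?V (s (Suc i)) \<omega> - ?V (s i) \<omega>) {..<n}"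
        by (rule indep_vars_restrict[OF *(1)]) (auto simp: disjoint_family_on_def)
      then have "indep_vars (\<lambda>_. borel) (\<lambda>j \<omega>. (\<lambda>f. f (Suc j)) (\<lambda>i\<in>{Suc j}. ?V (s (Suc i)) \<omega> - ?V (s i) \<omega>)) {..<n}"
        by (rule indep_vars_compose2) (auto intro: measurable_component_singleton)
      then show ?thesis by simp
    qed
    with *(2)[of "Suc i" for i] show ?thesis by (simp add: s_def)
  qed
  show ?thesis
    unfolding standard_brownian_motion_def
  proof (intro conjI allI impI ballI)
    show "continuous_on {0..} (\<lambda>s. ?V s \<omega>)" if "\<omega> \<in> space M" for \<omega>
    proof -
      have "continuous_on {0..1} (\<lambda>t. X t \<omega>)" using X' that by auto
      then have "continuous_on {0..} (\<lambda>s. X (s / (1 + s)) \<omega>)"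
        by (rule continuous_on_compose2) (auto intro!: continuous_intros)
      then show ?thesis by (intro continuous_intros)
    qed
    show "distributed M lborel (\<lambda>\<omega>. ?V t \<omega> - ?V s \<omega>) (normal_density 0 (sqrt (t - s)))"
      if "0 \<le> s \<and> s < t" for s t
      using inc'[of "\<lambda>i. if i = 0 then s else t" 1] that by simp
    show "indep_vars (\<lambda>_. borel) (\<lambda>i \<omega>. ?V (t (Suc i)) \<omega> - ?V (t i) \<omega>) {..<n}"
      if "0 \<le> t 0 \<and> (\<forall>i<n. t i < t (Suc i))" for n t
      using inc'[of t n] that by blast
  qed (use rv ae0 in auto)
qed

end

subsection \<open>First passage along a grid\<close>

text \<open>The value \<open>Suc m\<close> signals that \<open>x\<close> stays below \<open>a\<close> on \<open>{..m}\<close>.\<close>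

definition first_exceed :: "(nat \<Rightarrow> real) \<Rightarrow> real \<Rightarrow> nat \<Rightarrow> nat" where
  "first_exceed x a m = (LEAST k. k = Suc m \<or> a < x k)"

lemma first_exceed_le: "first_exceed x a m \<le> Suc m"
  unfolding first_exceed_def by (rule Least_le) simp

lemma first_exceed_eq_iff:
  assumes "k \<le> m"
  shows "first_exceed x a m = k \<longleftrightarrow> (\<forall>j<k. x j \<le> a) \<and> a < x k"
proof
  assume eq: "first_exceed x a m = k"
  have "first_exceed x a m = Suc m \<or> a < x (first_exceed x a m)"
    unfolding first_exceed_def by (rule LeastI[of _ "Suc m"]) simp
  moreover have "x j \<le> a" if "j < k" for j
    using not_less_Least[of j "\<lambda>k. k = Suc m \<or> a < x k"] that eq unfolding first_exceed_def by auto
  ultimately show "(\<forall>j<k. x j \<le> a) \<and> a < x k" using eq assms by auto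
next
  assume *: "(\<forall>j<k. x j \<le> a) \<and> a < x k"
  show "first_exceed x a m = k" unfolding first_exceed_def
  proof (rule Least_equality)
    fix y assume y: "y = Suc m \<or> a < x y"
    show "k \<le> y" using y * assms by (metis le_SucI linorder_not_less)
  qed (use * in simp)
qed

lemma first_exceed_eq_Suc_iff: "first_exceed x a m = Suc m \<longleftrightarrow> (\<forall>j\<le>m. x j \<le> a)"
proof
  assume eq: "first_exceed x a m = Suc m"
  show "\<forall>j\<le>m. x j \<le> a"
    using not_less_Least[of _ "\<lambda>k. k = Suc m \<or> a < x k"] eq unfolding first_exceed_def
    by (metis le_imp_less_Suc linorder_not_less)
next
  assume *: "\<forall>j\<le>m. x j \<le> a"
  show "first_exceed x a m = Suc m" unfolding first_exceed_def
    by (rule Least_equality) (use * in \<open>auto simp: not_less_eq_eq[symmetric]\<close>)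
qed

lemma exceed_at:
  assumes "first_exceed x a m \<le> m"
  shows "a < x (first_exceed x a m)" and "\<And>j. j < first_exceed x a m \<Longrightarrow> x j \<le> a"
  using first_exceed_eq_iff[OF assms, of x a] by auto

locale path_grid =
  fixes T a :: real and f :: "real \<Rightarrow> real"
  assumes T: "0 < T" and cont: "continuous_on {0..T} f" and start: "f 0 \<le> a"
begin

definition grid :: "nat \<Rightarrow> nat \<Rightarrow> real" where
  "grid n k = f (real k * (T / real (Suc n)))"

lemma grid_time: "k \<le> Suc n \<Longrightarrow> real k * (T / real (Suc n)) \<in> {0..T}"
proof -
  assume "k \<le> Suc n"
  then have "real k * T \<le> real (Suc n) * T" using T by (intro mult_right_mono) auto
  then show ?thesis using T by (auto simp: divide_le_eq mult.commute)
qed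

lemma uniform:
  assumes "0 < e"
  shows "\<exists>n0. \<forall>n\<ge>n0. \<forall>s\<in>{0..T}. \<forall>t\<in>{0..T}. \<bar>s - t\<bar> \<le> T / real (Suc n) \<longrightarrow> \<bar>f s - f t\<bar> < e"
proof -
  have "uniformly_continuous_on {0..T} f" using cont by (intro compact_uniformly_continuous) auto
  then obtain d where d: "0 < d" "\<And>s t. s \<in> {0..T} \<Longrightarrow> t \<in> {0..T} \<Longrightarrow> \<bar>s - t\<bar> < d \<Longrightarrow> \<bar>f s - f t\<bar> < e"
    using assms unfolding uniformly_continuous_on_def dist_real_def by metis
  obtain n0 :: nat where n0: "T / d < real n0" using reals_Archimedean2 by blast
  show ?thesis
  proof (intro exI[of _ n0] allI ballI impI)
    fix n s t assume n: "n0 \<le> n" and st: "s \<in> {0..T}" "t \<in> {0..T}" "\<bar>s - t\<bar> \<le> T / real (Suc n)"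
    have "T / d < real (Suc n)" using n0 n by simp
    then have "T / real (Suc n) < d" using d(1) T by (simp add: field_simps)
    then show "\<bar>f s - f t\<bar> < e" using st d by auto
  qed
qed

text \<open>The last grid time before \<open>t\<close> is within one mesh width of \<open>t\<close>,
  so uniform continuity keeps the path above the level there once the grid is fine.\<close>

lemma eventually_grid_exceeds:
  assumes "t \<in> {0..T}" "a < f t"
  shows "\<forall>\<^sub>F n in sequentially. first_exceed (grid n) a (Suc n) \<le> Suc n"
proof -
  have "0 < f t - a" using assms by simp
  from uniform[OF this] obtain n0 where
    n0: "\<And>n s. n0 \<le> n \<Longrightarrow> s \<in> {0..T} \<Longrightarrow> \<bar>s - t\<bar> \<le> T / real (Suc n) \<Longrightarrow> \<bar>f s - f t\<bar> < f t - a"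
    using assms(1) by blast
  show ?thesis
    unfolding eventually_sequentially
  proof (intro exI[of _ n0] allI impI)
    fix n assume n: "n0 \<le> n"
    define h where "h = T / real (Suc n)"
    have h: "0 < h" "real (Suc n) * h = T" using T by (auto simp: h_def)
    define k where "k = nat \<lfloor>t / h\<rfloor>"
    have "0 \<le> t / h" using assms h by auto
    then have k: "real k \<le> t / h" "t / h < real k + 1" by (auto simp: k_def)
    have k': "real k * h \<le> t" "t < real k * h + h"
      using k h by (auto simp: field_simps)
    have "real k * h \<le> real (Suc n) * h" using k'(1) assms h by auto
    then have kn: "k \<le> Suc n" using h(1) by (simp del: of_nat_Suc)
    have "\<bar>f (real k * h) - f t\<bar> < f t - a"
    proof (rule n0[OF n])
      show "real k * h \<in> {0..T}" using grid_time[OF kn] by (simp only: h_def)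
      show "\<bar>real k * h - t\<bar> \<le> T / real (Suc n)" using k' h(1) unfolding h_def[symmetric] by simp
    qed
    then have "a < grid n k" unfolding grid_def h_def[symmetric] by linarith
    then have "first_exceed (grid n) a (Suc n) \<noteq> Suc (Suc n)"
      unfolding first_exceed_eq_Suc_iff using kn by force
    then show "first_exceed (grid n) a (Suc n) \<le> Suc n"
      using first_exceed_le[of "grid n" a "Suc n"] by auto
  qed
qed

text \<open>The overshoot is at most the last grid step of the path: the preceding grid value is
  still at most \<open>a\<close>, and it exists because the path starts at or below
  \<open>a\<close>.\<close>

lemma grid_first_exceed_tendsto:
  assumes "t \<in> {0..T}" "a < f t"
  shows "(\<lambda>n. grid n (first_exceed (grid n) a (Suc n))) \<longlonglongrightarrow> a"
proof (rule tendstoI)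
  fix e :: real assume e: "0 < e"
  obtain n0 where n0: "\<And>n s t. n0 \<le> n \<Longrightarrow> s \<in> {0..T} \<Longrightarrow> t \<in> {0..T} \<Longrightarrow> \<bar>s - t\<bar> \<le> T / real (Suc n) \<Longrightarrow> \<bar>f s - f t\<bar> < e"
    using uniform[OF e] by blast
  from eventually_grid_exceeds[OF assms] eventually_ge_at_top[of n0]
  show "\<forall>\<^sub>F n in sequentially. dist (grid n (first_exceed (grid n) a (Suc n))) a < e"
  proof eventually_elim
    case (elim n)
    define k where "k = first_exceed (grid n) a (Suc n)"
    have k: "k \<le> Suc n" "a < grid n k" "\<And>j. j < k \<Longrightarrow> grid n j \<le> a"
      using exceed_at[OF elim(1)] elim(1) by (auto simp: k_def)
    have "k \<noteq> 0" using k(2) start by (auto simp: grid_def intro: ccontr)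
    then obtain j where j: "k = Suc j" by (cases k) auto
    have "\<bar>grid n k - grid n j\<bar> < e"
    proof -
      have "real (Suc j) * h - real j * h = h" for h :: real by (simp add: algebra_simps)
      then have eq: "real k * (T / real (Suc n)) - real j * (T / real (Suc n)) = T / real (Suc n)"
        unfolding j by blast
      have "\<bar>real k * (T / real (Suc n)) - real j * (T / real (Suc n))\<bar> \<le> T / real (Suc n)"
        unfolding eq using T by simp
      then show ?thesis
        unfolding grid_def using k(1) j by (intro n0[OF elim(2)] grid_time) auto
    qed
    moreover have "grid n j \<le> a" using k(3) j by simp
    ultimately show ?case using k(2) by (simp add: dist_real_def k_def[symmetric])
  qed
qed

lemma first_exceed_grid_none:
  assumes "\<And>t. t \<in> {0..T} \<Longrightarrow> f t \<le> a"
  shows "first_exceed (grid n) a (Suc n) = Suc (Suc n)"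
  unfolding first_exceed_eq_Suc_iff grid_def using grid_time assms by auto

lemma exceeds_iff_grid: "(\<exists>t\<in>{0..T}. a < f t) \<longleftrightarrow> (\<exists>n. \<exists>k\<le>Suc n. a < f (real k * (T / real (Suc n))))"
proof
  assume "\<exists>t\<in>{0..T}. a < f t"
  then obtain n where "first_exceed (grid n) a (Suc n) \<le> Suc n"
    using eventually_grid_exceeds unfolding eventually_sequentially by blast
  then show "\<exists>n. \<exists>k\<le>Suc n. a < f (real k * (T / real (Suc n)))"
    using exceed_at(1)[of "grid n" a "Suc n"] unfolding grid_def by blast
qed (use grid_time in blast)

end

section \<open>Stopping at a random index, and symmetry and exponential moments of normal
  increments\<close>

context prob_space
begin

text \<open>Optional stopping for finitely many times: on each event \<open>\<kappa> = k\<close> the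
  variable \<open>w k\<close> has the same integral as the terminal variable \<open>u\<close>, and
  these events partition the space.\<close>

lemma expectation_random_index:
  fixes w :: "nat \<Rightarrow> 'a \<Rightarrow> real"
  assumes \<kappa>: "\<And>\<omega>. \<omega> \<in> space M \<Longrightarrow> \<kappa> \<omega> \<le> m" and ev: "\<And>k. k \<le> m \<Longrightarrow> {\<omega> \<in> space M. \<kappa> \<omega> = k} \<in> events"
    and w: "\<And>k. k \<le> m \<Longrightarrow> integrable M (w k)" and u: "integrable M u"
    and eq: "\<And>k. k \<le> m \<Longrightarrow> (\<integral>\<omega>. indicator {\<omega> \<in> space M. \<kappa> \<omega> = k} \<omega> * w k \<omega> \<partial>M)
        = (\<integral>\<omega>. indicator {\<omega> \<in> space M. \<kappa> \<omega> = k} \<omega> * u \<omega> \<partial>M)"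
  shows "(\<integral>\<omega>. w (\<kappa> \<omega>) \<omega> \<partial>M) = (\<integral>\<omega>. u \<omega> \<partial>M)"
    and "integrable M (\<lambda>\<omega>. w (\<kappa> \<omega>) \<omega>)"
proof -
  let ?I = "\<lambda>k. indicator {\<omega> \<in> space M. \<kappa> \<omega> = k} :: 'a \<Rightarrow> real"
  have split: "(\<Sum>k\<le>m. ?I k \<omega> * v k) = v (\<kappa> \<omega>)" if "\<omega> \<in> space M" for \<omega> and v :: "nat \<Rightarrow> real"
  proof -
    have "(\<Sum>k\<le>m. ?I k \<omega> * v k) = (\<Sum>k\<le>m. if k = \<kappa> \<omega> then v k else 0)"
      using that by (intro sum.cong) (auto simp: indicator_def)
    then show ?thesis using \<kappa>[OF that] by simp
  qed
  have int: "integrable M (\<lambda>\<omega>. ?I k \<omega> * v \<omega>)" if "k \<le> m" "integrable M v" for k and v :: "'a \<Rightarrow> real"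
    using integrable_mult_indicator[OF ev[OF that(1)] that(2)] by simp
  have "(\<integral>\<omega>. w (\<kappa> \<omega>) \<omega> \<partial>M) = (\<integral>\<omega>. (\<Sum>k\<le>m. ?I k \<omega> * w k \<omega>) \<partial>M)"
    by (intro Bochner_Integration.integral_cong refl) (rule split[of _ "\<lambda>k. w k _", symmetric])
  also have "\<dots> = (\<Sum>k\<le>m. \<integral>\<omega>. ?I k \<omega> * w k \<omega> \<partial>M)"
    using w by (intro Bochner_Integration.integral_sum int) auto
  also have "\<dots> = (\<Sum>k\<le>m. \<integral>\<omega>. ?I k \<omega> * u \<omega> \<partial>M)" by (intro sum.cong eq) auto
  also have "\<dots> = (\<integral>\<omega>. (\<Sum>k\<le>m. ?I k \<omega> * u \<omega>) \<partial>M)"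
    using u by (intro Bochner_Integration.integral_sum[symmetric] int) auto
  also have "\<dots> = (\<integral>\<omega>. u \<omega> \<partial>M)"
    by (intro Bochner_Integration.integral_cong refl) (rule split[of _ "\<lambda>k. u _"])
  finally show "(\<integral>\<omega>. w (\<kappa> \<omega>) \<omega> \<partial>M) = (\<integral>\<omega>. u \<omega> \<partial>M)" .
  have "integrable M (\<lambda>\<omega>. \<Sum>k\<le>m. ?I k \<omega> * w k \<omega>)"
    using w by (intro Bochner_Integration.integrable_sum int) auto
  moreover have "integrable M (\<lambda>\<omega>. \<Sum>k\<le>m. ?I k \<omega> * w k \<omega>) \<longleftrightarrow> integrable M (\<lambda>\<omega>. w (\<kappa> \<omega>) \<omega>)"
    by (intro Bochner_Integration.integrable_cong refl) (rule split[of _ "\<lambda>k. w k _"])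
  ultimately show "integrable M (\<lambda>\<omega>. w (\<kappa> \<omega>) \<omega>)" by blast
qed

lemma distr_neg_normal:
  assumes R: "distributed M lborel R (normal_density 0 \<sigma>)" and \<sigma>: "0 < \<sigma>"
  shows "distr M borel (\<lambda>\<omega>. - R \<omega>) = distr M borel R"
proof -
  have "distributed M lborel (\<lambda>\<omega>. - R \<omega>) (normal_density 0 \<sigma>)"
    using normal_density_affine[OF R \<sigma>, of "- 1" 0] by simp
  then have "distr M lborel (\<lambda>\<omega>. - R \<omega>) = distr M lborel R"
    using R by (simp add: distributed_def)
  moreover have "distr M borel f = distr M lborel f" for f :: "'a \<Rightarrow> real"
    by (rule distr_cong) auto
  ultimately show ?thesis by simp
qed

lemma distr_pair_indep:
  assumes ind: "indep_var N P N' Q" and \<rho>: "\<rho> \<in> borel_measurable N'"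
  shows "distr M (N \<Otimes>\<^sub>M borel) (\<lambda>\<omega>. (P \<omega>, \<rho> (Q \<omega>) :: real))
    = distr M N P \<Otimes>\<^sub>M distr M borel (\<lambda>\<omega>. \<rho> (Q \<omega>))"
proof -
  have P: "random_variable N P" and Q: "random_variable N' Q"
    using ind by (auto dest: indep_var_rv1 indep_var_rv2)
  have \<rho>Q: "random_variable borel (\<lambda>\<omega>. \<rho> (Q \<omega>))"
    using measurable_compose[OF Q \<rho>] by simp
  interpret D: prob_space "distr M borel (\<lambda>\<omega>. \<rho> (Q \<omega>))" by (rule prob_space_distr[OF \<rho>Q])
  have dQ: "distr (distr M N' Q) borel \<rho> = distr M borel (\<lambda>\<omega>. \<rho> (Q \<omega>))"
    using \<rho> Q by (simp add: distr_distr comp_def)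
  have dP: "distr (distr M N P) N (\<lambda>x. x) = distr M N P" by (rule distr_id2) simp
  have "distr (distr M N P) N (\<lambda>x. x) \<Otimes>\<^sub>M distr (distr M N' Q) borel \<rho>
    = distr (distr M N P \<Otimes>\<^sub>M distr M N' Q) (N \<Otimes>\<^sub>M borel) (\<lambda>(x, y). (x, \<rho> y))"
    using \<rho> D.sigma_finite_measure_axioms by (intro pair_measure_distr) (simp_all add: dQ)
  also have "distr M N P \<Otimes>\<^sub>M distr M N' Q = distr M (N \<Otimes>\<^sub>M N') (\<lambda>\<omega>. (P \<omega>, Q \<omega>))"
    using ind by (simp add: indep_var_distribution_eq)
  also have "distr (distr M (N \<Otimes>\<^sub>M N') (\<lambda>\<omega>. (P \<omega>, Q \<omega>))) (N \<Otimes>\<^sub>M borel) (\<lambda>(x, y). (x, \<rho> y))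
    = distr M (N \<Otimes>\<^sub>M borel) (\<lambda>\<omega>. (P \<omega>, \<rho> (Q \<omega>)))"
    using P Q \<rho> by (subst distr_distr) (auto simp: comp_def)
  finally show ?thesis by (simp add: dP dQ)
qed

text \<open>Past and increment are independent, so their joint law is a product whose second factor,
  a centred normal law, is symmetric. The increment is read off from the future variable
  \<open>Q\<close> by \<open>\<rho>\<close>.\<close>

lemma expectation_reflect:
  fixes g :: "'b \<times> real \<Rightarrow> real"
  assumes ind: "indep_var N P N' Q" and \<rho>: "\<rho> \<in> borel_measurable N'"
    and R: "distributed M lborel (\<lambda>\<omega>. \<rho> (Q \<omega>)) (normal_density 0 \<sigma>)" and \<sigma>: "0 < \<sigma>"
    and g: "g \<in> borel_measurable (N \<Otimes>\<^sub>M borel)"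
  shows "(\<integral>\<omega>. g (P \<omega>, \<rho> (Q \<omega>)) \<partial>M) = (\<integral>\<omega>. g (P \<omega>, - \<rho> (Q \<omega>)) \<partial>M)"
proof -
  have \<rho>': "(\<lambda>x. - \<rho> x) \<in> borel_measurable N'" using \<rho> by simp
  have P: "random_variable N P" and Q: "random_variable N' Q"
    using ind by (auto dest: indep_var_rv1 indep_var_rv2)
  have d: "distr M (N \<Otimes>\<^sub>M borel) (\<lambda>\<omega>. (P \<omega>, \<rho> (Q \<omega>))) = distr M (N \<Otimes>\<^sub>M borel) (\<lambda>\<omega>. (P \<omega>, - \<rho> (Q \<omega>)))"
    unfolding distr_pair_indep[OF ind \<rho>] distr_pair_indep[OF ind \<rho>'] distr_neg_normal[OF R \<sigma>] ..
  have m: "random_variable (N \<Otimes>\<^sub>M borel) (\<lambda>\<omega>. (P \<omega>, \<rho> (Q \<omega>)))" "random_variable (N \<Otimes>\<^sub>M borel) (\<lambda>\<omega>. (P \<omega>, - \<rho> (Q \<omega>)))"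
    using measurable_Pair[OF P measurable_compose[OF Q \<rho>]] measurable_Pair[OF P measurable_compose[OF Q \<rho>']] by simp_all
  show ?thesis
    using integral_distr[OF m(1) g] integral_distr[OF m(2) g] d by simp
qed

end

text \<open>Completing the square: an exponential tilt shifts the mean of a normal law by
  \<open>\<theta> * \<sigma>\<^sup>2\<close>.\<close>

lemma exp_times_normal_density:
  assumes "0 < \<sigma>"
  shows "exp (\<theta> * x) * normal_density 0 \<sigma> x = exp (\<theta>\<^sup>2 * \<sigma>\<^sup>2 / 2) * normal_density (\<theta> * \<sigma>\<^sup>2) \<sigma> x"
proof -
  have "\<theta> * x + - (x - 0)\<^sup>2 / (2 * \<sigma>\<^sup>2) = \<theta>\<^sup>2 * \<sigma>\<^sup>2 / 2 + - (x - \<theta> * \<sigma>\<^sup>2)\<^sup>2 / (2 * \<sigma>\<^sup>2)"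
    using assms by (simp add: power2_eq_square field_simps)
  then have "exp (\<theta> * x) * exp (- (x - 0)\<^sup>2 / (2 * \<sigma>\<^sup>2)) = exp (\<theta>\<^sup>2 * \<sigma>\<^sup>2 / 2) * exp (- (x - \<theta> * \<sigma>\<^sup>2)\<^sup>2 / (2 * \<sigma>\<^sup>2))"
    by (simp only: exp_add[symmetric])
  then show ?thesis by (simp add: normal_density_def)
qed

context prob_space
begin

lemma exp_normal:
  assumes X: "distributed M lborel X (normal_density 0 \<sigma>)" and \<sigma>: "0 < \<sigma>"
  shows "integrable M (\<lambda>\<omega>. exp (\<theta> * X \<omega>))"
    and "(\<integral>\<omega>. exp (\<theta> * X \<omega>) \<partial>M) = exp (\<theta>\<^sup>2 * \<sigma>\<^sup>2 / 2)"
proof -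
  have m: "(\<lambda>x. exp (\<theta> * x)) \<in> borel_measurable lborel" by simp
  have "integrable lborel (\<lambda>x. normal_density 0 \<sigma> x * exp (\<theta> * x))"
    using \<sigma> by (simp add: mult.commute[of "normal_density _ _ _"] exp_times_normal_density)
  then show "integrable M (\<lambda>\<omega>. exp (\<theta> * X \<omega>))"
    using distributed_integrable[OF X m] by simp
  have "(\<integral>\<omega>. exp (\<theta> * X \<omega>) \<partial>M) = (\<integral>x. normal_density 0 \<sigma> x * exp (\<theta> * x) \<partial>lborel)"
    using distributed_integral[OF X m] by simp
  also have "\<dots> = exp (\<theta>\<^sup>2 * \<sigma>\<^sup>2 / 2)"
    using \<sigma> by (simp add: mult.commute[of "normal_density _ _ _"] exp_times_normal_density)
  finally show "(\<integral>\<omega>. exp (\<theta> * X \<omega>) \<partial>M) = exp (\<theta>\<^sup>2 * \<sigma>\<^sup>2 / 2)" .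
qed

lemma distributed_no_atom:
  assumes X: "distributed M lborel X (normal_density 0 \<sigma>)"
  shows "AE \<omega> in M. X \<omega> \<noteq> a"
proof -
  have "random_variable borel X" using X by (simp add: distributed_def)
  moreover have "emeasure M (X -` {a} \<inter> space M) = (\<integral>\<^sup>+x. ennreal (normal_density 0 \<sigma> x) * indicator {a} x \<partial>lborel)"
    using distributed_emeasure[OF X, of "{a}"] by simp
  moreover have "\<dots> = 0"
  proof (subst nn_integral_0_iff_AE)
    show "AE x in lborel. ennreal (normal_density 0 \<sigma> x) * indicator {a} x = 0"
      using AE_lborel_singleton[of a] by eventually_elim auto
    show "(\<lambda>x. ennreal (normal_density 0 \<sigma> x) * indicator {a} x) \<in> borel_measurable lborel"
      by measurable
  qed
  ultimately show ?thesis
    by (intro AE_I[of _ _ "X -` {a} \<inter> space M"]) auto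
qed

end

section \<open>Brownian motion with a drift, stopped on a grid\<close>

text \<open>The start at 0 is required at every sample point, so that past increments add up to the
  current value everywhere. Subtracting the value at time 0 brings any standard Brownian motion into
  this form.\<close>

locale standard_bm = prob_space +
  fixes X :: "real \<Rightarrow> 'a \<Rightarrow> real"
  assumes bm: "standard_brownian_motion X" and zero: "\<And>\<omega>. \<omega> \<in> space M \<Longrightarrow> X 0 \<omega> = 0"
begin

lemma X_measurable: "0 \<le> t \<Longrightarrow> random_variable borel (X t)"
  using bm unfolding standard_brownian_motion_def by auto

lemma X_continuous: "\<omega> \<in> space M \<Longrightarrow> continuous_on {0..T} (\<lambda>t. X t \<omega>)"
  using bm unfolding standard_brownian_motion_def by (auto intro: continuous_on_subset)

lemma X_increment:
  "0 \<le> s \<Longrightarrow> s < t \<Longrightarrow> distributed M lborel (\<lambda>\<omega>. X t \<omega> - X s \<omega>) (normal_density 0 (sqrt (t - s)))"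
  using bm unfolding standard_brownian_motion_def by auto

lemma X_normal:
  assumes "0 < t"
  shows "distributed M lborel (X t) (normal_density 0 (sqrt t))"
proof (rule distributed_cong_AE)
  show "distributed M lborel (\<lambda>\<omega>. X t \<omega> - X 0 \<omega>) (normal_density 0 (sqrt t))"
    using X_increment[of 0 t] assms by simp
  show "AE \<omega> in M. X t \<omega> - X 0 \<omega> = X t \<omega>" by (rule AE_I2) (simp add: zero)
  show "random_variable lborel (X t)" using X_measurable[of t] assms by simp
qed

text \<open>The partition consists of the first grid times up to \<open>k\<close> and the single
  further time \<open>u\<close>. The index set \<open>{k}\<close> of the second vector is the form
  in which splitting an independent family delivers one increment.\<close>

lemma past_indep_future:
  assumes h: "0 < h" and u: "real k * h < u"
  defines "t \<equiv> \<lambda>i. real i * h"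
  shows "indep_var (Pi\<^sub>M {..<k} (\<lambda>_. borel)) (\<lambda>\<omega>. \<lambda>i\<in>{..<k}. X (t (Suc i)) \<omega> - X (t i) \<omega>)
    (Pi\<^sub>M {k} (\<lambda>_. borel)) (\<lambda>\<omega>. \<lambda>i\<in>{k}. X u \<omega> - X (t k) \<omega>)"
proof -
  define t' where "t' i = (if i \<le> k then t i else u)" for i
  have "0 \<le> t' 0 \<and> (\<forall>i<Suc k. t' i < t' (Suc i))"
    using h u by (auto simp: t'_def t_def less_Suc_eq)
  then have "indep_vars (\<lambda>_. borel) (\<lambda>i \<omega>. X (t' (Suc i)) \<omega> - X (t' i) \<omega>) {..<Suc k}"
    using bm unfolding standard_brownian_motion_def by blast
  then have "indep_var (Pi\<^sub>M {..<k} (\<lambda>_. borel)) (\<lambda>\<omega>. \<lambda>i\<in>{..<k}. X (t' (Suc i)) \<omega> - X (t' i) \<omega>)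
    (Pi\<^sub>M {k} (\<lambda>_. borel)) (\<lambda>\<omega>. \<lambda>i\<in>{k}. X (t' (Suc i)) \<omega> - X (t' i) \<omega>)"
    by (rule indep_var_restrict) auto
  moreover have "(\<lambda>i\<in>{..<k}. X (t' (Suc i)) \<omega> - X (t' i) \<omega>) = (\<lambda>i\<in>{..<k}. X (t (Suc i)) \<omega> - X (t i) \<omega>)"
    "(\<lambda>i\<in>{k}. X (t' (Suc i)) \<omega> - X (t' i) \<omega>) = (\<lambda>i\<in>{k}. X u \<omega> - X (t k) \<omega>)" for \<omega>
    by (auto simp: t'_def restrict_def fun_eq_iff)
  ultimately show ?thesis by simp
qed

context
  fixes T a b :: real
  assumes T: "0 < T" and a: "0 \<le> a"
begin

definition gtime :: "nat \<Rightarrow> nat \<Rightarrow> real" where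
  "gtime n k = real k * (T / real (Suc n))"

text \<open>Slope \<open>b = 0\<close> serves the reflection principle, \<open>b > 0\<close> the
  passage of a line.\<close>

definition drifted :: "nat \<Rightarrow> nat \<Rightarrow> 'a \<Rightarrow> real" where
  "drifted n k \<omega> = X (gtime n k) \<omega> - b * gtime n k"

text \<open>The grid indices are 0 to \<open>Suc n\<close>, the latter belonging to time
  \<open>T\<close>; the value \<open>Suc (Suc n)\<close> stands for no passage.\<close>

definition passage :: "nat \<Rightarrow> 'a \<Rightarrow> nat" where
  "passage n \<omega> = first_exceed (\<lambda>k. drifted n k \<omega>) a (Suc n)"

definition past :: "nat \<Rightarrow> nat \<Rightarrow> 'a \<Rightarrow> nat \<Rightarrow> real" where
  "past n k \<omega> = (\<lambda>i\<in>{..<k}. X (gtime n (Suc i)) \<omega> - X (gtime n i) \<omega>)"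

text \<open>The event that the passage is at grid index \<open>k\<close>, as a set of vectors of the
  first \<open>k\<close> increments. In this form it is visibly independent of everything after grid
  time \<open>k\<close>.\<close>

definition past_passes :: "nat \<Rightarrow> nat \<Rightarrow> (nat \<Rightarrow> real) set" where
  "past_passes n k = {v \<in> space (Pi\<^sub>M {..<k} (\<lambda>_. borel)). (\<forall>j<k. (\<Sum>i<j. v i) - b * gtime n j \<le> a)
      \<and> a < (\<Sum>i<k. v i) - b * gtime n k}"

lemma gtime_0 [simp]: "gtime n 0 = 0" and gtime_last [simp]: "gtime n (Suc n) = T"
  by (simp_all add: gtime_def del: of_nat_Suc)

lemma gtime_nonneg [simp]: "0 \<le> gtime n k"
  using T by (simp add: gtime_def)

lemma gtime_less: "k \<le> n \<Longrightarrow> gtime n k < T"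
proof -
  assume "k \<le> n"
  then have "real k * T < real (Suc n) * T" using T by (intro mult_strict_right_mono) auto
  then show ?thesis by (simp add: gtime_def field_simps)
qed

lemma drifted_measurable [measurable]: "random_variable borel (drifted n k)"
  unfolding drifted_def by (intro borel_measurable_diff X_measurable) auto

lemma passage_le: "passage n \<omega> \<le> Suc (Suc n)"
  unfolding passage_def by (rule first_exceed_le)

lemma passage_eq_event: "{\<omega> \<in> space M. passage n \<omega> = k} \<in> events"
proof (cases "k \<le> Suc n")
  case True
  then show ?thesis unfolding passage_def first_exceed_eq_iff[OF True] by measurable
next
  case False
  show ?thesis
  proof (cases "k = Suc (Suc n)")
    case True
    then show ?thesis unfolding True passage_def first_exceed_eq_Suc_iff by measurable
  next
    case 2: False
    with False have "passage n \<omega> \<noteq> k" for \<omega> using passage_le[of n \<omega>] by linarith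
    then show ?thesis by simp
  qed
qed

lemma past_sum:
  assumes "\<omega> \<in> space M" "j \<le> k"
  shows "(\<Sum>i<j. past n k \<omega> i) = X (gtime n j) \<omega>"
proof -
  have "(\<Sum>i<j. past n k \<omega> i) = (\<Sum>i<j. X (gtime n (Suc i)) \<omega> - X (gtime n i) \<omega>)"
    using assms by (intro sum.cong) (auto simp: past_def)
  also have "\<dots> = X (gtime n j) \<omega> - X (gtime n 0) \<omega>"
    by (rule sum_lessThan_telescope)
  finally show ?thesis using zero[OF assms(1)] by simp
qed

lemma past_passes_iff:
  assumes "\<omega> \<in> space M" "k \<le> Suc n"
  shows "past n k \<omega> \<in> past_passes n k \<longleftrightarrow> passage n \<omega> = k"
proof -
  have "past n k \<omega> \<in> space (Pi\<^sub>M {..<k} (\<lambda>_. borel))" by (auto simp: space_PiM past_def)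
  then show ?thesis
    unfolding past_passes_def passage_def first_exceed_eq_iff[OF assms(2)]
    using past_sum[OF assms(1), of _ k n] by (auto simp: drifted_def)
qed

lemma past_passes_sets [measurable]: "past_passes n k \<in> sets (Pi\<^sub>M {..<k} (\<lambda>_. borel))"
proof -
  have S: "(\<lambda>v. (\<Sum>i<j. v i) - b * gtime n j :: real) \<in> borel_measurable (Pi\<^sub>M {..<k} (\<lambda>_. borel))" if "j \<le> k" for j
    using that by (intro borel_measurable_diff borel_measurable_sum measurable_component_singleton borel_measurable_const) auto
  have 1: "{v \<in> space (Pi\<^sub>M {..<k} (\<lambda>_. borel)). (\<Sum>i<j. v i) - b * gtime n j \<le> a} \<in> sets (Pi\<^sub>M {..<k} (\<lambda>_. borel))"
    if "j < k" for j using borel_measurable_le[OF S borel_measurable_const] that by simp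
  have 2: "{v \<in> space (Pi\<^sub>M {..<k} (\<lambda>_. borel)). a < (\<Sum>i<k. v i) - b * gtime n k} \<in> sets (Pi\<^sub>M {..<k} (\<lambda>_. borel))"
    using borel_measurable_less[OF borel_measurable_const S[OF order.refl]] by simp
  have "past_passes n k = {v \<in> space (Pi\<^sub>M {..<k} (\<lambda>_. borel)). \<forall>j<k. (\<Sum>i<j. v i) - b * gtime n j \<le> a}
     \<inter> {v \<in> space (Pi\<^sub>M {..<k} (\<lambda>_. borel)). a < (\<Sum>i<k. v i) - b * gtime n k}"
    by (auto simp: past_passes_def)
  moreover have "{v \<in> space (Pi\<^sub>M {..<k} (\<lambda>_. borel)). \<forall>j<k. (\<Sum>i<j. v i) - b * gtime n j \<le> a} \<in> sets (Pi\<^sub>M {..<k} (\<lambda>_. borel))"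
  proof (cases "k = 0")
    case False
    then have "(\<Inter>j\<in>{..<k}. {v \<in> space (Pi\<^sub>M {..<k} (\<lambda>_. borel)). (\<Sum>i<j. v i) - b * gtime n j \<le> a}) \<in> sets (Pi\<^sub>M {..<k} (\<lambda>_. borel))"
      using 1 by (intro sets.finite_INT) auto
    also have "(\<Inter>j\<in>{..<k}. {v \<in> space (Pi\<^sub>M {..<k} (\<lambda>_. borel)). (\<Sum>i<j. v i) - b * gtime n j \<le> a})
      = {v \<in> space (Pi\<^sub>M {..<k} (\<lambda>_. borel)). \<forall>j<k. (\<Sum>i<j. v i) - b * gtime n j \<le> a}"
      using False by blast
    finally show ?thesis .
  next
    case True
    show ?thesis unfolding True by (simp only: not_less_zero simp_thms) simp
  qed
  ultimately show ?thesis using 2 by (simp only: sets.Int)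
qed

lemma past_indep:
  assumes "k \<le> n"
  shows "indep_var (Pi\<^sub>M {..<k} (\<lambda>_. borel)) (past n k)
    (Pi\<^sub>M {k} (\<lambda>_. borel)) (\<lambda>\<omega>. \<lambda>i\<in>{k}. X T \<omega> - X (gtime n k) \<omega>)"
  using past_indep_future[of "T / real (Suc n)" k T] T gtime_less[OF assms]
  unfolding past_def gtime_def by simp

lemma path_grid: "\<omega> \<in> space M \<Longrightarrow> path_grid T a (\<lambda>t. X t \<omega> - b * t)"
proof
  assume \<omega>: "\<omega> \<in> space M"
  show "continuous_on {0..T} (\<lambda>t. X t \<omega> - b * t)" by (intro continuous_intros X_continuous \<omega>)
  show "X 0 \<omega> - b * 0 \<le> a" using a zero[OF \<omega>] by simp
qed (rule T)

lemma passage_path_grid: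
  assumes "\<omega> \<in> space M"
  shows "passage n \<omega> = first_exceed (path_grid.grid T (\<lambda>t. X t \<omega> - b * t) n) a (Suc n)"
  unfolding passage_def drifted_def gtime_def path_grid.grid_def[OF path_grid[OF assms]] ..

definition crosses :: "'a set" where
  "crosses = {\<omega> \<in> space M. \<exists>t\<in>{0..T}. a < X t \<omega> - b * t}"

lemma crosses_event: "crosses \<in> events"
proof -
  have "crosses = {\<omega> \<in> space M. \<exists>n. \<exists>k\<le>Suc n. a < drifted n k \<omega>}"
    using path_grid.exceeds_iff_grid[OF path_grid] unfolding crosses_def drifted_def gtime_def by blast
  then show ?thesis by auto
qed

lemma passage_tendsto:
  assumes "\<omega> \<in> crosses"
  shows "\<forall>\<^sub>F n in sequentially. passage n \<omega> \<le> Suc n"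
    and "(\<lambda>n. drifted n (passage n \<omega>) \<omega>) \<longlonglongrightarrow> a"
proof -
  from assms obtain t where t: "\<omega> \<in> space M" "t \<in> {0..T}" "a < X t \<omega> - b * t" by (auto simp: crosses_def)
  note pg = path_grid[OF t(1)]
  show "\<forall>\<^sub>F n in sequentially. passage n \<omega> \<le> Suc n"
    using path_grid.eventually_grid_exceeds[OF pg t(2,3)] by (simp add: passage_path_grid t(1))
  show "(\<lambda>n. drifted n (passage n \<omega>) \<omega>) \<longlonglongrightarrow> a"
    using path_grid.grid_first_exceed_tendsto[OF pg t(2,3)]
    by (simp add: passage_path_grid[OF t(1)] path_grid.grid_def[OF pg] drifted_def gtime_def)
qed

lemma passage_none:
  assumes "\<omega> \<in> space M" "\<omega> \<notin> crosses"
  shows "passage n \<omega> = Suc (Suc n)"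
proof -
  have "X t \<omega> - b * t \<le> a" if "t \<in> {0..T}" for t
    using assms that unfolding crosses_def by (auto simp: not_less[symmetric])
  then show ?thesis
    unfolding passage_path_grid[OF assms(1)]
    by (rule path_grid.first_exceed_grid_none[OF path_grid[OF assms(1)]])
qed

end

end

subsection \<open>Reflection principle and passage of a line\<close>

context standard_bm
begin

text \<open>Given the passage at index \<open>k\<close>, the rest of the path contributes an
  independent symmetric increment. Reversing its sign replaces the terminal value X T by 2 X (t_k) -
  X T.\<close>

lemma reflection_step:
  assumes T: "0 < T" and a: "0 \<le> a" and k: "k \<le> Suc n"
  shows "(\<integral>\<omega>. indicator {\<omega> \<in> space M. passage T a 0 n \<omega> = k} \<omega>
        * indicator {\<omega> \<in> space M. a < 2 * X (gtime T n k) \<omega> - X T \<omega>} \<omega> \<partial>M)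
    = (\<integral>\<omega>. indicator {\<omega> \<in> space M. passage T a 0 n \<omega> = k} \<omega> * indicator {\<omega> \<in> space M. a < X T \<omega>} \<omega> \<partial>M :: real)"
proof (cases "k = Suc n")
  case True
  then show ?thesis using gtime_last[OF T a] by simp
next
  case False
  with k have kn: "k \<le> n" by simp
  define N where "N = Pi\<^sub>M {..<k} (\<lambda>_. borel :: real measure)"
  define N' where "N' = Pi\<^sub>M {k} (\<lambda>_. borel :: real measure)"
  define g :: "(nat \<Rightarrow> real) \<times> real \<Rightarrow> real" where
    "g = (\<lambda>(v, r). indicator (past_passes T a 0 n k) v * indicator {a<..} ((\<Sum>i<k. v i) + r))"
  have ind: "indep_var N (past T n k) N' (\<lambda>\<omega>. \<lambda>i\<in>{k}. X T \<omega> - X (gtime T n k) \<omega>)"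
    unfolding N_def N'_def by (rule past_indep[OF T a kn])
  have \<rho>: "(\<lambda>f. f k) \<in> borel_measurable N'"
    unfolding N'_def by (rule measurable_component_singleton) simp
  have \<sigma>: "0 < sqrt (T - gtime T n k)" using gtime_less[OF T a kn] by simp
  have R: "distributed M lborel (\<lambda>\<omega>. (\<lambda>i\<in>{k}. X T \<omega> - X (gtime T n k) \<omega>) k) (normal_density 0 (sqrt (T - gtime T n k)))"
    using X_increment[OF gtime_nonneg[OF T a] gtime_less[OF T a kn]] by simp
  have g: "g \<in> borel_measurable (N \<Otimes>\<^sub>M borel)"
  proof -
    have s: "(\<lambda>v. \<Sum>i<k. v i) \<in> borel_measurable N"
      unfolding N_def by (intro borel_measurable_sum measurable_component_singleton) auto
    have [measurable]: "(\<lambda>p. (\<Sum>i<k. fst p i) + snd p) \<in> borel_measurable (N \<Otimes>\<^sub>M borel)"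
      by (intro borel_measurable_add measurable_compose[OF measurable_fst s] measurable_snd)
    have [measurable]: "past_passes T a 0 n k \<in> sets N"
      unfolding N_def by (rule past_passes_sets[OF T a])
    show ?thesis unfolding g_def case_prod_beta by measurable
  qed
  have sum: "(\<Sum>i<k. past T n k \<omega> i) = X (gtime T n k) \<omega>" if "\<omega> \<in> space M" for \<omega>
    by (rule past_sum[OF T a that order.refl])
  have pp: "past T n k \<omega> \<in> past_passes T a 0 n k \<longleftrightarrow> passage T a 0 n \<omega> = k" if "\<omega> \<in> space M" for \<omega>
    using past_passes_iff[OF T a that k] .
  have "(\<integral>\<omega>. g (past T n k \<omega>, X T \<omega> - X (gtime T n k) \<omega>) \<partial>M)
      = (\<integral>\<omega>. g (past T n k \<omega>, - (X T \<omega> - X (gtime T n k) \<omega>)) \<partial>M)"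
    using expectation_reflect[OF ind \<rho> R \<sigma> g] by simp
  moreover have "(\<integral>\<omega>. g (past T n k \<omega>, X T \<omega> - X (gtime T n k) \<omega>) \<partial>M)
    = (\<integral>\<omega>. indicator {\<omega> \<in> space M. passage T a 0 n \<omega> = k} \<omega> * indicator {\<omega> \<in> space M. a < X T \<omega>} \<omega> \<partial>M)"
    by (intro Bochner_Integration.integral_cong refl) (auto simp: g_def sum pp indicator_def)
  moreover have "(\<integral>\<omega>. g (past T n k \<omega>, - (X T \<omega> - X (gtime T n k) \<omega>)) \<partial>M)
    = (\<integral>\<omega>. indicator {\<omega> \<in> space M. passage T a 0 n \<omega> = k} \<omega>
        * indicator {\<omega> \<in> space M. a < 2 * X (gtime T n k) \<omega> - X T \<omega>} \<omega> \<partial>M)"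
    by (intro Bochner_Integration.integral_cong refl) (auto simp: g_def sum pp indicator_def)
  ultimately show ?thesis by simp
qed

text \<open>As the grid is refined, the value at the passage tends to \<open>a\<close>, so the
  reflected terminal value tends to 2 a - X T and exceeds \<open>a\<close> in the limit exactly if X
  T < a. Hence ending above \<open>a\<close> is as likely as crossing and ending below, and ending
  above implies crossing.\<close>

lemma reflection_principle:
  assumes T: "0 < T" and a: "0 \<le> a"
  shows "prob (crosses T a 0) = 2 * prob {\<omega> \<in> space M. a < X T \<omega>}"
proof -
  let ?C = "crosses T a 0"
  have [measurable]: "random_variable borel (X T)" "random_variable borel (X (gtime T n k))" for n k
    using X_measurable T gtime_nonneg[OF T a] by auto
  have [measurable]: "?C \<in> events" by (rule crosses_event[OF T a])
  define u :: "'a \<Rightarrow> real" where "u = indicator {\<omega> \<in> space M. a < X T \<omega>}"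
  \<comment> \<open>At the index for no passage the reflected variable is \<open>u\<close> itself,
    so the required equality of integrals is trivial there.\<close>
  define w :: "nat \<Rightarrow> nat \<Rightarrow> 'a \<Rightarrow> real" where
    "w n k = (if k \<le> Suc n then indicator {\<omega> \<in> space M. a < 2 * X (gtime T n k) \<omega> - X T \<omega>} else u)" for n k
  have bd: "\<bar>w n k \<omega>\<bar> \<le> 1" for n k \<omega> by (auto simp: w_def u_def indicator_def)
  have meas: "random_variable borel (w n k)" "random_variable borel u" for n k
    unfolding w_def u_def by (cases "k \<le> Suc n") auto
  have int: "integrable M (w n k)" "integrable M u" for n k
    using meas by (auto intro!: integrable_const_bound[of _ 1] simp: bd u_def indicator_def)
  have eq: "(\<integral>\<omega>. w n (passage T a 0 n \<omega>) \<omega> \<partial>M) = (\<integral>\<omega>. u \<omega> \<partial>M)"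
    "integrable M (\<lambda>\<omega>. w n (passage T a 0 n \<omega>) \<omega>)" for n
  proof -
    have "(\<integral>\<omega>. indicator {\<omega> \<in> space M. passage T a 0 n \<omega> = k} \<omega> * w n k \<omega> \<partial>M)
        = (\<integral>\<omega>. indicator {\<omega> \<in> space M. passage T a 0 n \<omega> = k} \<omega> * u \<omega> \<partial>M)" if "k \<le> Suc (Suc n)" for k
    proof (cases "k \<le> Suc n")
      case True
      then show ?thesis using reflection_step[OF T a True] by (simp add: w_def u_def)
    qed (simp add: w_def)
    from expectation_random_index[OF passage_le[OF T a] passage_eq_event[OF T a] int this]
    show "(\<integral>\<omega>. w n (passage T a 0 n \<omega>) \<omega> \<partial>M) = (\<integral>\<omega>. u \<omega> \<partial>M)"
      "integrable M (\<lambda>\<omega>. w n (passage T a 0 n \<omega>) \<omega>)" by auto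
  qed
  define L :: "'a \<Rightarrow> real" where "L = indicator (?C \<inter> {\<omega> \<in> space M. X T \<omega> < a})"
  \<comment> \<open>At X T = a the limit 2 a - X T of the reflected value equals the threshold
    itself and does not decide the indicators; this is a null event.\<close>
  have lim: "(\<lambda>n. w n (passage T a 0 n \<omega>) \<omega>) \<longlonglongrightarrow> L \<omega>" if \<omega>: "\<omega> \<in> space M" "X T \<omega> \<noteq> a" for \<omega>
  proof (cases "\<omega> \<in> ?C")
    case False
    then have "X T \<omega> \<le> a" using \<omega>(1) T by (auto simp: crosses_def[OF T a] not_less dest!: bspec[of _ _ T])
    then have "w n (passage T a 0 n \<omega>) \<omega> = 0" for n
      using passage_none[OF T a \<omega>(1) False] by (simp add: w_def u_def)
    then show ?thesis using False by (simp add: L_def)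
  next
    case True
    have "(\<lambda>n. X (gtime T n (passage T a 0 n \<omega>)) \<omega>) \<longlonglongrightarrow> a"
      using passage_tendsto(2)[OF T a True] by (simp add: drifted_def[OF T a])
    then have t: "(\<lambda>n. 2 * X (gtime T n (passage T a 0 n \<omega>)) \<omega> - X T \<omega>) \<longlonglongrightarrow> 2 * a - X T \<omega>"
      by (intro tendsto_intros)
    show ?thesis
    proof (cases "X T \<omega> < a")
      case less: True
      then have "\<forall>\<^sub>F n in sequentially. a < 2 * X (gtime T n (passage T a 0 n \<omega>)) \<omega> - X T \<omega>"
        using t by (intro order_tendstoD(1)) auto
      with passage_tendsto(1)[OF T a True]
      have "\<forall>\<^sub>F n in sequentially. w n (passage T a 0 n \<omega>) \<omega> = L \<omega>"
        by eventually_elim (use True less \<omega> in \<open>auto simp: w_def L_def\<close>)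
      then show ?thesis by (rule tendsto_eventually)
    next
      case False
      then have "\<forall>\<^sub>F n in sequentially. 2 * X (gtime T n (passage T a 0 n \<omega>)) \<omega> - X T \<omega> < a"
        using t \<omega>(2) by (intro order_tendstoD(2)) auto
      with passage_tendsto(1)[OF T a True]
      have "\<forall>\<^sub>F n in sequentially. w n (passage T a 0 n \<omega>) \<omega> = L \<omega>"
        by eventually_elim (use True False \<omega> in \<open>auto simp: w_def L_def\<close>)
      then show ?thesis by (rule tendsto_eventually)
    qed
  qed
  have ae: "AE \<omega> in M. X T \<omega> \<noteq> a" by (rule distributed_no_atom[OF X_normal[OF T]])
  have "(\<lambda>n. \<integral>\<omega>. w n (passage T a 0 n \<omega>) \<omega> \<partial>M) \<longlonglongrightarrow> (\<integral>\<omega>. L \<omega> \<partial>M)"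
  proof (rule integral_dominated_convergence[where w = "\<lambda>_. 1"])
    show "AE \<omega> in M. (\<lambda>n. w n (passage T a 0 n \<omega>) \<omega>) \<longlonglongrightarrow> L \<omega>"
      using ae AE_space by eventually_elim (rule lim)
  qed (use eq(2) bd in \<open>auto simp: L_def intro: borel_measurable_integrable\<close>)
  then have "(\<integral>\<omega>. u \<omega> \<partial>M) = (\<integral>\<omega>. L \<omega> \<partial>M)"
    by (simp add: eq LIMSEQ_const_iff)
  then have 1: "prob {\<omega> \<in> space M. a < X T \<omega>} = prob (?C \<inter> {\<omega> \<in> space M. X T \<omega> < a})"
    by (simp add: u_def L_def)
  have "prob ?C = prob ((?C \<inter> {\<omega> \<in> space M. X T \<omega> < a}) \<union> {\<omega> \<in> space M. a < X T \<omega>})"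
  proof (rule finite_measure_eq_AE)
    show "AE \<omega> in M. \<omega> \<in> ?C \<longleftrightarrow> \<omega> \<in> (?C \<inter> {\<omega> \<in> space M. X T \<omega> < a}) \<union> {\<omega> \<in> space M. a < X T \<omega>}"
      using ae AE_space by eventually_elim (use T in \<open>auto simp: crosses_def[OF T a] neq_iff intro: bexI[of _ T]\<close>)
  qed auto
  also have "\<dots> = prob (?C \<inter> {\<omega> \<in> space M. X T \<omega> < a}) + prob {\<omega> \<in> space M. a < X T \<omega>}"
    by (rule finite_measure_Union) auto
  finally show ?thesis using 1 by simp
qed

lemma prob_abs_normal:
  assumes T: "0 < T" and x: "0 \<le> x"
  shows "prob {\<omega> \<in> space M. x < \<bar>X T \<omega>\<bar>} = 2 * prob {\<omega> \<in> space M. x < X T \<omega>}"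
proof -
  have [measurable]: "random_variable borel (X T)" using X_measurable T by auto
  have "distr M borel (\<lambda>\<omega>. - X T \<omega>) = distr M borel (X T)"
    using distr_neg_normal[OF X_normal[OF T]] T by simp
  then have "measure (distr M borel (\<lambda>\<omega>. - X T \<omega>)) {x<..} = measure (distr M borel (X T)) {x<..}" by simp
  then have "prob {\<omega> \<in> space M. x < - X T \<omega>} = prob {\<omega> \<in> space M. x < X T \<omega>}"
    by (simp add: measure_distr vimage_def Int_def conj_commute)
  moreover have "prob {\<omega> \<in> space M. x < \<bar>X T \<omega>\<bar>}
      = prob ({\<omega> \<in> space M. x < X T \<omega>} \<union> {\<omega> \<in> space M. x < - X T \<omega>})"
    using x by (intro arg_cong[where f = prob]) auto
  moreover have "\<dots> = prob {\<omega> \<in> space M. x < X T \<omega>} + prob {\<omega> \<in> space M. x < - X T \<omega>}"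
    using x by (intro finite_measure_Union) auto
  ultimately show ?thesis by simp
qed

definition path_sup :: "real \<Rightarrow> 'a \<Rightarrow> real" where
  "path_sup T \<omega> = (SUP t\<in>{0..T}. X t \<omega>)"

lemma bdd_above_path: "\<omega> \<in> space M \<Longrightarrow> bdd_above ((\<lambda>t. X t \<omega>) ` {0..T})"
  by (intro bounded_imp_bdd_above compact_imp_bounded compact_continuous_image X_continuous compact_Icc)

lemma path_le_sup: "\<omega> \<in> space M \<Longrightarrow> t \<in> {0..T} \<Longrightarrow> X t \<omega> \<le> path_sup T \<omega>"
  unfolding path_sup_def by (intro cSUP_upper bdd_above_path)

lemma path_sup_nonneg: "0 < T \<Longrightarrow> \<omega> \<in> space M \<Longrightarrow> 0 \<le> path_sup T \<omega>"
  using path_le_sup[of \<omega> 0 T] zero by simp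

lemma path_sup_greater:
  assumes T: "0 < T" and x: "0 \<le> x"
  shows "{\<omega> \<in> space M. x < path_sup T \<omega>} = crosses T x 0"
  using T less_cSUP_iff[OF _ bdd_above_path, where T1 = T] unfolding path_sup_def crosses_def[OF T x]
  by auto

lemma path_sup_measurable:
  assumes T: "0 < T"
  shows "random_variable borel (path_sup T)"
  unfolding borel_measurable_iff_greater
proof
  fix x
  show "{\<omega> \<in> space M. x < path_sup T \<omega>} \<in> events"
  proof (cases "0 \<le> x")
    case True
    then show ?thesis using path_sup_greater[OF T True] crosses_event[OF T True] by simp
  next
    case False
    then have "x < path_sup T \<omega>" if "\<omega> \<in> space M" for \<omega>
      using path_sup_nonneg[OF T that] by linarith
    then have "{\<omega> \<in> space M. x < path_sup T \<omega>} = space M" by auto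
    then show ?thesis by simp
  qed
qed

lemma distr_path_sup:
  assumes T: "0 < T"
  shows "distr M borel (path_sup T) = distr M borel (\<lambda>\<omega>. \<bar>X T \<omega>\<bar>)"
proof (rule cdf_unique)
  have [measurable]: "random_variable borel (X T)" "random_variable borel (path_sup T)"
    using X_measurable T path_sup_measurable by auto
  show "real_distribution (distr M borel (path_sup T))" "real_distribution (distr M borel (\<lambda>\<omega>. \<bar>X T \<omega>\<bar>))"
    by (auto intro!: real_distribution_distr)
  show "cdf (distr M borel (path_sup T)) = cdf (distr M borel (\<lambda>\<omega>. \<bar>X T \<omega>\<bar>))"
  proof
    fix x
    have c: "cdf (distr M borel Z) x = 1 - prob {\<omega> \<in> space M. x < Z \<omega>}" if [measurable]: "random_variable borel Z" for Z
    proof -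
      have "cdf (distr M borel Z) x = prob {\<omega> \<in> space M. \<not> x < Z \<omega>}"
        by (simp add: cdf_def measure_distr vimage_def Int_def conj_commute not_less)
      then show ?thesis by (simp add: prob_neg)
    qed
    show "cdf (distr M borel (path_sup T)) x = cdf (distr M borel (\<lambda>\<omega>. \<bar>X T \<omega>\<bar>)) x"
    proof (cases "0 \<le> x")
      case True
      then show ?thesis
        using reflection_principle[OF T True] prob_abs_normal[OF T True] by (simp add: c path_sup_greater T)
    next
      case False
      then have "x < path_sup T \<omega> \<and> x < \<bar>X T \<omega>\<bar>" if "\<omega> \<in> space M" for \<omega>
        using path_sup_nonneg[OF T that] by linarith
      then have "{\<omega> \<in> space M. x < path_sup T \<omega>} = {\<omega> \<in> space M. x < \<bar>X T \<omega>\<bar>}" by auto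
      then show ?thesis by (simp add: c)
    qed
  qed
qed

text \<open>The supremum has the law of |X T|, whose exponential is bounded by two integrable ones.
  The result is the dominating function for the stopped exponential martingale.\<close>

lemma integrable_exp_path_sup:
  assumes T: "0 < T"
  shows "integrable M (\<lambda>\<omega>. exp (\<theta> * path_sup T \<omega>))"
proof -
  have [measurable]: "random_variable borel (X T)" "random_variable borel (path_sup T)"
    using X_measurable T path_sup_measurable by auto
  have "integrable M (\<lambda>\<omega>. exp (\<theta> * X T \<omega>) + exp (- \<theta> * X T \<omega>))"
    by (intro Bochner_Integration.integrable_add exp_normal[OF X_normal[OF T]]) (use T in auto)
  then have "integrable M (\<lambda>\<omega>. exp (\<theta> * \<bar>X T \<omega>\<bar>))"
  proof (rule Bochner_Integration.integrable_bound)
    have "exp (\<theta> * \<bar>x\<bar>) \<le> exp (\<theta> * x) + exp (- \<theta> * x)" for x :: real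
      by (cases "0 \<le> x") (auto intro: add_increasing add_increasing2)
    then show "AE \<omega> in M. norm (exp (\<theta> * \<bar>X T \<omega>\<bar>)) \<le> norm (exp (\<theta> * X T \<omega>) + exp (- \<theta> * X T \<omega>))"
      by (intro AE_I2) (simp add: abs_of_nonneg add_nonneg_nonneg)
  qed simp
  then have "integrable (distr M borel (\<lambda>\<omega>. \<bar>X T \<omega>\<bar>)) (\<lambda>x. exp (\<theta> * x))"
    by (subst integrable_distr_eq) auto
  then show ?thesis unfolding distr_path_sup[OF T, symmetric]
    by (subst (asm) integrable_distr_eq) auto
qed

section \<open>The exponential martingale and the passage of a line\<close>

lemma exp_drifted:
  fixes T a :: real
  assumes T: "0 < T" and a: "0 \<le> a"
  shows "integrable M (\<lambda>\<omega>. exp (\<theta> * drifted T b n k \<omega>))"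
proof (cases "gtime T n k = 0")
  case True
  have "integrable M (\<lambda>\<omega>. exp (\<theta> * drifted T b n k \<omega>)) \<longleftrightarrow> integrable M (\<lambda>\<omega>. 1 :: real)"
    by (intro Bochner_Integration.integrable_cong refl) (simp add: drifted_def[OF T a] True zero)
  then show ?thesis by simp
next
  case False
  then have t: "0 < gtime T n k" using gtime_nonneg[OF T a, of n k] by simp
  have "integrable M (\<lambda>\<omega>. exp (- \<theta> * b * gtime T n k) * exp (\<theta> * X (gtime T n k) \<omega>))"
    by (intro integrable_mult_right exp_normal[OF X_normal[OF t]]) (use t in auto)
  then show ?thesis by (simp add: drifted_def[OF T a] exp_add[symmetric] algebra_simps)
qed

text \<open>The exponent \<open>2 * b\<close> makes exp (2 b (X t - b t)) a martingale: the
  increment up to \<open>T\<close> contributes a factor of mean exp (2 b^2 (T - t)), which cancels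
  the drift. It is independent of the past, hence also of the event that the passage is at
  \<open>k\<close>.\<close>

lemma exp_martingale_step:
  assumes T: "0 < T" and a: "0 \<le> a" and k: "k \<le> Suc n"
  shows "(\<integral>\<omega>. indicator {\<omega> \<in> space M. passage T a b n \<omega> = k} \<omega> * exp (2 * b * drifted T b n k \<omega>) \<partial>M)
    = (\<integral>\<omega>. indicator {\<omega> \<in> space M. passage T a b n \<omega> = k} \<omega> * exp (2 * b * drifted T b n (Suc n) \<omega>) \<partial>M :: real)"
proof (cases "k = Suc n")
  case False
  with k have kn: "k \<le> n" by simp
  define N where "N = Pi\<^sub>M {..<k} (\<lambda>_. borel :: real measure)"
  define N' where "N' = Pi\<^sub>M {k} (\<lambda>_. borel :: real measure)"
  let ?t = "gtime T n k"
  define g :: "(nat \<Rightarrow> real) \<Rightarrow> real" where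
    "g v = indicator (past_passes T a b n k) v * exp (2 * b * ((\<Sum>i<k. v i) - b * ?t))" for v
  define G where "G = (\<lambda>\<omega>. g (past T n k \<omega>))"
  define R where "R = (\<lambda>\<omega>. X T \<omega> - X ?t \<omega>)"
  have ind: "indep_var N (past T n k) N' (\<lambda>\<omega>. \<lambda>i\<in>{k}. X T \<omega> - X (gtime T n k) \<omega>)"
    unfolding N_def N'_def by (rule past_indep[OF T a kn])
  have t: "?t < T" by (rule gtime_less[OF T a kn])
  have g: "g \<in> borel_measurable N"
  proof -
    have [measurable]: "(\<lambda>v. \<Sum>i<k. v i) \<in> borel_measurable N"
      unfolding N_def by (intro borel_measurable_sum measurable_component_singleton) auto
    have [measurable]: "past_passes T a b n k \<in> sets N"
      unfolding N_def by (rule past_passes_sets[OF T a])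
    show ?thesis unfolding g_def by measurable
  qed
  have \<rho>: "(\<lambda>f. exp (2 * b * f k)) \<in> borel_measurable N'"
  proof -
    have [measurable]: "(\<lambda>f. f k) \<in> borel_measurable N'"
      unfolding N'_def by (rule measurable_component_singleton) simp
    show ?thesis by measurable
  qed
  have GR: "indep_var borel G borel (\<lambda>\<omega>. exp (2 * b * R \<omega>))"
    using indep_var_compose[OF ind g \<rho>] by (simp add: comp_def G_def R_def)
  have G_eq: "G \<omega> = indicator {\<omega> \<in> space M. passage T a b n \<omega> = k} \<omega> * exp (2 * b * drifted T b n k \<omega>)"
    if "\<omega> \<in> space M" for \<omega>
    using past_sum[OF T a that order.refl, of n k] past_passes_iff[OF T a that k, of b] that
    by (auto simp: G_def g_def drifted_def[OF T a] indicator_def)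
  have intG: "integrable M G"
  proof -
    have "integrable M (\<lambda>\<omega>. indicator {\<omega> \<in> space M. passage T a b n \<omega> = k} \<omega> * exp (2 * b * drifted T b n k \<omega>) :: real)"
      using integrable_mult_indicator[OF passage_eq_event[OF T a] exp_drifted[OF T a]] by simp
    moreover have "integrable M G \<longleftrightarrow> integrable M (\<lambda>\<omega>. indicator {\<omega> \<in> space M. passage T a b n \<omega> = k} \<omega> * exp (2 * b * drifted T b n k \<omega>) :: real)"
      by (intro Bochner_Integration.integrable_cong refl G_eq)
    ultimately show ?thesis by blast
  qed
  have Rn: "distributed M lborel R (normal_density 0 (sqrt (T - ?t)))"
    unfolding R_def by (rule X_increment[OF gtime_nonneg[OF T a] t])
  have s: "0 < sqrt (T - ?t)" using t by simp
  note e = exp_normal[OF Rn s, of "2 * b"]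
  have "(\<integral>\<omega>. G \<omega> * exp (2 * b * R \<omega>) \<partial>M) = (\<integral>\<omega>. G \<omega> \<partial>M) * exp (2 * b\<^sup>2 * (T - ?t))"
    using indep_var_lebesgue_integral[OF GR intG e(1)] t unfolding e(2) by (simp add: power_mult_distrib)
  then have "(\<integral>\<omega>. G \<omega> \<partial>M) = exp (- 2 * b\<^sup>2 * (T - ?t)) * (\<integral>\<omega>. G \<omega> * exp (2 * b * R \<omega>) \<partial>M)"
  proof -
    assume eq: "(\<integral>\<omega>. G \<omega> * exp (2 * b * R \<omega>) \<partial>M) = (\<integral>\<omega>. G \<omega> \<partial>M) * exp (2 * b\<^sup>2 * (T - ?t))"
    have "exp (- 2 * b\<^sup>2 * (T - ?t)) * exp (2 * b\<^sup>2 * (T - ?t)) = 1" by (simp add: exp_add[symmetric])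
    then show ?thesis unfolding eq by (metis mult.left_commute mult.right_neutral)
  qed
  also have "\<dots> = (\<integral>\<omega>. exp (- 2 * b\<^sup>2 * (T - ?t)) * (G \<omega> * exp (2 * b * R \<omega>)) \<partial>M)"
    by simp
  also have "\<dots> = (\<integral>\<omega>. indicator {\<omega> \<in> space M. passage T a b n \<omega> = k} \<omega> * exp (2 * b * drifted T b n (Suc n) \<omega>) \<partial>M)"
  proof (intro Bochner_Integration.integral_cong refl)
    fix \<omega> assume \<omega>: "\<omega> \<in> space M"
    have "exp (- 2 * b\<^sup>2 * (T - ?t)) * (exp (2 * b * drifted T b n k \<omega>) * exp (2 * b * R \<omega>)) = exp (2 * b * drifted T b n (Suc n) \<omega>)"
      unfolding exp_add[symmetric]
      by (rule arg_cong[where f = exp]) (simp add: drifted_def[OF T a] gtime_last[OF T a] R_def power2_eq_square algebra_simps)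
    then show "exp (- 2 * b\<^sup>2 * (T - ?t)) * (G \<omega> * exp (2 * b * R \<omega>))
      = indicator {\<omega> \<in> space M. passage T a b n \<omega> = k} \<omega> * exp (2 * b * drifted T b n (Suc n) \<omega>)"
      unfolding G_eq[OF \<omega>] by (simp add: mult.left_commute mult.assoc)
  qed
  also have "(\<integral>\<omega>. G \<omega> \<partial>M) = (\<integral>\<omega>. indicator {\<omega> \<in> space M. passage T a b n \<omega> = k} \<omega> * exp (2 * b * drifted T b n k \<omega>) \<partial>M)"
    by (intro Bochner_Integration.integral_cong refl G_eq)
  finally show ?thesis .
qed simp

text \<open>The martingale stopped at the first grid passage, or at \<open>T\<close> without a
  passage, has mean 1. Refining the grid makes its value exp (2 a b) on crossing paths and leaves
  the terminal value on the others.\<close>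

lemma exp_crosses:
  assumes T: "0 < T" and a: "0 \<le> a" and b: "0 < b"
  shows "exp (2 * a * b) * prob (crosses T a b)
    + (\<integral>\<omega>. indicator (space M - crosses T a b) \<omega> * exp (2 * b * (X T \<omega> - b * T)) \<partial>M) = 1"
proof -
  let ?C = "crosses T a b"
  have [measurable]: "?C \<in> events" by (rule crosses_event[OF T a])
  have [measurable]: "random_variable borel (X T)" using X_measurable T by auto
  \<comment> \<open>The minimum maps the index for no passage to the terminal index
    \<open>Suc n\<close>.\<close>
  define w where "w n k \<omega> = exp (2 * b * drifted T b n (min k (Suc n)) \<omega>)" for n k \<omega>
  have int: "integrable M (w n k)" for n k
    unfolding w_def by (rule exp_drifted[OF T a])
  have last: "drifted T b n (Suc n) \<omega> = X T \<omega> - b * T" for n \<omega>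
    by (simp add: drifted_def[OF T a] gtime_last[OF T a])
  have one: "(\<integral>\<omega>. w n (Suc n) \<omega> \<partial>M) = 1" for n
  proof -
    have "(\<integral>\<omega>. w n (Suc n) \<omega> \<partial>M) = (\<integral>\<omega>. exp (- 2 * b\<^sup>2 * T) * exp (2 * b * X T \<omega>) \<partial>M)"
      by (simp add: w_def last exp_add[symmetric] power2_eq_square algebra_simps)
    also have "\<dots> = exp (- 2 * b\<^sup>2 * T) * exp ((2 * b)\<^sup>2 * (sqrt T)\<^sup>2 / 2)"
      using exp_normal(2)[OF X_normal[OF T], of "2 * b"] T by simp
    also have "\<dots> = 1"
      using T by (simp add: exp_add[symmetric] power_mult_distrib)
    finally show ?thesis .
  qed
  have eq: "(\<integral>\<omega>. w n (passage T a b n \<omega>) \<omega> \<partial>M) = 1"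
    "integrable M (\<lambda>\<omega>. w n (passage T a b n \<omega>) \<omega>)" for n
  proof -
    have "(\<integral>\<omega>. indicator {\<omega> \<in> space M. passage T a b n \<omega> = k} \<omega> * w n k \<omega> \<partial>M)
        = (\<integral>\<omega>. indicator {\<omega> \<in> space M. passage T a b n \<omega> = k} \<omega> * w n (Suc n) \<omega> \<partial>M)"
      if "k \<le> Suc (Suc n)" for k
    proof (cases "k \<le> Suc n")
      case True
      then show ?thesis using exp_martingale_step[OF T a True] by (simp add: w_def min_absorb1)
    qed (simp add: w_def min_def)
    from expectation_random_index[OF passage_le[OF T a] passage_eq_event[OF T a] int int this]
    show "(\<integral>\<omega>. w n (passage T a b n \<omega>) \<omega> \<partial>M) = 1"
      "integrable M (\<lambda>\<omega>. w n (passage T a b n \<omega>) \<omega>)" using one by auto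
  qed
  define L where "L \<omega> = (if \<omega> \<in> ?C then exp (2 * a * b) else exp (2 * b * (X T \<omega> - b * T)))" for \<omega>
  have "(\<lambda>n. \<integral>\<omega>. w n (passage T a b n \<omega>) \<omega> \<partial>M) \<longlonglongrightarrow> (\<integral>\<omega>. L \<omega> \<partial>M)"
    and intL: "integrable M L"
  proof -
    have 1: "L \<in> borel_measurable M" unfolding L_def by measurable
    have 2: "(\<lambda>\<omega>. w n (passage T a b n \<omega>) \<omega>) \<in> borel_measurable M" for n
      using eq(2) by (rule borel_measurable_integrable)
    have 3: "integrable M (\<lambda>\<omega>. exp (2 * b * path_sup T \<omega>))" by (rule integrable_exp_path_sup[OF T])
    have 4: "AE \<omega> in M. (\<lambda>n. w n (passage T a b n \<omega>) \<omega>) \<longlonglongrightarrow> L \<omega>"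
    proof (rule AE_I2)
      fix \<omega> assume \<omega>: "\<omega> \<in> space M"
      show "(\<lambda>n. w n (passage T a b n \<omega>) \<omega>) \<longlonglongrightarrow> L \<omega>"
      proof (cases "\<omega> \<in> ?C")
        case False
        then have "w n (passage T a b n \<omega>) \<omega> = L \<omega>" for n
          using passage_none[OF T a \<omega> False] by (simp add: w_def L_def min_def last)
        then show ?thesis by simp
      next
        case True
        have "(\<lambda>n. exp (2 * b * drifted T b n (passage T a b n \<omega>) \<omega>)) \<longlonglongrightarrow> exp (2 * b * a)"
          by (intro tendsto_intros passage_tendsto(2)[OF T a True])
        moreover have "\<forall>\<^sub>F n in sequentially. exp (2 * b * drifted T b n (passage T a b n \<omega>) \<omega>) = w n (passage T a b n \<omega>) \<omega>"
          using passage_tendsto(1)[OF T a True] by eventually_elim (simp add: w_def min_absorb1)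
        ultimately show ?thesis using True by (simp add: L_def mult.commute mult.left_commute tendsto_cong)
      qed
    qed
    \<comment> \<open>For \<open>b > 0\<close> the drift only lowers the path, so all stopped values
      are bounded through the supremum of the path, whatever the grid.\<close>
    have 5: "AE \<omega> in M. norm (w n (passage T a b n \<omega>) \<omega>) \<le> exp (2 * b * path_sup T \<omega>)" for n
    proof (rule AE_I2)
      fix \<omega> assume \<omega>: "\<omega> \<in> space M"
      let ?k = "min (passage T a b n \<omega>) (Suc n)"
      have "gtime T n ?k \<le> T"
      proof (cases "?k \<le> n")
        case False
        then have "?k = Suc n" by linarith
        then show ?thesis using gtime_last[OF T a, of n] by simp
      next
        case True
        show ?thesis using gtime_less[OF T a True] by (rule less_imp_le)
      qed
      then have "X (gtime T n ?k) \<omega> \<le> path_sup T \<omega>"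
        using gtime_nonneg[OF T a] by (intro path_le_sup \<omega>) auto
      moreover have "0 \<le> b * gtime T n ?k" using b gtime_nonneg[OF T a] by (intro mult_nonneg_nonneg) auto
      ultimately have "drifted T b n ?k \<omega> \<le> path_sup T \<omega>" unfolding drifted_def[OF T a] by linarith
      then show "norm (w n (passage T a b n \<omega>) \<omega>) \<le> exp (2 * b * path_sup T \<omega>)"
        using b by (simp add: w_def)
    qed
    show "(\<lambda>n. \<integral>\<omega>. w n (passage T a b n \<omega>) \<omega> \<partial>M) \<longlonglongrightarrow> (\<integral>\<omega>. L \<omega> \<partial>M)"
      by (rule integral_dominated_convergence[OF 1 2 3 4 5])
    show "integrable M L" by (rule integrable_dominated_convergence[OF 1 2 3 4 5])
  qed
  then have L1: "(\<integral>\<omega>. L \<omega> \<partial>M) = 1" by (simp add: eq LIMSEQ_const_iff)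
  have "(\<integral>\<omega>. L \<omega> \<partial>M) = (\<integral>\<omega>. exp (2 * a * b) * indicator ?C \<omega> + indicator (space M - ?C) \<omega> * exp (2 * b * (X T \<omega> - b * T)) \<partial>M)"
    by (intro Bochner_Integration.integral_cong refl) (auto simp: L_def indicator_def)
  also have "\<dots> = exp (2 * a * b) * prob ?C + (\<integral>\<omega>. indicator (space M - ?C) \<omega> * exp (2 * b * (X T \<omega> - b * T)) \<partial>M)"
  proof (subst Bochner_Integration.integral_add)
    have "integrable M (\<lambda>\<omega>. indicator (space M - ?C) \<omega> * L \<omega>)"
      using integrable_mult_indicator[OF _ intL, of "space M - ?C"] by simp
    moreover have "integrable M (\<lambda>\<omega>. indicator (space M - ?C) \<omega> * L \<omega>)
        \<longleftrightarrow> integrable M (\<lambda>\<omega>. indicator (space M - ?C) \<omega> * exp (2 * b * (X T \<omega> - b * T)))"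
      by (intro Bochner_Integration.integrable_cong refl) (auto simp: L_def indicator_def)
    ultimately show "integrable M (\<lambda>\<omega>. indicator (space M - ?C) \<omega> * exp (2 * b * (X T \<omega> - b * T)))" by simp
    show "integrable M (\<lambda>\<omega>. exp (2 * a * b) * indicator ?C \<omega>)"
      by (intro integrable_mult_right integrable_real_indicator) (auto simp: emeasure_eq_measure)
  qed auto
  finally show ?thesis using L1 by simp
qed

text \<open>In \<open>exp_crosses\<close> the horizon tends to infinity, and the contribution
  \<open>r\<close> of the paths that have not crossed vanishes, because the drift carries them
  downwards.\<close>

lemma prob_crosses_line:
  assumes a: "0 \<le> a" and b: "0 < b"
  shows "prob {\<omega> \<in> space M. \<exists>t\<ge>0. a < X t \<omega> - b * t} = exp (- 2 * a * b)" (is "?prob")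
    and "{\<omega> \<in> space M. \<exists>t\<ge>0. a < X t \<omega> - b * t} \<in> events" (is "?event")
proof -
  define C where "C n = crosses (real (Suc n)) a b" for n
  have T: "0 < real (Suc n)" for n by simp
  have C_def': "C n = {\<omega> \<in> space M. \<exists>t\<in>{0..real (Suc n)}. a < X t \<omega> - b * t}" for n
    unfolding C_def by (rule crosses_def[OF T a])
  have Un: "{\<omega> \<in> space M. \<exists>t\<ge>0. a < X t \<omega> - b * t} = (\<Union>n. C n)"
  proof (safe; (simp add: C_def'; fail)?)
    fix \<omega> t assume "\<omega> \<in> space M" and t: "0 \<le> t" "a < X t \<omega> - b * t"
    moreover obtain n :: nat where "t < real n" using reals_Archimedean2 by blast
    ultimately have "\<omega> \<in> C n" by (auto simp: C_def' intro!: bexI[of _ t])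
    then show "\<omega> \<in> (\<Union>n. C n)" by blast
  next
    fix \<omega> n assume "\<omega> \<in> C n"
    then show "\<exists>t\<ge>0. a < X t \<omega> - b * t" by (auto simp: C_def')
  qed
  have C_events: "range C \<subseteq> events" unfolding C_def using crosses_event[OF T a] by auto
  then show ?event unfolding Un by (intro sets.countable_UN)
  have lim1: "(\<lambda>n. prob (C n)) \<longlonglongrightarrow> prob (\<Union>n. C n)"
  proof (rule finite_Lim_measure_incseq)
    show "range C \<subseteq> events" by (rule C_events)
    show "incseq C" unfolding C_def' incseq_def by fastforce
  qed
  have "(\<lambda>n. prob (C n)) \<longlonglongrightarrow> exp (- 2 * a * b)"
  proof -
    define r where "r n = (\<integral>\<omega>. indicator (space M - C n) \<omega> * exp (2 * b * (X (real (Suc n)) \<omega> - b * real (Suc n))) \<partial>M)" for n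
    \<comment> \<open>The exponent is split into halves. Without a crossing one half is at most
      \<open>a * b\<close>; the other has mean exp (- b^2 T / 2), since E exp (b X T) = exp (b^2 T /
      2).\<close>
    have r_le: "r n \<le> exp (a * b) * exp (- (b\<^sup>2 / 2) * real (Suc n))" for n
    proof -
      let ?T = "real (Suc n)"
      have i: "integrable M (\<lambda>\<omega>. exp (a * b) * (exp (- b\<^sup>2 * ?T) * exp (b * X ?T \<omega>)))"
        by (intro integrable_mult_right exp_normal[OF X_normal[OF T]]) simp
      have "r n \<le> (\<integral>\<omega>. exp (a * b) * (exp (- b\<^sup>2 * ?T) * exp (b * X ?T \<omega>)) \<partial>M)"
        unfolding r_def
      proof (rule integral_mono_AE')
        show "integrable M (\<lambda>\<omega>. exp (a * b) * (exp (- b\<^sup>2 * ?T) * exp (b * X ?T \<omega>)))" by (rule i)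
        show "AE \<omega> in M. indicator (space M - C n) \<omega> * exp (2 * b * (X ?T \<omega> - b * ?T))
            \<le> exp (a * b) * (exp (- b\<^sup>2 * ?T) * exp (b * X ?T \<omega>))"
        proof (rule AE_I2)
          fix \<omega> assume \<omega>: "\<omega> \<in> space M"
          show "indicator (space M - C n) \<omega> * exp (2 * b * (X ?T \<omega> - b * ?T))
            \<le> exp (a * b) * (exp (- b\<^sup>2 * ?T) * exp (b * X ?T \<omega>))"
          proof (cases "\<omega> \<in> C n")
            case False
            then have "X ?T \<omega> - b * ?T \<le> a" using \<omega> by (auto simp: C_def' not_less dest!: bspec[of _ _ ?T])
            then have "b * (X ?T \<omega> - b * ?T) \<le> b * a" using b by (intro mult_left_mono) auto
            then have "2 * b * (X ?T \<omega> - b * ?T) \<le> a * b + (- b\<^sup>2 * ?T + b * X ?T \<omega>)"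
              by (simp add: power2_eq_square algebra_simps del: of_nat_Suc)
            then have "exp (2 * b * (X ?T \<omega> - b * ?T)) \<le> exp (a * b) * (exp (- b\<^sup>2 * ?T) * exp (b * X ?T \<omega>))"
              unfolding exp_add[symmetric] by simp
            with False \<omega> show ?thesis by simp
          qed simp
        qed
      qed auto
      also have "\<dots> = exp (a * b) * (exp (- b\<^sup>2 * ?T) * exp (b\<^sup>2 * (sqrt ?T)\<^sup>2 / 2))"
        using exp_normal(2)[OF X_normal[OF T], of n b] by simp
      also have "\<dots> = exp (a * b) * exp (- (b\<^sup>2 / 2) * ?T)"
        unfolding exp_add[symmetric] by (simp add: field_simps del: of_nat_Suc)
      finally show ?thesis .
    qed
    have r0: "0 \<le> r n" for n unfolding r_def by (intro Bochner_Integration.integral_nonneg) auto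
    have "(\<lambda>n. exp (a * b) * exp (- (b\<^sup>2 / 2) * real (Suc n))) \<longlonglongrightarrow> exp (a * b) * 0"
    proof (intro tendsto_intros filterlim_compose[OF exp_at_bot])
      have "filterlim (\<lambda>n. real (Suc n)) at_top sequentially"
        using filterlim_real_sequentially by (rule filterlim_sequentially_Suc[THEN iffD2])
      then show "filterlim (\<lambda>n. - (b\<^sup>2 / 2) * real (Suc n)) at_bot sequentially"
        using b by (intro filterlim_tendsto_neg_mult_at_bot[OF tendsto_const]) auto
    qed
    then have up: "(\<lambda>n. exp (a * b) * exp (- (b\<^sup>2 / 2) * real (Suc n))) \<longlonglongrightarrow> 0" by simp
    have "r \<longlonglongrightarrow> 0"
      by (rule tendsto_sandwich[OF always_eventually always_eventually tendsto_const up]) (intro allI r0 r_le)+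
    then have "(\<lambda>n. (1 - r n) * exp (- 2 * a * b)) \<longlonglongrightarrow> (1 - 0) * exp (- 2 * a * b)"
      by (intro tendsto_intros)
    moreover have "prob (C n) = (1 - r n) * exp (- 2 * a * b)" for n
      using exp_crosses[OF T a b, of n, folded C_def] unfolding r_def[symmetric]
      by (simp add: exp_minus field_simps)
    ultimately show ?thesis by simp
  qed
  then show ?prob unfolding Un using LIMSEQ_unique[OF lim1] by simp
qed

end

subsection \<open>Expected maximum of the two suprema\<close>

text \<open>The two exponents add up to - c x^2 with c = 2 + s^2 / 2, and the factor
  \<open>x\<close> makes the integrand an exact derivative; 2 c is the denominator 4 + s^2.\<close>

lemma nn_integral_half_line_gauss:
  fixes s :: real
  shows "(\<integral>\<^sup>+x. ennreal (x * std_normal_density (x * s) * exp (- 2 * x\<^sup>2)) * indicator {0..} x \<partial>lborel)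
    = ennreal (1 / ((4 + s\<^sup>2) * sqrt (2 * pi)))"
proof -
  define c where "c = 2 + s\<^sup>2 / 2"
  have c: "0 < c" by (simp add: c_def add_pos_nonneg)
  have e: "x * std_normal_density (x * s) * exp (- 2 * x\<^sup>2) = x * exp (- c * x\<^sup>2) / sqrt (2 * pi)" for x :: real
    by (simp add: std_normal_density_def c_def exp_add[symmetric] power_mult_distrib field_simps)
  define F where "F x = - exp (- c * x\<^sup>2) / (2 * c * sqrt (2 * pi))" for x :: real
  have "(\<integral>\<^sup>+x. ennreal (x * exp (- c * x\<^sup>2) / sqrt (2 * pi)) * indicator {0..} x \<partial>lborel) = ennreal (0 - F 0)"
  proof (rule nn_integral_FTC_atLeast)
    show "(F has_real_derivative x * exp (- c * x\<^sup>2) / sqrt (2 * pi)) (at x)" for x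
      unfolding F_def using c
      by (auto intro!: derivative_eq_intros simp: field_simps power2_eq_square)
    have "filterlim (\<lambda>x::real. - c * x\<^sup>2) at_bot at_top"
      using c by (intro filterlim_tendsto_neg_mult_at_bot[OF tendsto_const]
        filterlim_pow_at_top[OF _ filterlim_ident]) auto
    then have "((\<lambda>x. exp (- c * x\<^sup>2)) \<longlongrightarrow> 0) at_top"
      by (rule filterlim_compose[OF exp_at_bot])
    then have "((\<lambda>x. - exp (- c * x\<^sup>2) / (2 * c * sqrt (2 * pi))) \<longlongrightarrow> - 0 / (2 * c * sqrt (2 * pi))) at_top"
      using c by (intro tendsto_intros) auto
    then show "(F \<longlongrightarrow> 0) at_top" by (simp add: F_def[abs_def])
  qed auto
  also have "0 - F 0 = 1 / ((4 + s\<^sup>2) * sqrt (2 * pi))"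
    by (simp add: F_def c_def)
  finally show ?thesis unfolding e .
qed

lemma nn_integral_arctan:
  "(\<integral>\<^sup>+s. ennreal (1 / ((4 + s\<^sup>2) * sqrt (2 * pi))) * indicator {-1..1} s \<partial>lborel)
    = ennreal (arctan (1 / 2) / sqrt (2 * pi))"
proof -
  define F where "F s = arctan (s / 2) / (2 * sqrt (2 * pi))" for s :: real
  have "(\<integral>\<^sup>+s. ennreal (1 / ((4 + s\<^sup>2) * sqrt (2 * pi))) * indicator {-1..1} s \<partial>lborel) = ennreal (F 1 - F (- 1))"
  proof (rule nn_integral_FTC_Icc)
    show "(F has_real_derivative 1 / ((4 + s\<^sup>2) * sqrt (2 * pi))) (at s)" for s
    proof -
      have "((\<lambda>s. arctan (s / 2) / c) has_real_derivative (1 / 2) * inverse (1 + (s / 2)\<^sup>2) / c) (at s)"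
        if "c \<noteq> 0" for c :: real
        using that by (auto intro!: derivative_eq_intros)
      from this[of "2 * sqrt (2 * pi)"]
      have "(F has_real_derivative (1 / 2) * inverse (1 + (s / 2)\<^sup>2) / (2 * sqrt (2 * pi))) (at s)"
        unfolding F_def by simp
      also have "(1 / 2) * inverse (1 + (s / 2)\<^sup>2) / (2 * sqrt (2 * pi)) = 1 / ((4 + s\<^sup>2) * sqrt (2 * pi))"
      proof -
        have "1 + (s / 2)\<^sup>2 = (4 + s\<^sup>2) / 4" by (simp add: power_divide)
        then show ?thesis by (simp only:) simp
      qed
      finally show ?thesis .
    qed
  qed (auto simp: add_pos_nonneg)
  also have "F 1 - F (- 1) = arctan (1 / 2) / sqrt (2 * pi)"
    by (simp add: F_def arctan_minus field_simps)
  finally show ?thesis .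
qed

text \<open>The substitution \<open>y = x s\<close> turns the Gaussian integral over the wedge \<open>\<bar>y\<bar> \<le> x\<close> into an
  integral over \<open>s \<in> {-1..1}\<close> of elementary integrals in \<open>x\<close>.\<close>

lemma nn_integral_wedge:
  "(\<integral>\<^sup>+x. (\<integral>\<^sup>+y. ennreal (std_normal_density y) * indicator {-x..x} y \<partial>lborel) * ennreal (exp (- 2 * x\<^sup>2)) * indicator {0..} x \<partial>lborel)
    = ennreal (arctan (1 / 2) / sqrt (2 * pi))"
proof -
  let ?f = "\<lambda>x s. ennreal (x * std_normal_density (x * s) * exp (- 2 * x\<^sup>2)) * indicator {0..} x * indicator {-1..1} s"
  have pt: "(\<integral>\<^sup>+y. ennreal (std_normal_density y) * indicator {-x..x} y \<partial>lborel) * ennreal (exp (- 2 * x\<^sup>2)) * indicator {0..} x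
      = (\<integral>\<^sup>+s. ?f x s \<partial>lborel)" if "x \<noteq> 0" for x :: real
  proof (cases "0 < x")
    case True
    have i: "indicator {-x..x} (0 + x * s) = (indicator {-1..1} s :: ennreal)" for s
    proof -
      have "- x \<le> x * s \<longleftrightarrow> - 1 \<le> s" "x * s \<le> x \<longleftrightarrow> s \<le> 1"
        using True mult_le_cancel_left_pos[of x "-1" s] mult_le_cancel_left_pos[of x s 1] by auto
      then show ?thesis by (simp add: indicator_def)
    qed
    have "(\<integral>\<^sup>+y. ennreal (std_normal_density y) * indicator {-x..x} y \<partial>lborel)
      = ennreal x * (\<integral>\<^sup>+s. ennreal (std_normal_density (0 + x * s)) * indicator {-x..x} (0 + x * s) \<partial>lborel)"
      using True by (subst nn_integral_real_affine[where c = x and t = 0]) auto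
    also have "\<dots> = (\<integral>\<^sup>+s. ennreal x * (ennreal (std_normal_density (x * s)) * indicator {-1..1} s) \<partial>lborel)"
      unfolding i by (subst nn_integral_cmult) auto
    finally have "(\<integral>\<^sup>+y. ennreal (std_normal_density y) * indicator {-x..x} y \<partial>lborel) * ennreal (exp (- 2 * x\<^sup>2))
      = (\<integral>\<^sup>+s. ennreal x * (ennreal (std_normal_density (x * s)) * indicator {-1..1} s) * ennreal (exp (- 2 * x\<^sup>2)) \<partial>lborel)"
      by (subst nn_integral_multc) auto
    also have "\<dots> = (\<integral>\<^sup>+s. ?f x s \<partial>lborel)"
      using True by (intro nn_integral_cong) (auto simp: ennreal_mult' indicator_def ac_simps)
    finally show ?thesis using True by simp
  qed (use that in simp)
  have "(\<integral>\<^sup>+x. (\<integral>\<^sup>+y. ennreal (std_normal_density y) * indicator {-x..x} y \<partial>lborel) * ennreal (exp (- 2 * x\<^sup>2)) * indicator {0..} x \<partial>lborel)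
    = (\<integral>\<^sup>+x. \<integral>\<^sup>+s. ?f x s \<partial>lborel \<partial>lborel)"
  proof (rule nn_integral_cong_AE)
    show "AE x in lborel. (\<integral>\<^sup>+y. ennreal (std_normal_density y) * indicator {-x..x} y \<partial>lborel) * ennreal (exp (- 2 * x\<^sup>2)) * indicator {0..} x
      = (\<integral>\<^sup>+s. ?f x s \<partial>lborel)"
      using AE_lborel_singleton[of "0 :: real"] by eventually_elim (rule pt)
  qed
  also have "\<dots> = (\<integral>\<^sup>+s. \<integral>\<^sup>+x. ?f x s \<partial>lborel \<partial>lborel)"
    by (rule lborel_pair.Fubini') measurable
  also have "\<dots> = (\<integral>\<^sup>+s. ennreal (1 / ((4 + s\<^sup>2) * sqrt (2 * pi))) * indicator {-1..1} s \<partial>lborel)"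
    by (intro nn_integral_cong, subst nn_integral_multc) (simp_all only: nn_integral_half_line_gauss, measurable)
  finally show ?thesis by (simp only: nn_integral_arctan)
qed

text \<open>For U \<ge> 0 one has max U V = U + (V - U)^+. The positive part is the Lebesgue measure
  of all x with U \<le> x < V, so by Tonelli its mean is the integral of P (U \<le> x) P (V >
  x).\<close>

lemma (in prob_space) expectation_max:
  assumes U [measurable]: "random_variable borel U" and V [measurable]: "random_variable borel V"
    and U0: "AE \<omega> in M. 0 \<le> U \<omega>"
    and N: "distributed M lborel N std_normal_density" and UN: "distr M borel U = distr M borel (\<lambda>\<omega>. \<bar>N \<omega>\<bar>)"
    and V_tail: "\<And>x. 0 < x \<Longrightarrow> prob {\<omega> \<in> space M. x < V \<omega>} = exp (- 2 * x\<^sup>2)"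
    and indep: "\<And>x. 0 < x \<Longrightarrow> prob {\<omega> \<in> space M. U \<omega> \<le> x \<and> x < V \<omega>}
      = prob {\<omega> \<in> space M. U \<omega> \<le> x} * prob {\<omega> \<in> space M. x < V \<omega>}"
  shows "has_bochner_integral M (\<lambda>\<omega>. max (U \<omega>) (V \<omega>)) (sqrt (2 / pi) + arctan (1 / 2) / sqrt (2 * pi))"
proof -
  have [measurable]: "random_variable borel N" using N by (simp add: distributed_def)
  have nnU: "(\<integral>\<^sup>+\<omega>. ennreal (U \<omega>) \<partial>M) = ennreal (sqrt (2 / pi))"
  proof -
    have "(\<integral>\<^sup>+\<omega>. ennreal (U \<omega>) \<partial>M) = (\<integral>\<^sup>+x. ennreal x \<partial>distr M borel U)"
      by (subst nn_integral_distr) auto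
    also have "\<dots> = (\<integral>\<^sup>+\<omega>. ennreal \<bar>N \<omega>\<bar> \<partial>M)" unfolding UN by (subst nn_integral_distr) auto
    also have "\<dots> = (\<integral>\<^sup>+x. ennreal (std_normal_density x) * ennreal \<bar>x\<bar> \<partial>lborel)"
      by (subst distributed_nn_integral[OF N, symmetric]) auto
    also have "\<dots> = (\<integral>\<^sup>+x. ennreal (std_normal_density x * \<bar>x\<bar> ^ (2 * 0 + 1)) \<partial>lborel)"
      by (simp add: ennreal_mult')
    also have "\<dots> = ennreal (sqrt (2 / pi) * 2 ^ 0 * fact 0)"
      using std_normal_moment_abs_odd[of 0]
      by (subst nn_integral_eq_integral) (auto simp: has_bochner_integral_iff)
    finally show ?thesis by simp
  qed
  have U_le: "ennreal (prob {\<omega> \<in> space M. U \<omega> \<le> x}) = (\<integral>\<^sup>+y. ennreal (std_normal_density y) * indicator {-x..x} y \<partial>lborel)" for x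
  proof -
    have "prob {\<omega> \<in> space M. U \<omega> \<le> x} = measure (distr M borel U) {..x}"
      by (simp add: measure_distr vimage_def Int_def conj_commute)
    also have "\<dots> = prob (N -` {-x..x} \<inter> space M)" unfolding UN
      by (simp add: measure_distr) (intro arg_cong[where f = prob]; auto simp: abs_le_iff)
    finally show ?thesis using distributed_emeasure[OF N, of "{-x..x}"] by (simp add: emeasure_eq_measure)
  qed
  have nnD: "(\<integral>\<^sup>+\<omega>. ennreal (V \<omega> - U \<omega>) \<partial>M) = ennreal (arctan (1 / 2) / sqrt (2 * pi))"
  proof -
    interpret P: pair_sigma_finite M lborel ..
    let ?I = "\<lambda>\<omega> x. indicator {p \<in> space (M \<Otimes>\<^sub>M lborel). U (fst p) \<le> snd p \<and> snd p < V (fst p)} (\<omega>, x) :: ennreal"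
    have [measurable]: "{p \<in> space (M \<Otimes>\<^sub>M lborel). U (fst p) \<le> snd p \<and> snd p < V (fst p)} \<in> sets (M \<Otimes>\<^sub>M lborel)"
      by measurable
    have "(\<integral>\<^sup>+\<omega>. ennreal (V \<omega> - U \<omega>) \<partial>M) = (\<integral>\<^sup>+\<omega>. \<integral>\<^sup>+x. ?I \<omega> x \<partial>lborel \<partial>M)"
    proof (rule nn_integral_cong)
      fix \<omega> assume \<omega>: "\<omega> \<in> space M"
      have "(\<integral>\<^sup>+x. ?I \<omega> x \<partial>lborel) = (\<integral>\<^sup>+x. indicator {U \<omega>..<V \<omega>} x \<partial>lborel)"
        using \<omega> by (intro nn_integral_cong) (auto simp: indicator_def space_pair_measure)
      also have "\<dots> = ennreal (V \<omega> - U \<omega>)"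
        by (cases "U \<omega> \<le> V \<omega>") (auto simp: ennreal_neg)
      finally show "ennreal (V \<omega> - U \<omega>) = (\<integral>\<^sup>+x. ?I \<omega> x \<partial>lborel)" ..
    qed
    also have "\<dots> = (\<integral>\<^sup>+x. \<integral>\<^sup>+\<omega>. ?I \<omega> x \<partial>M \<partial>lborel)"
      by (rule P.Fubini'[symmetric]) measurable
    also have "\<dots> = (\<integral>\<^sup>+x. (\<integral>\<^sup>+y. ennreal (std_normal_density y) * indicator {-x..x} y \<partial>lborel) * ennreal (exp (- 2 * x\<^sup>2)) * indicator {0..} x \<partial>lborel)"
    proof (rule nn_integral_cong_AE, rule AE_mp[OF AE_lborel_singleton[of "0 :: real"]], intro AE_I2 impI)
      fix x :: real assume x0: "x \<noteq> 0"
      have "(\<integral>\<^sup>+\<omega>. ?I \<omega> x \<partial>M) = (\<integral>\<^sup>+\<omega>. indicator {\<omega> \<in> space M. U \<omega> \<le> x \<and> x < V \<omega>} \<omega> \<partial>M)"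
        by (intro nn_integral_cong) (auto simp: indicator_def space_pair_measure)
      also have "\<dots> = ennreal (prob {\<omega> \<in> space M. U \<omega> \<le> x \<and> x < V \<omega>})"
        by (subst nn_integral_indicator) (auto simp: emeasure_eq_measure)
      also have "\<dots> = (\<integral>\<^sup>+y. ennreal (std_normal_density y) * indicator {-x..x} y \<partial>lborel) * ennreal (exp (- 2 * x\<^sup>2)) * indicator {0..} x"
      proof (cases "0 < x")
        case True
        then show ?thesis using indep[OF True] V_tail[OF True] U_le[of x] by (simp add: ennreal_mult)
      next
        \<comment> \<open>Negative levels contribute nothing because \<open>U\<close> is nonnegative
          almost surely.\<close>
        case False
        have "prob {\<omega> \<in> space M. U \<omega> \<le> x \<and> x < V \<omega>} = prob {}"
          using U0 by (intro finite_measure_eq_AE) (use False x0 in \<open>auto elim!: eventually_mono\<close>)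
        then show ?thesis using False x0 by simp
      qed
      finally show "(\<integral>\<^sup>+\<omega>. ?I \<omega> x \<partial>M) = (\<integral>\<^sup>+y. ennreal (std_normal_density y) * indicator {-x..x} y \<partial>lborel) * ennreal (exp (- 2 * x\<^sup>2)) * indicator {0..} x" .
    qed
    also have "\<dots> = ennreal (arctan (1 / 2) / sqrt (2 * pi))" by (rule nn_integral_wedge)
    finally show ?thesis .
  qed
  have a0: "0 \<le> arctan (1 / 2 :: real)" using arctan_le_zero_iff[of "1 / 2 :: real"] by simp
  show ?thesis
  proof (rule has_bochner_integral_nn_integral)
    show "AE \<omega> in M. 0 \<le> max (U \<omega>) (V \<omega>)" using U0 by eventually_elim simp
    have "(\<integral>\<^sup>+\<omega>. ennreal (max (U \<omega>) (V \<omega>)) \<partial>M) = (\<integral>\<^sup>+\<omega>. ennreal (U \<omega>) + ennreal (V \<omega> - U \<omega>) \<partial>M)"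
    proof (rule nn_integral_cong_AE)
      show "AE \<omega> in M. ennreal (max (U \<omega>) (V \<omega>)) = ennreal (U \<omega>) + ennreal (V \<omega> - U \<omega>)"
        using U0
      proof eventually_elim
        case (elim \<omega>)
        then show ?case by (cases "U \<omega> \<le> V \<omega>") (auto simp: max_def ennreal_neg ennreal_plus[symmetric] simp del: ennreal_plus)
      qed
    qed
    also have "\<dots> = ennreal (sqrt (2 / pi)) + ennreal (arctan (1 / 2) / sqrt (2 * pi))"
      by (subst nn_integral_add) (auto simp: nnU nnD)
    finally show "(\<integral>\<^sup>+\<omega>. ennreal (max (U \<omega>) (V \<omega>)) \<partial>M) = ennreal (sqrt (2 / pi) + arctan (1 / 2) / sqrt (2 * pi))"
      using a0 by simp
  qed (use a0 in auto)
qed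

section \<open>Suprema of continuous paths over the unit interval\<close>

definition sup01 :: "(real \<Rightarrow> real) \<Rightarrow> real" where
  "sup01 f = (SUP t\<in>{0..1}. f t)"

lemma sup01_bdd: "continuous_on {0..1} f \<Longrightarrow> bdd_above (f ` {0..1})" for f :: "real \<Rightarrow> real"
  by (intro bounded_imp_bdd_above compact_imp_bounded compact_continuous_image compact_Icc)

lemma less_sup01_iff: "continuous_on {0..1} f \<Longrightarrow> x < sup01 f \<longleftrightarrow> (\<exists>t\<in>{0..1}. x < f t)"
  unfolding sup01_def by (subst less_cSUP_iff[OF _ sup01_bdd]) auto

text \<open>Countably many evaluations decide the event, which gives measurability of suprema. A
  path starting above \<open>x\<close> is not a \<open>path_grid\<close>; for it the grid point 0 is
  a witness.\<close>

lemma less_sup01_iff_grid: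
  assumes "continuous_on {0..1} f"
  shows "x < sup01 f \<longleftrightarrow> (\<exists>n. \<exists>k\<le>Suc n. x < f (real k / real (Suc n)))"
proof (cases "f 0 \<le> x")
  case True
  with assms have "path_grid 1 x f" by unfold_locales auto
  from path_grid.exceeds_iff_grid[OF this] show ?thesis
    unfolding less_sup01_iff[OF assms] by (simp del: of_nat_Suc)
next
  case False
  then have "x < f (real 0 / real (Suc 0))" "x < f 0" by simp_all
  then show ?thesis unfolding less_sup01_iff[OF assms] by (meson atLeastAtMost_iff le0 order.refl zero_le_one)
qed

lemma sup01_measurable:
  assumes "\<And>t. t \<in> {0..1} \<Longrightarrow> (\<lambda>\<omega>. Y t \<omega>) \<in> borel_measurable M"
    and "\<And>\<omega>. \<omega> \<in> space M \<Longrightarrow> continuous_on {0..1} (\<lambda>t. Y t \<omega>)"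
  shows "(\<lambda>\<omega>. sup01 (\<lambda>t. Y t \<omega>)) \<in> borel_measurable M"
  unfolding borel_measurable_iff_greater
proof
  fix x
  have Y: "(\<lambda>\<omega>. Y (real k / real (Suc n)) \<omega>) \<in> borel_measurable M" if "k \<le> Suc n" for n k
    using that by (intro assms(1)) (auto simp: divide_le_eq)
  have "{\<omega> \<in> space M. x < sup01 (\<lambda>t. Y t \<omega>)} = (\<Union>n. \<Union>k\<in>{..Suc n}. {\<omega> \<in> space M. x < Y (real k / real (Suc n)) \<omega>})"
    using less_sup01_iff_grid[OF assms(2)] by blast
  also have "\<dots> \<in> sets M"
    using borel_measurable_less[OF borel_measurable_const Y] by (intro sets.countable_UN' sets.finite_UN) auto
  finally show "{\<omega> \<in> space M. x < sup01 (\<lambda>t. Y t \<omega>)} \<in> sets M" .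
qed

subsection \<open>Expected perimeter\<close>

context prob_space
begin

lemma standard_bm_normalized:
  assumes "standard_brownian_motion X"
  shows "standard_bm M (\<lambda>t \<omega>. X t \<omega> - X 0 \<omega>)"
proof (intro standard_bm.intro standard_bm_axioms.intro)
  note X = assms[unfolded standard_brownian_motion_def]
  have d: "(X t \<omega> - X 0 \<omega>) - (X s \<omega> - X 0 \<omega>) = X t \<omega> - X s \<omega>" for s t \<omega> by simp
  show "standard_brownian_motion (\<lambda>t \<omega>. X t \<omega> - X 0 \<omega>)"
    unfolding standard_brownian_motion_def d
  proof (intro conjI allI impI ballI)
    show "random_variable borel (\<lambda>\<omega>. X t \<omega> - X 0 \<omega>)" if "0 \<le> t" for t
      using X that by (intro borel_measurable_diff) auto
    show "continuous_on {0..} (\<lambda>t. X t \<omega> - X 0 \<omega>)" if "\<omega> \<in> space M" for \<omega>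
      using X that by (intro continuous_intros) auto
  qed (use X in auto)
qed (auto intro: prob_space_axioms)

lemma distr_sup01_brownian_motion:
  assumes X: "standard_brownian_motion X"
  shows "distr M borel (\<lambda>\<omega>. sup01 (\<lambda>t. X t \<omega>)) = distr M borel (\<lambda>\<omega>. \<bar>X 1 \<omega> - X 0 \<omega>\<bar>)"
    and "AE \<omega> in M. 0 \<le> sup01 (\<lambda>t. X t \<omega>)"
proof -
  interpret bm: standard_bm M "\<lambda>t \<omega>. X t \<omega> - X 0 \<omega>" by (rule standard_bm_normalized[OF X])
  have X0: "AE \<omega> in M. X 0 \<omega> = 0" using X by (auto simp: standard_brownian_motion_def)
  have m: "random_variable borel (\<lambda>\<omega>. sup01 (\<lambda>t. X t \<omega>))"
    by (rule sup01_measurable) (use X in \<open>auto simp: standard_brownian_motion_def intro: continuous_on_subset\<close>)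
  have ae: "AE \<omega> in M. bm.path_sup 1 \<omega> = sup01 (\<lambda>t. X t \<omega>)"
    using X0 by eventually_elim (simp add: bm.path_sup_def sup01_def)
  have "distr M borel (\<lambda>\<omega>. sup01 (\<lambda>t. X t \<omega>)) = distr M borel (bm.path_sup 1)"
    using ae by (intro distr_cong_AE bm.path_sup_measurable m) (auto elim: eventually_mono)
  then show "distr M borel (\<lambda>\<omega>. sup01 (\<lambda>t. X t \<omega>)) = distr M borel (\<lambda>\<omega>. \<bar>X 1 \<omega> - X 0 \<omega>\<bar>)"
    using bm.distr_path_sup[of 1] by simp
  show "AE \<omega> in M. 0 \<le> sup01 (\<lambda>t. X t \<omega>)"
    using ae AE_space
  proof eventually_elim
    case (elim \<omega>)
    then show ?case using bm.path_sup_nonneg[of 1 \<omega>] by simp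
  qed
qed

text \<open>The hypothesis is on the time-changed process and not on \<open>Y\<close> as a bridge,
  since for a projection of the planar bridge only the time-changed process is known to be a
  Brownian motion.\<close>

lemma prob_sup01_bridge:
  assumes V: "standard_brownian_motion (\<lambda>s \<omega>. (1 + s) * Y (s / (1 + s)) \<omega>)"
    and Y: "\<And>t. t \<in> {0..1} \<Longrightarrow> random_variable borel (Y t)"
    and cont: "\<And>\<omega>. \<omega> \<in> space M \<Longrightarrow> continuous_on {0..1} (\<lambda>t. Y t \<omega>)"
    and Y1: "AE \<omega> in M. Y 1 \<omega> = 0" and x: "0 < x"
  shows "prob {\<omega> \<in> space M. x < sup01 (\<lambda>t. Y t \<omega>)} = exp (- 2 * x\<^sup>2)"
proof -
  let ?V = "\<lambda>s \<omega>. (1 + s) * Y (s / (1 + s)) \<omega>"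
  interpret bm: standard_bm M "\<lambda>t \<omega>. ?V t \<omega> - ?V 0 \<omega>" by (rule standard_bm_normalized[OF V])
  have Y0: "AE \<omega> in M. Y 0 \<omega> = 0" using V by (auto simp: standard_brownian_motion_def)
  let ?E = "{\<omega> \<in> space M. \<exists>s\<ge>0. x < (?V s \<omega> - ?V 0 \<omega>) - x * s}"
  have [measurable]: "random_variable borel (\<lambda>\<omega>. sup01 (\<lambda>t. Y t \<omega>))"
    by (rule sup01_measurable) (use Y cont in auto)
  have "prob {\<omega> \<in> space M. x < sup01 (\<lambda>t. Y t \<omega>)} = prob ?E"
  proof (rule finite_measure_eq_AE)
    show "AE \<omega> in M. \<omega> \<in> {\<omega> \<in> space M. x < sup01 (\<lambda>t. Y t \<omega>)} \<longleftrightarrow> \<omega> \<in> ?E"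
      using Y0 Y1 AE_space
    proof eventually_elim
      case (elim \<omega>)
      have "(\<exists>t\<in>{0..1}. x < Y t \<omega>) \<longleftrightarrow> (\<exists>s\<ge>0. x < (1 + s) * Y (s / (1 + s)) \<omega> - x * s)"
      proof
        assume "\<exists>t\<in>{0..1}. x < Y t \<omega>"
        then obtain t where t: "0 \<le> t" "t \<le> 1" "x < Y t \<omega>" by auto
        \<comment> \<open>The time 1 corresponds to s = \<infinity>; it is harmless because the path
          is 0 there and \<open>x\<close> is positive.\<close>
        then have "t \<noteq> 1" using elim x by auto
        then have t1: "t < 1" using t by simp
        define s where "s = t / (1 - t)"
        have s: "0 \<le> s" "1 + s = 1 / (1 - t)" using t t1 by (auto simp: s_def field_simps)
        have "s / (1 + s) = t" using t1 unfolding s(2) by (simp add: s_def)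
        moreover have "(1 + s) * x < (1 + s) * Y t \<omega>" using t(3) s(1) by simp
        ultimately have "x < (1 + s) * Y (s / (1 + s)) \<omega> - x * s" by (simp add: algebra_simps)
        with s(1) show "\<exists>s\<ge>0. x < (1 + s) * Y (s / (1 + s)) \<omega> - x * s" by blast
      next
        assume "\<exists>s\<ge>0. x < (1 + s) * Y (s / (1 + s)) \<omega> - x * s"
        then obtain s where s: "0 \<le> s" "x < (1 + s) * Y (s / (1 + s)) \<omega> - x * s" by auto
        then have "(1 + s) * x < (1 + s) * Y (s / (1 + s)) \<omega>" by (simp add: algebra_simps)
        then have "x < Y (s / (1 + s)) \<omega>" using s(1) by simp
        with s(1) show "\<exists>t\<in>{0..1}. x < Y t \<omega>" by (intro bexI[of _ "s / (1 + s)"]) auto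
      qed
      then show ?case using elim less_sup01_iff[OF cont, of \<omega> x] by simp
    qed
    show "?E \<in> events" using bm.prob_crosses_line(2)[of x x] x by simp
  qed measurable
  also have "\<dots> = exp (- 2 * x * x)" using bm.prob_crosses_line(1)[of x x] x by simp
  finally show ?thesis by (simp add: power2_eq_square mult.assoc)
qed

end

locale planar_brownian = prob_space +
  fixes W B :: "real \<Rightarrow> 'a \<Rightarrow> real ^ 2"
  assumes W: "planar_brownian_motion W" and B: "planar_brownian_bridge B"
    and WB: "indep_processes {0..} W {0..1} B"
begin

lemma W_measurable: "0 \<le> t \<Longrightarrow> random_variable borel (W t)"
  and B_measurable: "t \<in> {0..1} \<Longrightarrow> random_variable borel (B t)"
proof -
  have p: "random_variable (Pi\<^sub>M {0..} (\<lambda>_. borel)) (\<lambda>\<omega>. \<lambda>t\<in>{0..}. W t \<omega>)"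
    and q: "random_variable (Pi\<^sub>M {0..1} (\<lambda>_. borel)) (\<lambda>\<omega>. \<lambda>t\<in>{0..1}. B t \<omega>)"
    using WB unfolding indep_processes_def by (auto dest: indep_var_rv1 indep_var_rv2)
  show "random_variable borel (W t)" if "0 \<le> t"
    using measurable_compose[OF p measurable_component_singleton[of t "{0..}"]] that by simp
  show "random_variable borel (B t)" if "t \<in> {0..1}"
    using measurable_compose[OF q measurable_component_singleton[of t "{0..1}"]] that by simp
qed

lemma W_dir: "standard_brownian_motion (\<lambda>t \<omega>. W t \<omega> \<bullet> dir \<theta>)"
  unfolding inner_dir_right
  using W by (intro standard_brownian_motion_rotate) (auto simp: planar_brownian_motion_def)

text \<open>The rotation is applied after the time change, to the two Brownian motions obtained from
  the coordinates, so only Brownian motion has to be rotated.\<close>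

lemma B_dir: "standard_brownian_motion (\<lambda>s \<omega>. (1 + s) * (B (s / (1 + s)) \<omega> \<bullet> dir \<theta>))"
proof -
  have eq: "(1 + s) * (B (s / (1 + s)) \<omega> \<bullet> dir \<theta>)
    = cos \<theta> * ((1 + s) * B (s / (1 + s)) \<omega> $ 1) + sin \<theta> * ((1 + s) * B (s / (1 + s)) \<omega> $ 2)" for s \<omega>
    by (simp add: inner_dir_right algebra_simps)
  have f: "(\<lambda>p. \<lambda>s\<in>{0..}. (1 + s) * p (s / (1 + s))) \<in> Pi\<^sub>M {0..1} (\<lambda>_. borel :: real measure) \<rightarrow>\<^sub>M Pi\<^sub>M {0..} (\<lambda>_. borel)"
    by (intro measurable_restrict borel_measurable_times borel_measurable_const measurable_component_singleton) auto
  have ind: "indep_processes {0..1} (\<lambda>t \<omega>. B t \<omega> $ 1) {0..1} (\<lambda>t \<omega>. B t \<omega> $ 2)"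
    using B by (simp add: planar_brownian_bridge_def)
  have r: "(\<lambda>s\<in>{0..}. (1 + s) * (\<lambda>t\<in>{0..1}. b t) (s / (1 + s))) = (\<lambda>s\<in>{0..}. (1 + s) * b (s / (1 + s)))"
    for b :: "real \<Rightarrow> real" by (intro restrict_ext) auto
  show ?thesis unfolding eq
  proof (intro standard_brownian_motion_rotate)
    show "indep_processes {0..} (\<lambda>s \<omega>. (1 + s) * B (s / (1 + s)) \<omega> $ 1) {0..} (\<lambda>s \<omega>. (1 + s) * B (s / (1 + s)) \<omega> $ 2)"
      using indep_processes_compose[OF ind f f] unfolding r indep_processes_def .
  qed (use B in \<open>auto simp: planar_brownian_bridge_def intro: standard_brownian_motion_of_bridge\<close>)
qed

lemma W_dir_continuous: "\<omega> \<in> space M \<Longrightarrow> continuous_on {0..1} (\<lambda>t. W t \<omega> \<bullet> dir \<theta>)"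
  using W_dir[of \<theta>] by (auto simp: standard_brownian_motion_def intro: continuous_on_subset)

lemma B_dir_continuous:
  assumes "\<omega> \<in> space M"
  shows "continuous_on {0..1} (\<lambda>t. B t \<omega> \<bullet> dir \<theta>)"
proof -
  have "continuous_on {0..1} (\<lambda>t. B t \<omega> $ 1)" "continuous_on {0..1} (\<lambda>t. B t \<omega> $ 2)"
    using B assms unfolding planar_brownian_bridge_def standard_brownian_bridge_def by blast+
  then show ?thesis
    unfolding inner_dir_right by (intro continuous_on_add continuous_on_mult_left)
qed

lemma W_continuous: "\<omega> \<in> space M \<Longrightarrow> continuous_on {0..1} (\<lambda>t. W t \<omega>)"
  by (subst dir_decomp[of _ 0]) (intro continuous_intros W_dir_continuous)

lemma B_continuous: "\<omega> \<in> space M \<Longrightarrow> continuous_on {0..1} (\<lambda>t. B t \<omega>)"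
  by (subst dir_decomp[of _ 0]) (intro continuous_intros B_dir_continuous)

definition hW :: "real \<Rightarrow> 'a \<Rightarrow> real" where "hW \<theta> \<omega> = sup01 (\<lambda>t. W t \<omega> \<bullet> dir \<theta>)"
definition hB :: "real \<Rightarrow> 'a \<Rightarrow> real" where "hB \<theta> \<omega> = sup01 (\<lambda>t. B t \<omega> \<bullet> dir \<theta>)"
definition h :: "real \<Rightarrow> 'a \<Rightarrow> real" where "h \<theta> \<omega> = max (hW \<theta> \<omega>) (hB \<theta> \<omega>)"

lemma hW_measurable [measurable]: "random_variable borel (hW \<theta>)"
  unfolding hW_def using W_measurable by (intro sup01_measurable W_dir_continuous) auto

lemma hB_measurable [measurable]: "random_variable borel (hB \<theta>)"
  unfolding hB_def using B_measurable by (intro sup01_measurable B_dir_continuous) auto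

lemma h_measurable [measurable]: "random_variable borel (h \<theta>)"
  unfolding h_def by measurable

text \<open>The product sigma-algebra over uncountably many times sees only countably many
  coordinates at once. The suprema are therefore compared with \<open>x\<close> through grid times
  only, as the set \<open>E\<close> of paths; independence of the two processes then
  applies.\<close>

lemma prob_hW_hB:
  "prob {\<omega> \<in> space M. hW \<theta> \<omega> \<le> x \<and> x < hB \<theta> \<omega>} = prob {\<omega> \<in> space M. hW \<theta> \<omega> \<le> x} * prob {\<omega> \<in> space M. x < hB \<theta> \<omega>}"
proof -
  define E where "E I = {p \<in> space (Pi\<^sub>M I (\<lambda>_. borel)). \<exists>n. \<exists>k\<le>Suc n. x < p (real k / real (Suc n)) \<bullet> dir \<theta>}"
    for I :: "real set"
  have E: "E I \<in> sets (Pi\<^sub>M I (\<lambda>_. borel))" if "{0..1} \<subseteq> I" for I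
  proof -
    have m: "(\<lambda>p. p (real k / real (Suc n)) \<bullet> dir \<theta>) \<in> borel_measurable (Pi\<^sub>M I (\<lambda>_. borel))" if "k \<le> Suc n" for k n
    proof -
      have "real k / real (Suc n) \<in> I" using that by (intro subsetD[OF \<open>{0..1} \<subseteq> I\<close>]) (auto simp: divide_le_eq)
      then show ?thesis
        by (intro borel_measurable_inner measurable_component_singleton borel_measurable_const)
    qed
    have "E I = (\<Union>n. \<Union>k\<in>{..Suc n}. {p \<in> space (Pi\<^sub>M I (\<lambda>_. borel)). x < p (real k / real (Suc n)) \<bullet> dir \<theta>})"
      unfolding E_def by blast
    also have "\<dots> \<in> sets (Pi\<^sub>M I (\<lambda>_. borel))"
      using borel_measurable_less[OF borel_measurable_const m] by (intro sets.countable_UN' sets.finite_UN) auto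
    finally show ?thesis .
  qed
  let ?W = "\<lambda>\<omega>. \<lambda>t\<in>{0..}. W t \<omega>" and ?B = "\<lambda>\<omega>. \<lambda>t\<in>{0..1}. B t \<omega>"
  have t: "real k / real (Suc n) \<in> {0..1}" if "k \<le> Suc n" for k n using that by (auto simp: divide_le_eq)
  have iW: "?W \<omega> \<in> E {0..} \<longleftrightarrow> x < hW \<theta> \<omega>" if "\<omega> \<in> space M" for \<omega>
    unfolding hW_def less_sup01_iff_grid[OF W_dir_continuous[OF that]] E_def
    by (auto simp: space_PiM simp del: of_nat_Suc)
  have iB: "?B \<omega> \<in> E {0..1} \<longleftrightarrow> x < hB \<theta> \<omega>" if "\<omega> \<in> space M" for \<omega>
    unfolding hB_def less_sup01_iff_grid[OF B_dir_continuous[OF that]] E_def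
    using t by (auto simp: space_PiM simp del: of_nat_Suc)
  have "prob ((\<lambda>\<omega>. (?W \<omega>, ?B \<omega>)) -` ((space (Pi\<^sub>M {0..} (\<lambda>_. borel)) - E {0..}) \<times> E {0..1}) \<inter> space M)
    = prob (?W -` (space (Pi\<^sub>M {0..} (\<lambda>_. borel)) - E {0..}) \<inter> space M) * prob (?B -` E {0..1} \<inter> space M)"
    using WB unfolding indep_processes_def by (rule indep_varD) (auto intro!: E sets.compl_sets)
  also have "(\<lambda>\<omega>. (?W \<omega>, ?B \<omega>)) -` ((space (Pi\<^sub>M {0..} (\<lambda>_. borel)) - E {0..}) \<times> E {0..1}) \<inter> space M
    = {\<omega> \<in> space M. hW \<theta> \<omega> \<le> x \<and> x < hB \<theta> \<omega>}"
    using iW iB by (auto simp: space_PiM not_less[symmetric])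
  also have "?W -` (space (Pi\<^sub>M {0..} (\<lambda>_. borel)) - E {0..}) \<inter> space M = {\<omega> \<in> space M. hW \<theta> \<omega> \<le> x}"
    using iW by (auto simp: space_PiM not_less[symmetric])
  also have "?B -` E {0..1} \<inter> space M = {\<omega> \<in> space M. x < hB \<theta> \<omega>}"
    using iB by auto
  finally show ?thesis .
qed

lemma expectation_h: "has_bochner_integral M (h \<theta>) (sqrt (2 / pi) + arctan (1 / 2) / sqrt (2 * pi))"
  unfolding h_def
proof (rule expectation_max[where N = "\<lambda>\<omega>. W 1 \<omega> \<bullet> dir \<theta> - W 0 \<omega> \<bullet> dir \<theta>"])
  note bm = W_dir[of \<theta>]
  show "AE \<omega> in M. 0 \<le> hW \<theta> \<omega>" unfolding hW_def by (rule distr_sup01_brownian_motion(2)[OF bm])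
  show "distr M borel (hW \<theta>) = distr M borel (\<lambda>\<omega>. \<bar>W 1 \<omega> \<bullet> dir \<theta> - W 0 \<omega> \<bullet> dir \<theta>\<bar>)"
    unfolding hW_def by (rule distr_sup01_brownian_motion(1)[OF bm])
  show "distributed M lborel (\<lambda>\<omega>. W 1 \<omega> \<bullet> dir \<theta> - W 0 \<omega> \<bullet> dir \<theta>) std_normal_density"
    using bm[unfolded standard_brownian_motion_def, THEN conjunct2, THEN conjunct2, THEN conjunct2,
      THEN conjunct1, rule_format, of 0 1] by simp
  show "prob {\<omega> \<in> space M. x < hB \<theta> \<omega>} = exp (- 2 * x\<^sup>2)" if "0 < x" for x
    unfolding hB_def
  proof (rule prob_sup01_bridge[OF B_dir _ B_dir_continuous _ that])
    show "random_variable borel (\<lambda>\<omega>. B t \<omega> \<bullet> dir \<theta>)" if "t \<in> {0..1}" for t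
      by (intro borel_measurable_inner B_measurable that borel_measurable_const)
    have "AE \<omega> in M. B 0 \<omega> $ 1 = 0 \<and> B 1 \<omega> $ 1 = 0" "AE \<omega> in M. B 0 \<omega> $ 2 = 0 \<and> B 1 \<omega> $ 2 = 0"
      using B unfolding planar_brownian_bridge_def standard_brownian_bridge_def by blast+
    then show "AE \<omega> in M. B 1 \<omega> \<bullet> dir \<theta> = 0" by eventually_elim (simp add: inner_dir_right)
  qed
qed (simp_all add: prob_hW_hB)

section \<open>The random hull and its nondegeneracy\<close>

definition range_hull :: "'a \<Rightarrow> (real ^ 2) set" where
  "range_hull \<omega> = convex hull ((\<lambda>t. W t \<omega>) ` {0..1} \<union> (\<lambda>t. B t \<omega>) ` {0..1})"

lemma compact_paths:
  assumes "\<omega> \<in> space M"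
  shows "compact ((\<lambda>t. W t \<omega>) ` {0..1} \<union> (\<lambda>t. B t \<omega>) ` {0..1})"
  by (intro compact_Un compact_continuous_image W_continuous B_continuous assms compact_Icc)

lemma range_hull:
  assumes "\<omega> \<in> space M"
  shows "compact (range_hull \<omega>)" "convex (range_hull \<omega>)" "range_hull \<omega> \<noteq> {}"
  using compact_paths[OF assms] by (auto simp: range_hull_def intro: compact_convex_hull convex_convex_hull)

lemma support_range_hull:
  assumes \<omega>: "\<omega> \<in> space M"
  shows "support (range_hull \<omega>) (dir \<theta>) = h \<theta> \<omega>"
proof -
  have "support (range_hull \<omega>) (dir \<theta>) = support ((\<lambda>t. W t \<omega>) ` {0..1} \<union> (\<lambda>t. B t \<omega>) ` {0..1}) (dir \<theta>)"
    unfolding range_hull_def by (rule support_convex_hull[OF compact_imp_bounded[OF compact_paths[OF \<omega>]]]) simp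
  also have "\<dots> = sup (SUP t\<in>{0..1}. W t \<omega> \<bullet> dir \<theta>) (SUP t\<in>{0..1}. B t \<omega> \<bullet> dir \<theta>)"
    unfolding support_def
    using sup01_bdd[OF W_dir_continuous[OF \<omega>]] sup01_bdd[OF B_dir_continuous[OF \<omega>]]
    by (subst cSUP_union) (auto simp: image_image)
  finally show ?thesis by (simp add: h_def hW_def hB_def sup01_def sup_max)
qed

lemma W_0: "AE \<omega> in M. W 0 \<omega> = 0"
proof -
  have "AE \<omega> in M. W 0 \<omega> $ 1 = 0" "AE \<omega> in M. W 0 \<omega> $ 2 = 0"
    using W unfolding planar_brownian_motion_def standard_brownian_motion_def by blast+
  then show ?thesis by eventually_elim (simp add: vec_eq_iff forall_2)
qed

lemma bm_no_atom:
  assumes X: "standard_brownian_motion X"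
  shows "AE \<omega> in M. X 1 \<omega> \<noteq> 0"
proof -
  have "distributed M lborel (\<lambda>\<omega>. X 1 \<omega> - X 0 \<omega>) (normal_density 0 (sqrt (1 - 0)))"
    using X[unfolded standard_brownian_motion_def, THEN conjunct2, THEN conjunct2, THEN conjunct2,
      THEN conjunct1, rule_format, of 0 1] by simp
  then have "AE \<omega> in M. X 1 \<omega> - X 0 \<omega> \<noteq> 0" by (rule distributed_no_atom)
  moreover have "AE \<omega> in M. X 0 \<omega> = 0"
    using X unfolding standard_brownian_motion_def by blast
  ultimately show ?thesis by eventually_elim simp
qed

text \<open>For a fixed nonzero value of \<open>W 1\<close> the determinant is a nonzero multiple of
  the projection of \<open>B (1 / 2)\<close> to the orthogonal direction, a law without atom.
  Independence and Fubini complete the argument.\<close>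

lemma W_B_independent_directions: "AE \<omega> in M. W 1 \<omega> $ 1 * B (1 / 2) \<omega> $ 2 - W 1 \<omega> $ 2 * B (1 / 2) \<omega> $ 1 \<noteq> 0"
proof -
  have mW [measurable]: "random_variable borel (W 1)" and mB [measurable]: "random_variable borel (B (1 / 2))"
    by (intro W_measurable B_measurable; simp)+
  let ?P = "distr M borel (W 1)" and ?Q = "distr M borel (B (1 / 2))"
  interpret P: prob_space ?P by (rule prob_space_distr[OF mW])
  interpret Q: prob_space ?Q by (rule prob_space_distr[OF mB])
  interpret PQ: pair_sigma_finite ?P ?Q ..
  have "indep_var borel (\<lambda>\<omega>. (\<lambda>p. p 1) (\<lambda>t\<in>{0..}. W t \<omega>)) borel (\<lambda>\<omega>. (\<lambda>p. p (1 / 2)) (\<lambda>t\<in>{0..1}. B t \<omega>))"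
    by (rule indep_processes_compose[OF WB]) (intro measurable_component_singleton; simp)+
  then have PQ: "?P \<Otimes>\<^sub>M ?Q = distr M (borel \<Otimes>\<^sub>M borel) (\<lambda>\<omega>. (W 1 \<omega>, B (1 / 2) \<omega>))"
    by (simp add: indep_var_distribution_eq)
  have [measurable]: "(\<lambda>x :: real ^ 2. x $ i) \<in> borel_measurable borel" for i
    by (intro borel_measurable_continuous_onI continuous_intros)
  have B_nz: "AE y in ?Q. y \<bullet> dir \<psi> \<noteq> 0" for \<psi>
  proof -
    \<comment> \<open>At time s = 1 the Brownian motion of \<open>B_dir\<close> is twice the
      projection of \<open>B (1 / 2)\<close>.\<close>
    have "AE \<omega> in M. B (1 / 2) \<omega> \<bullet> dir \<psi> \<noteq> 0"
      using bm_no_atom[OF B_dir[of \<psi>]] by simp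
    then show ?thesis by (subst AE_distr_iff) auto
  qed
  have W_nz: "AE x in ?P. x \<noteq> 0"
  proof -
    have "AE \<omega> in M. W 1 \<omega> \<noteq> 0"
      using bm_no_atom[OF W_dir[of 0]] by eventually_elim auto
    then show ?thesis by (subst AE_distr_iff) auto
  qed
  have "AE z in ?P \<Otimes>\<^sub>M ?Q. fst z $ 1 * snd z $ 2 - fst z $ 2 * snd z $ 1 \<noteq> 0"
  proof (rule PQ.AE_pair_measure)
    show "{z \<in> space (?P \<Otimes>\<^sub>M ?Q). fst z $ 1 * snd z $ 2 - fst z $ 2 * snd z $ 1 \<noteq> 0} \<in> sets (?P \<Otimes>\<^sub>M ?Q)"
      by measurable
    show "AE x in ?P. AE y in ?Q. fst (x, y) $ 1 * snd (x, y) $ 2 - fst (x, y) $ 2 * snd (x, y) $ 1 \<noteq> 0"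
      using W_nz
    proof eventually_elim
      case (elim x)
      obtain \<phi> where \<phi>: "x = norm x *\<^sub>R dir \<phi>" using vec2_polar .
      have "x $ 1 * y $ 2 - x $ 2 * y $ 1 = norm x * (y \<bullet> dir (\<phi> + pi / 2))" for y
        by (subst (1 2) \<phi>) (simp add: inner_dir_right sin_add cos_add algebra_simps)
      with elim B_nz[of "\<phi> + pi / 2"] show ?case by simp
    qed
  qed
  then show ?thesis unfolding PQ by (subst (asm) AE_distr_iff) auto
qed

text \<open>The hull contains the three points 0, \<open>W 1\<close> and \<open>B (1 / 2)\<close>,
  which are almost surely not collinear.\<close>

lemma interior_range_hull: "AE \<omega> in M. interior (range_hull \<omega>) \<noteq> {}"
  using W_0 W_B_independent_directions
proof eventually_elim
  case (elim \<omega>)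
  let ?x = "W 1 \<omega>" and ?y = "B (1 / 2) \<omega>"
  have mem: "0 \<in> range_hull \<omega>" "?x \<in> range_hull \<omega>" "?y \<in> range_hull \<omega>"
    unfolding range_hull_def elim(1)[symmetric] by (auto intro!: hull_inc)
  show ?case
  proof
    assume "interior (range_hull \<omega>) = {}"
    then obtain a b where ab: "a \<noteq> 0" "range_hull \<omega> \<subseteq> {x. a \<bullet> x = b}"
      using empty_interior_subset_hyperplane[of "range_hull \<omega>"] by (auto simp: range_hull_def convex_convex_hull)
    have "b = 0" using ab(2) mem(1) by auto
    then have 1: "a $ 1 * ?x $ 1 + a $ 2 * ?x $ 2 = 0" and 2: "a $ 1 * ?y $ 1 + a $ 2 * ?y $ 2 = 0"
      using ab(2) mem(2,3) by (auto simp: inner_vec_def sum_2)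
    define d where "d = ?x $ 1 * ?y $ 2 - ?x $ 2 * ?y $ 1"
    \<comment> \<open>Cramer's rule: a normal vector orthogonal to two vectors with determinant
      \<open>d\<close> satisfies \<open>d\<close> times each coordinate = 0.\<close>
    have "a $ 1 * d = ?y $ 2 * (a $ 1 * ?x $ 1 + a $ 2 * ?x $ 2) - ?x $ 2 * (a $ 1 * ?y $ 1 + a $ 2 * ?y $ 2)"
      "a $ 2 * d = ?x $ 1 * (a $ 1 * ?y $ 1 + a $ 2 * ?y $ 2) - ?y $ 1 * (a $ 1 * ?x $ 1 + a $ 2 * ?x $ 2)"
      by (simp_all add: d_def algebra_simps)
    then have "a $ 1 * d = 0" "a $ 2 * d = 0" unfolding 1 2 by auto
    moreover have "d \<noteq> 0" using elim(2) by (simp add: d_def)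
    ultimately have "a = 0" by (simp add: vec_eq_iff forall_2)
    with ab(1) show False by simp
  qed
qed

definition width :: "real \<Rightarrow> 'a \<Rightarrow> real" where "width \<theta> \<omega> = h \<theta> \<omega> + h (\<theta> + pi) \<omega>"

lemma width_measurable [measurable]: "random_variable borel (width \<theta>)"
  unfolding width_def by measurable

text \<open>A compact convex set has empty interior iff its widths come arbitrarily close to 0.
  Widths depend continuously on the direction, so rational angles suffice, and the degenerate hulls
  form an event.\<close>

lemma degenerate_iff:
  assumes \<omega>: "\<omega> \<in> space M"
  shows "interior (range_hull \<omega>) = {} \<longleftrightarrow> (\<forall>m. \<exists>q::rat. width (of_rat q) \<omega> < 1 / real (Suc m))"
proof
  let ?K = "range_hull \<omega>"
  note K = range_hull[OF \<omega>]
  have bK: "bounded ?K" using K(1) by (rule compact_imp_bounded)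
  have sup: "h \<theta> \<omega> = support ?K (dir \<theta>)" for \<theta> using support_range_hull[OF \<omega>] by simp
  show "\<forall>m. \<exists>q::rat. width (of_rat q) \<omega> < 1 / real (Suc m)" if int: "interior ?K = {}"
  proof
    fix m
    obtain a b where ab: "a \<noteq> 0" "?K \<subseteq> {x. a \<bullet> x = b}"
      using empty_interior_subset_hyperplane[OF K(2) int] by blast
    obtain \<theta> where \<theta>: "a = norm a *\<^sub>R dir \<theta>" using vec2_polar .
    define \<beta> where "\<beta> = b / norm a"
    have K_line: "x \<bullet> dir \<theta> = \<beta>" if "x \<in> ?K" for x
    proof -
      have "norm a * (x \<bullet> dir \<theta>) = a \<bullet> x" by (subst (2) \<theta>) (simp add: inner_commute)
      also have "\<dots> = b" using ab that by auto
      finally show ?thesis using ab(1) by (simp add: \<beta>_def field_simps)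
    qed
    obtain R where R: "0 < R" "\<And>x. x \<in> ?K \<Longrightarrow> norm x \<le> R" using bK by (auto simp: bounded_pos)
    \<comment> \<open>The width is 0 at \<open>\<theta>\<close> and at most 2 R \<delta> at an angle
      larger by \<delta>.\<close>
    have "\<theta> < \<theta> + 1 / (2 * R * real (Suc m))" using R(1) by simp
    then obtain q where q: "\<theta> < of_rat q" "of_rat q < \<theta> + 1 / (2 * R * real (Suc m))"
      using of_rat_dense by blast
    define \<delta> where "\<delta> = of_rat q - \<theta>"
    have le: "x \<bullet> dir (of_rat q) \<le> \<beta> + R * \<delta>" "x \<bullet> (- dir (of_rat q)) \<le> - \<beta> + R * \<delta>" if "x \<in> ?K" for x
    proof -
      have "\<bar>x \<bullet> (dir (of_rat q) - dir \<theta>)\<bar> \<le> norm x * norm (dir (of_rat q) - dir \<theta>)"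
        by (rule Cauchy_Schwarz_ineq2)
      also have "\<dots> \<le> R * \<delta>"
        using norm_dir_diff_le[of "of_rat q" \<theta>] q(1) R that by (intro mult_mono) (auto simp: \<delta>_def)
      finally show "x \<bullet> dir (of_rat q) \<le> \<beta> + R * \<delta>" "x \<bullet> (- dir (of_rat q)) \<le> - \<beta> + R * \<delta>"
        using K_line[OF that] by (auto simp: inner_diff_right)
    qed
    have "width (of_rat q) \<omega> \<le> (\<beta> + R * \<delta>) + (- \<beta> + R * \<delta>)"
      unfolding width_def sup dir_plus_pi
      using le by (intro add_mono; subst support_le_iff[OF bK K(3)]; blast)
    also have "\<dots> < 1 / real (Suc m)"
    proof -
      have "\<delta> < 1 / (2 * R * real (Suc m))" using q(2) by (simp add: \<delta>_def)
      then have "2 * R * \<delta> < 2 * R * (1 / (2 * R * real (Suc m)))" using R(1) by (intro mult_strict_left_mono) auto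
      also have "\<dots> = 1 / real (Suc m)" using R(1) by simp
      finally show ?thesis by simp
    qed
    finally show "\<exists>q::rat. width (of_rat q) \<omega> < 1 / real (Suc m)" by blast
  qed
  show "interior ?K = {}" if small: "\<forall>m. \<exists>q::rat. width (of_rat q) \<omega> < 1 / real (Suc m)"
  proof (rule ccontr)
    assume "interior ?K \<noteq> {}"
    then obtain c r where cr: "0 < r" "cball c r \<subseteq> ?K" using mem_interior_cball by blast
    have "c \<bullet> dir \<theta> + r \<le> h \<theta> \<omega>" for \<theta>
    proof -
      have "c + r *\<^sub>R dir \<theta> \<in> ?K" using cr(1) by (intro subsetD[OF cr(2)]) (simp add: dist_norm)
      from inner_le_support[OF bK this, of "dir \<theta>"] show ?thesis by (simp add: sup inner_add_left)
    qed
    note ge = this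
    obtain m where m: "1 / real (Suc m) < r" using cr(1) by (metis nat_approx_posE)
    obtain q where "width (of_rat q) \<omega> < 1 / real (Suc m)" using small by blast
    moreover have "2 * r \<le> width (of_rat q) \<omega>"
      using ge[of "of_rat q"] ge[of "of_rat q + pi"] by (simp add: width_def)
    ultimately show False using m cr(1) by linarith
  qed
qed

section \<open>Measurability and expectation of the perimeter\<close>

definition riemann_sum :: "nat \<Rightarrow> 'a \<Rightarrow> real" where
  "riemann_sum n \<omega> = 2 * tan (pi / n) * (\<Sum>k<n. h (real k * (2 * pi / n)) \<omega>)"

lemma riemann_sum_measurable [measurable]: "random_variable borel (riemann_sum n)"
  unfolding riemann_sum_def by measurable

lemma riemann_sum_eq: "\<omega> \<in> space M \<Longrightarrow> riemann_sum n \<omega> = support_sum (range_hull \<omega>) n"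
  by (simp add: riemann_sum_def support_sum_def support_range_hull)

lemma riemann_sum_tendsto:
  assumes "\<omega> \<in> space M" "interior (range_hull \<omega>) \<noteq> {}"
  shows "(\<lambda>n. riemann_sum n \<omega>) \<longlonglongrightarrow> perimeter (range_hull \<omega>)"
  using support_sum_tendsto_perimeter[OF range_hull(1,2)[OF assms(1)] assms(2)] riemann_sum_eq[OF assms(1)]
  by simp

text \<open>On the null event that the hull is degenerate, \<^const>\<open>perimeter\<close> is the length of a segment and
  not twice that length; the case distinction is needed because the expectation of a function that is
  not measurable is 0.\<close>

lemma perimeter_measurable: "(\<lambda>\<omega>. perimeter (range_hull \<omega>)) \<in> borel_measurable M"
proof -
  define D where "D = {\<omega> \<in> space M. \<forall>m. \<exists>q::rat. width (of_rat q) \<omega> < 1 / real (Suc m)}"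
  have [measurable]: "D \<in> events" unfolding D_def by measurable
  have "(\<lambda>\<omega>. if \<omega> \<in> D then sqrt ((width 0 \<omega>)\<^sup>2 + (width (pi / 2) \<omega>)\<^sup>2) else lim (\<lambda>n. riemann_sum n \<omega>)) \<in> borel_measurable M"
    by measurable
  moreover have "perimeter (range_hull \<omega>) = (if \<omega> \<in> D then sqrt ((width 0 \<omega>)\<^sup>2 + (width (pi / 2) \<omega>)\<^sup>2) else lim (\<lambda>n. riemann_sum n \<omega>))"
    if \<omega>: "\<omega> \<in> space M" for \<omega>
  proof (cases "\<omega> \<in> D")
    case True
    then have "interior (range_hull \<omega>) = {}" using degenerate_iff[OF \<omega>] by (simp add: D_def)
    from perimeter_empty_interior[OF range_hull[OF \<omega>] this] True show ?thesis
      by (simp add: support_range_hull[OF \<omega>] width_def del: dir_plus_pi)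
  next
    case False
    then have "interior (range_hull \<omega>) \<noteq> {}" using degenerate_iff[OF \<omega>] \<omega> by (simp add: D_def)
    from limI[OF riemann_sum_tendsto[OF \<omega> this]] False show ?thesis by simp
  qed
  ultimately show ?thesis by (subst measurable_cong) auto
qed

text \<open>The support value has the same mean in every direction, so the mean of each Riemann sum
  is that mean times the total weight 2 n tan (pi / n), which tends to 2 pi. Dominated convergence
  passes to the perimeter.\<close>

lemma expectation_perimeter:
  "expectation (\<lambda>\<omega>. perimeter (range_hull \<omega>)) = sqrt (2 * pi) * (2 + arctan (1 / 2))"
proof -
  define m where "m = sqrt (2 / pi) + arctan (1 / 2) / sqrt (2 * pi)"
  have int_h: "integrable M (h \<theta>)" and exp_h: "expectation (h \<theta>) = m" for \<theta>
    using expectation_h[of \<theta>] by (auto simp: has_bochner_integral_iff m_def)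
  \<comment> \<open>The hull contains 0 almost surely, so the support values in the four coordinate
    directions bound the coordinates of its points, and with them the support value in every
    direction at once.\<close>
  define G where "G \<omega> = h 0 \<omega> + h pi \<omega> + h (pi / 2) \<omega> + h (pi / 2 + pi) \<omega>" for \<omega>
  have int_G: "integrable M G" unfolding G_def by (intro Bochner_Integration.integrable_add int_h)
  have h_bound: "AE \<omega> in M. \<forall>\<theta>. 0 \<le> h \<theta> \<omega> \<and> h \<theta> \<omega> \<le> G \<omega>"
    using W_0 AE_space
  proof eventually_elim
    case (elim \<omega>)
    let ?K = "range_hull \<omega>"
    have bK: "bounded ?K" using range_hull(1)[OF elim(2)] by (rule compact_imp_bounded)
    have sup: "support ?K (dir \<theta>) = h \<theta> \<omega>" for \<theta> by (rule support_range_hull[OF elim(2)])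
    have "0 \<in> ?K" unfolding range_hull_def elim(1)[symmetric] by (auto intro!: hull_inc)
    then have h0: "0 \<le> h \<theta> \<omega>" for \<theta> using inner_le_support[OF bK, of 0 "dir \<theta>"] by (simp add: sup)
    have "h \<theta> \<omega> \<le> G \<omega>" for \<theta>
      unfolding sup[symmetric, of \<theta>]
    proof (subst support_le_iff[OF bK range_hull(3)[OF elim(2)]], intro ballI)
      fix x assume x: "x \<in> ?K"
      have i: "x \<bullet> dir t \<le> h t \<omega>" for t using inner_le_support[OF bK x, of "dir t"] by (simp add: sup)
      have "\<bar>x $ 1\<bar> \<le> h 0 \<omega> + h pi \<omega>" "\<bar>x $ 2\<bar> \<le> h (pi / 2) \<omega> + h (pi / 2 + pi) \<omega>"
        using i[of 0] i[of pi] i[of "pi / 2"] i[of "pi / 2 + pi", unfolded dir_plus_pi] h0[of 0] h0[of pi] h0[of "pi / 2"] h0[of "pi / 2 + pi"]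
        by (auto simp: inner_dir_right)
      moreover have "cos \<theta> * x $ 1 \<le> \<bar>x $ 1\<bar>" "sin \<theta> * x $ 2 \<le> \<bar>x $ 2\<bar>"
      proof -
        have "\<bar>cos \<theta>\<bar> * \<bar>x $ 1\<bar> \<le> 1 * \<bar>x $ 1\<bar>" "\<bar>sin \<theta>\<bar> * \<bar>x $ 2\<bar> \<le> 1 * \<bar>x $ 2\<bar>"
          by (intro mult_right_mono; simp)+
        then show "cos \<theta> * x $ 1 \<le> \<bar>x $ 1\<bar>" "sin \<theta> * x $ 2 \<le> \<bar>x $ 2\<bar>"
          by (auto simp: abs_mult[symmetric] intro: order.trans[OF abs_ge_self])
      qed
      ultimately show "x \<bullet> dir \<theta> \<le> G \<omega>" by (simp add: inner_dir_right G_def)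
    qed
    with h0 show ?case by blast
  qed
  have tan_lim: "(\<lambda>n. real n * tan (pi / real n)) \<longlonglongrightarrow> pi" by real_asymp
  \<comment> \<open>A convergent sequence is bounded as a whole, so one constant serves all
    \<open>n\<close>, also the small ones for which the tangent is no approximation.\<close>
  have "Bseq (\<lambda>n. real n * tan (pi / real n))"
    by (rule convergent_imp_Bseq[OF convergentI[OF tan_lim]])
  then obtain C where C: "\<And>n. \<bar>real n * tan (pi / real n)\<bar> \<le> C"
    unfolding Bseq_def real_norm_def by blast
  have exp_sum: "expectation (riemann_sum n) = 2 * (real n * tan (pi / real n)) * m" for n
    unfolding riemann_sum_def by (simp add: int_h exp_h Bochner_Integration.integral_sum)
  have "(\<lambda>n. expectation (riemann_sum n)) \<longlonglongrightarrow> expectation (\<lambda>\<omega>. perimeter (range_hull \<omega>))"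
  proof (rule integral_dominated_convergence[where w = "\<lambda>\<omega>. 2 * C * G \<omega>"])
    show "(\<lambda>\<omega>. perimeter (range_hull \<omega>)) \<in> borel_measurable M" by (rule perimeter_measurable)
    show "integrable M (\<lambda>\<omega>. 2 * C * G \<omega>)" by (intro integrable_mult_right int_G)
    show "AE \<omega> in M. (\<lambda>n. riemann_sum n \<omega>) \<longlonglongrightarrow> perimeter (range_hull \<omega>)"
      using interior_range_hull AE_space by eventually_elim (rule riemann_sum_tendsto)
    show "AE \<omega> in M. norm (riemann_sum n \<omega>) \<le> 2 * C * G \<omega>" for n
      using h_bound
    proof eventually_elim
      case (elim \<omega>)
      let ?s = "\<Sum>k<n. h (real k * (2 * pi / n)) \<omega>"
      have s: "0 \<le> ?s" "?s \<le> real n * G \<omega>"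
        using elim sum_bounded_above[of "{..<n}" "\<lambda>k. h (real k * (2 * pi / n)) \<omega>" "G \<omega>"] by (auto intro: sum_nonneg)
      have G0: "0 \<le> G \<omega>" using elim by (meson order.trans)
      have "norm (riemann_sum n \<omega>) = 2 * \<bar>tan (pi / real n)\<bar> * ?s"
        using s(1) by (simp add: riemann_sum_def abs_mult)
      also have "\<dots> \<le> 2 * \<bar>tan (pi / real n)\<bar> * (real n * G \<omega>)"
        using s(2) by (intro mult_left_mono) auto
      also have "\<dots> = 2 * \<bar>real n * tan (pi / real n)\<bar> * G \<omega>" by (simp add: abs_mult)
      also have "\<dots> \<le> 2 * C * G \<omega>" using C[of n] G0 by (intro mult_right_mono mult_left_mono) auto
      finally show ?case .
    qed
  qed measurable
  moreover have "(\<lambda>n. expectation (riemann_sum n)) \<longlonglongrightarrow> 2 * pi * m"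
    unfolding exp_sum by (intro tendsto_intros tan_lim)
  ultimately have "expectation (\<lambda>\<omega>. perimeter (range_hull \<omega>)) = 2 * pi * m" by (rule LIMSEQ_unique)
  also have "2 * pi * m = sqrt (2 * pi) * (2 + arctan (1 / 2))"
  proof -
    have "sqrt (2 * pi) * sqrt (2 * pi) = 2 * pi" "sqrt (2 * pi) * sqrt (2 / pi) = 2"
      by (simp_all add: real_sqrt_mult[symmetric])
    then have 1: "2 * pi * sqrt (2 / pi) = sqrt (2 * pi) * 2"
      and 2: "2 * pi * (arctan (1 / 2) / sqrt (2 * pi)) = sqrt (2 * pi) * arctan (1 / 2)"
      by (metis mult.assoc, simp add: field_simps)
    show ?thesis unfolding m_def distrib_left 1 2 ..
  qed
  finally show ?thesis .
qed

end

theorem theorem1p1: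
  fixes M :: "'a measure" and W B :: "real \<Rightarrow> 'a \<Rightarrow> real ^ 2"
    and H :: "'a \<Rightarrow> (real ^ 2) set" and L :: "'a \<Rightarrow> real"
  assumes "prob_space M"
    and "prob_space.planar_brownian_motion M W"
    and "prob_space.planar_brownian_bridge M B"
    and "prob_space.indep_processes M {0..} W {0..1} B"
    and "\<And>\<omega>. H \<omega> = convex hull ((\<lambda>t. W t \<omega>) ` {0..1} \<union> (\<lambda>t. B t \<omega>) ` {0..1})"
    and "\<And>\<omega>. L \<omega> = perimeter (H \<omega>)"
  shows "prob_space.expectation M L = sqrt (2 * pi) * (2 + arctan (1 / 2))"
proof -
  interpret planar_brownian M W B
    using assms(1-4) by (intro planar_brownian.intro planar_brownian_axioms.intro)
  have "L = (\<lambda>\<omega>. perimeter (range_hull \<omega>))"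
    by (simp add: fun_eq_iff assms(5,6) range_hull_def)
  then show ?thesis using expectation_perimeter by simp
qed

end
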